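(* Let $V,U\ge 0$ be independent random variables with $\mathbb{E}[V]=\mathbb{E}[U]=1$, variances satisfying $0<\sigma_V^2+\sigma_U^2<\infty$, and such that for some $\delta_0>0$ the functions $z\mapsto \mathbb{E}[e^{zV}]$ and $z\mapsto\mathbb{E}[e^{zU}]$ are analytic in an open strip containing $-\delta_0\le \mathrm{Re}(z)\le\delta_0$. Assume moreover that the separation assumption (A) of the context holds. Let $\rho_n\in(0,1)$, $n=1,2,\dots$, be such that there are fixed $0<\beta_1\le\beta_2<\infty$ with $(1-\rho_n)\sqrt n\in[\beta_1,\beta_2]$ for all $n$. Let $W_n$ be the steady-state waiting time of the nearly deterministic $\mathrm{GI}_n/\mathrm{G}_n/1$ queue built from $V,U,\rho_n$. For $n$ sufficiently large, let $\zeta_{sp}$ be the saddle point on the negative real axis of $h(\zeta)=\log\psi(-\zeta;\rho_n)$, and put $$\sigma_n=\big(h''(\zeta_{sp})\big)^{1/2},\qquad \beta_n=-\zeta_{sp}\,\sigma_n\sqrt n .$$ Then $\sigma_n\asymp1$ and $\beta_n\asymp1$ as $n\to\infty$, and $$\mathbb{E}\Big[\exp\Big(-s\,\frac{\sqrt n}{\sigma_n}\,W_n\Big)\Big]=\mathbb{E}\big[\exp(-sM_{\beta_n})\big]+O\Big(\frac1{\sqrt n}\Big),\qquad n\to\infty,$$ uniformly in any bounded set of complex $s$ with $\mathrm{Re}(s)\ge-\frac12\beta_n$. That is, for every bounded $S\subset\mathbb{C}$ there are $K<\infty$ and $n_0$ such that for all $n\ge n_0$ and all $s\in S$ with $\mathrm{Re}(s)\ge-\frac12\beta_n$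 both expectations exist and differ by at most $K/\sqrt n$ in modulus.
   Context: Nearly deterministic $\mathrm{GI}_n/\mathrm{G}_n/1$ queue: $V_n=\frac1n\sum_{k=1}^n V_{n,k}$ and $U_n=\frac1n\sum_{k=1}^nU_{n,k}$, where the $V_{n,k}$ are i.i.d. copies of $V$, the $U_{n,k}$ are i.i.d. copies of $U$, and all of these are independent. The steady-state waiting time $W_n\ge0$ is the (finite) random variable whose distribution is the stationary solution of $W_n\stackrel{d}{=}\big(W_n+V_n-\frac1{\rho_n}U_n\big)^+$, where $x^+=\max\{0,x\}$ and on the right-hand side $W_n,V_n,U_n$ are independent. For $\rho\in(0,1]$ let $\psi(s)=\psi(s;\rho)=\mathbb{E}\big[e^{s(V-\frac1\rho U)}\big]$. Assumption (A): there are $\delta>0$ (with $\mathbb{E}[e^{\delta V}]<\infty$, so that the quantities below are defined) and $\varepsilon>0$ such that for all $\rho\in[\frac12,1)$, all $x\in[-\delta,0)$ and all $y\in\mathbb{R}$ with $|y|>\delta$ one has $|\psi(-x+iy;\rho)|<\psi(-x;\rho)-\varepsilon$. Saddle point: $h(\zeta)=\log\psi(-\zeta;\rho_n)$ is, on a sufficiently small fixed interval $[-\delta',0]$, a convex function with $h(0)=0$, $h'(0)=\frac1{\rho_n}-1>0$; for $\rho_n$ sufficiently close to 1 (hence $n$ sufficiently large) it has a unique point $\zeta_{sp}\in[-\delta',0]$ with $h'(\zeta_{sp})=0$. This $\zeta_{sp}$ (depending on $n$) is the saddle point. Gaussian random walk: for $\beta>0$, $M_\beta=\max_{k\ge0}S_k$,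 where $S_0=0$ and $S_k$ is the sum of $k$ i.i.d. normal random variables with mean $-\beta$ and variance 1. $a_n\asymp1$ means that there are constants $0<c\le C<\infty$ with $c\le a_n\le C$ for all sufficiently large $n$. *)

theory Defs
  imports "HOL-Probability.Probability"
begin

definition mgf_analytic_on_strip :: "'a measure \<Rightarrow> ('a \<Rightarrow> real) \<Rightarrow> real \<Rightarrow> bool" where
  "mgf_analytic_on_strip M X d \<longleftrightarrow>
    (\<exists>a b. a < - d \<and> d < b \<and>
      (\<forall>z::complex. a < Re z \<and> Re z < b \<longrightarrow>
         integrable M (\<lambda>\<omega>. exp (z * complex_of_real (X \<omega>)))) \<and>
      (\<lambda>z::complex. LINT \<omega>|M. exp (z * complex_of_real (X \<omega>)))
         analytic_on {z. a < Re z \<and> Re z < b})"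

definition psi ::
  "'a measure \<Rightarrow> ('a \<Rightarrow> real) \<Rightarrow> ('a \<Rightarrow> real) \<Rightarrow> real \<Rightarrow> complex \<Rightarrow> complex" where
  "psi M V U r s = (LINT \<omega>|M. exp (s * complex_of_real (V \<omega> - U \<omega> / r)))"

text \<open>At a real point \<open>psi\<close> is real, so taking the real part only changes the type.\<close>

definition separation :: "'a measure \<Rightarrow> ('a \<Rightarrow> real) \<Rightarrow> ('a \<Rightarrow> real) \<Rightarrow> bool" where
  "separation M V U \<longleftrightarrow>
    (\<exists>\<delta>>0. \<exists>\<epsilon>>0. integrable M (\<lambda>\<omega>. exp (\<delta> * V \<omega>)) \<and>
      (\<forall>r\<in>{1/2..<1}. \<forall>x\<in>{-\<delta>..<0}. \<forall>y::real. \<bar>y\<bar> > \<delta> \<longrightarrow>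
         cmod (psi M V U r (Complex (- x) y)) < Re (psi M V U r (complex_of_real (- x))) - \<epsilon>))"

definition log_psi ::
  "'a measure \<Rightarrow> ('a \<Rightarrow> real) \<Rightarrow> ('a \<Rightarrow> real) \<Rightarrow> real \<Rightarrow> real \<Rightarrow> real" where
  "log_psi M V U r \<zeta> = ln (Re (psi M V U r (complex_of_real (- \<zeta>))))"

text \<open>The interval is part of the notion: the Bochner integral defining \<open>psi\<close> is 0 where the
  integrand is not integrable, so \<open>log_psi\<close> may have spurious critical points far from 0.\<close>

definition is_saddle_point ::
  "'a measure \<Rightarrow> ('a \<Rightarrow> real) \<Rightarrow> ('a \<Rightarrow> real) \<Rightarrow> real \<Rightarrow> real \<Rightarrow> real \<Rightarrow> bool" where
  "is_saddle_point M V U d r \<zeta> \<longleftrightarrow>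
     \<zeta> \<in> {- d..0} \<and> (log_psi M V U r has_real_derivative 0) (at \<zeta>)"

definition saddle_point ::
  "'a measure \<Rightarrow> ('a \<Rightarrow> real) \<Rightarrow> ('a \<Rightarrow> real) \<Rightarrow> real \<Rightarrow> real \<Rightarrow> real" where
  "saddle_point M V U d r = (THE \<zeta>. is_saddle_point M V U d r \<zeta>)"

definition sample_mean_law :: "'a measure \<Rightarrow> ('a \<Rightarrow> real) \<Rightarrow> nat \<Rightarrow> real measure" where
  "sample_mean_law M X n =
     distr (\<Pi>\<^sub>M k\<in>{1..n}. distr M borel X) borel (\<lambda>x. (\<Sum>k=1..n. x k) / real n)"

text \<open>One step of the Lindley recursion at the level of laws: \<open>L\<close>, \<open>A\<close>, \<open>B\<close> are the laws of the
  independent waiting, service and (unscaled) interarrival times.\<close>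

definition lindley_step ::
  "real measure \<Rightarrow> real measure \<Rightarrow> real \<Rightarrow> real measure \<Rightarrow> real measure" where
  "lindley_step A B r L =
     distr (L \<Otimes>\<^sub>M (A \<Otimes>\<^sub>M B)) borel (\<lambda>(w, v, u). max 0 (w + v - 1 / r * u))"

definition steady_state_waiting_time ::
  "'a measure \<Rightarrow> ('a \<Rightarrow> real) \<Rightarrow> ('a \<Rightarrow> real) \<Rightarrow> real \<Rightarrow> nat \<Rightarrow> 'b measure \<Rightarrow> ('b \<Rightarrow> real) \<Rightarrow> bool" where
  "steady_state_waiting_time M V U r n Q W \<longleftrightarrow>
     prob_space Q \<and> W \<in> borel_measurable Q \<and> (AE \<omega> in Q. 0 \<le> W \<omega>) \<and>
     distr Q borel W =
       lindley_step (sample_mean_law M V n) (sample_mean_law M U n) r (distr Q borel W)"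

definition gaussian_steps :: "real \<Rightarrow> (nat \<Rightarrow> real) measure" where
  "gaussian_steps \<beta> = (\<Pi>\<^sub>M i\<in>(UNIV::nat set). density lborel (normal_density (- \<beta>) 1))"

text \<open>For \<open>\<beta> > 0\<close> the walk tends to \<open>- \<infinity>\<close> almost surely under \<open>gaussian_steps \<beta>\<close>; the supremum
  is then an attained maximum.\<close>

definition walk_max :: "(nat \<Rightarrow> real) \<Rightarrow> real" where
  "walk_max x = (SUP k. \<Sum>i<k. x i)"

definition asymp_one :: "(nat \<Rightarrow> real) \<Rightarrow> bool" where
  "asymp_one a \<longleftrightarrow> (\<exists>c C. 0 < c \<and> c \<le> C \<and> (\<forall>\<^sub>F n in sequentially. c \<le> a n \<and> a n \<le> C))"

end

theory Submission
  imports Defs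
begin

text \<open>
  Both $W_n$ (rescaled) and $M_\beta$ are stationary for a Lindley recursion $w \mapsto (w + X)^+$, so
  no Spitzer or Pollaczek formula is needed: one compares the stop-loss transforms
  $a \mapsto E(W - a)^+$. Since $(W - a)^+ = (W + X - a)^+$ for $a \ge 0$, one step of the recursion
  contracts the norm $\sup_{a \ge 0} e^{\theta a} |\cdot|$ by the factor $E e^{\theta X} < 1$. Hence
  the distance of the stationary laws is controlled by
  $\sup_a e^{\theta a} |E(X - a)^+ - E(Z - a)^+|$ for the two increments, and Laplace transforms
  follow from $e^{-sw} = 1 - sw + s^2 \int_0^\infty (w - a)^+ e^{-sa} da$.

  By Fourier inversion of the ramp the distance of the increments is at most
  $\frac{1}{2\pi} \int |\phi_X(\theta + it) - \phi_Z(\theta + it)| / (\theta^2 + t^2) dt$. With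
  $\theta = \beta_n$ the tilt is exactly at the saddle point, so the tilted increment is centred with
  unit variance. For $|t| \le c \sqrt n$ a Taylor expansion bounds the numerator by
  $O(n^{-1/2})$; for larger $t$ the denominator alone contributes $O(n^{-1/2})$.
\<close>

section \<open>Fourier inversion of the ramp function\<close>

text \<open>Why the ramp: the transform of an indicator decays like 1/|z| and is not absolutely
  integrable on a vertical line, whereas that of the ramp is 1/z^2. Hence the trivial bound 2 on the
  difference of the transforms is enough for large frequencies. Why one exponent serves both laws:
  tilting N(-\<beta>,1) by \<beta> gives a multiple of the standard normal density, and after
  scaling by sqrt n / \<sigma> the same exponent corresponds to the saddle point of the queue. The
  decay exp(-\<beta> a) of the stop-loss transforms leaves a margin \<beta>/2 on the half plane Re s
  \<ge> -\<beta>/2. The obstacle is uniformity in n, since the increment changes with n and its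
  drift vanishes. After rescaling the contraction factor stays away from 1 because \<beta> stays
  away from 0, and the other constants depend only on an exponential moment bound, a lower bound for
  the variance and the range of \<beta>. Orders: the saddle point is of order n^(-1/2), one summand
  is approximated up to n^(-3/2), and the n-th power multiplies this by n.\<close>

lemma Re_pos_imp_plus_ii_nonzero: "0 < \<theta> \<Longrightarrow> complex_of_real \<theta> + \<i> * complex_of_real t \<noteq> 0"
  by (auto simp: complex_eq_iff)

lemma norm_plus_ii_power2:
  "cmod ((complex_of_real \<theta> + \<i> * complex_of_real t)\<^sup>2) = \<theta>\<^sup>2 + t\<^sup>2"
  by (simp add: norm_power cmod_power2)

text \<open>Up to the factor \<theta>^2 the integrand is the Erlang density of shape 2.\<close>

lemma integrable_ramp_exp:
  assumes "0 < (\<theta>::real)"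
  shows "integrable lborel (\<lambda>x. max 0 x * exp (- \<theta> * x))"
proof -
  interpret prob_space "density lborel (erlang_density 1 \<theta>)"
    using assms by (rule prob_space_erlang_density)
  have eq: "erlang_density 1 \<theta> x = \<theta>\<^sup>2 * (max 0 x * exp (- \<theta> * x))" for x
    by (auto simp: erlang_density_def max_def power2_eq_square)
  have "integrable (density lborel (erlang_density 1 \<theta>)) (\<lambda>x. 1::real)"
    by (rule integrable_const)
  hence "integrable lborel (erlang_density 1 \<theta>)"
    using assms by (subst (asm) integrable_density) auto
  hence "integrable lborel (\<lambda>x. inverse (\<theta>\<^sup>2) * (\<theta>\<^sup>2 * (max 0 x * exp (- \<theta> * x))))"
    unfolding eq by (intro integrable_mult_right) auto
  thus ?thesis
    using assms by (simp add: mult.assoc[symmetric])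
qed

lemma fourier_ramp_exp:
  assumes \<theta>: "0 < (\<theta>::real)"
  shows "(LBINT x. complex_of_real (max 0 x * exp (- \<theta> * x)) * iexp (- t * x))
           = 1 / (complex_of_real \<theta> + \<i> * complex_of_real t)\<^sup>2"
proof -
  define s where "s = complex_of_real \<theta> + \<i> * complex_of_real t"
  have s: "s \<noteq> 0" unfolding s_def by (rule Re_pos_imp_plus_ii_nonzero[OF \<theta>])
  have Re_s: "Re s = \<theta>" by (simp add: s_def)
  \<comment> \<open>Antiderivative of \<open>f\<close> obtained by parts. It vanishes at infinity
    and equals -1/s^2 at 0, which produces the right-hand side.\<close>
  define F where "F = (\<lambda>x. - (of_real x / s + 1 / s\<^sup>2) * exp (- s * complex_of_real x))"
  define f where "f = (\<lambda>x. complex_of_real x * exp (- s * complex_of_real x))"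
  have f_eq: "complex_of_real (max 0 x * exp (- \<theta> * x)) * iexp (- t * x)
      = indicator {0<..} x *\<^sub>R f x" for x
    by (auto simp: f_def s_def indicator_def exp_of_real[symmetric] exp_add[symmetric] algebra_simps)
  have intg: "set_integrable lborel (einterval 0 \<infinity>) f"
    unfolding set_integrable_def
  proof (rule Bochner_Integration.integrable_bound[OF integrable_ramp_exp[OF \<theta>]])
    show "(\<lambda>x. indicat_real (einterval 0 \<infinity>) x *\<^sub>R f x) \<in> borel_measurable lborel"
      unfolding f_def by measurable
    show "AE x in lborel. norm (indicat_real (einterval 0 \<infinity>) x *\<^sub>R f x)
        \<le> norm (max 0 x * exp (- \<theta> * x))"
      by (intro AE_I2) (auto simp: f_def indicator_def norm_mult Re_s einterval_def zero_ereal_def)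
  qed
  have der: "(F has_vector_derivative f x) (at x)" for x
  proof -
    have "((\<lambda>z. - (z / s + 1 / s\<^sup>2) * exp (- s * z)) has_field_derivative
       (- (1 / s) * exp (- s * of_real x) + - (of_real x / s + 1 / s\<^sup>2) * (exp (- s * of_real x) * (- s))))
       (at (of_real x))"
      using s by (auto intro!: derivative_eq_intros)
    also have "(- (1 / s) * exp (- s * of_real x) + - (of_real x / s + 1 / s\<^sup>2) * (exp (- s * of_real x) * (- s))) = f x"
      using s unfolding f_def by (simp add: field_simps power2_eq_square)
    finally show ?thesis
      unfolding F_def by (rule has_vector_derivative_real_field[unfolded o_def])
  qed
  have "(LBINT x=0..\<infinity>. f x) = 0 - (- 1 / s\<^sup>2)"
  proof (rule interval_integral_FTC_integrable[OF _ der _ intg])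
    show "isCont f x" for x unfolding f_def by (intro continuous_intros)
    have "(F \<longlongrightarrow> F 0) (at_right 0)"
      unfolding F_def using s by (auto intro!: tendsto_eq_intros)
    thus "((F \<circ> real_of_ereal) \<longlongrightarrow> - 1 / s\<^sup>2) (at_right 0)"
      unfolding zero_ereal_def ereal_tendsto_simps1 by (simp add: F_def)
    have "((\<lambda>x. (x / cmod s + 1 / (cmod s)\<^sup>2) * exp (- \<theta> * x)) \<longlongrightarrow> 0) at_top"
    proof -
      have "((\<lambda>x. (1 / (cmod s * \<theta>)) * ((\<theta> * x) ^ 1 / exp (\<theta> * x)) + 1 / (cmod s)\<^sup>2 * ((\<theta> * x) ^ 0 / exp (\<theta> * x)))
          \<longlongrightarrow> (1 / (cmod s * \<theta>)) * 0 + 1 / (cmod s)\<^sup>2 * 0) at_top"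
        by (intro tendsto_intros filterlim_compose[OF tendsto_power_div_exp_0]
              filterlim_tendsto_pos_mult_at_top[OF tendsto_const \<theta> filterlim_ident])
      thus ?thesis using \<theta> by (simp add: exp_minus field_simps add_divide_distrib)
    qed
    hence "(F \<longlongrightarrow> 0) at_top"
    proof (rule Lim_null_comparison[rotated])
      show "\<forall>\<^sub>F x in at_top. norm (F x) \<le> (x / cmod s + 1 / (cmod s)\<^sup>2) * exp (- \<theta> * x)"
        using eventually_ge_at_top[of 0]
      proof eventually_elim
        case (elim x)
        have "norm (of_real x / s + 1 / s\<^sup>2) \<le> x / cmod s + 1 / (cmod s)\<^sup>2"
          by (rule norm_triangle_le) (use elim in \<open>simp add: norm_divide norm_power\<close>)
        moreover have "norm (exp (- s * complex_of_real x)) = exp (- \<theta> * x)"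
          by (simp add: Re_s)
        ultimately show ?case
          unfolding F_def norm_mult norm_minus_cancel using elim by (intro mult_mono) auto
      qed
    qed
    thus "((F \<circ> real_of_ereal) \<longlongrightarrow> 0) (at_left \<infinity>)"
      unfolding ereal_tendsto_simps1 .
  qed auto
  moreover have "(LBINT x=0..\<infinity>. f x) = (LBINT x. indicator {0<..} x *\<^sub>R f x)"
    by (simp add: interval_lebesgue_integral_def set_lebesgue_integral_def zero_ereal_def)
  ultimately show ?thesis
    unfolding f_eq by (simp add: s_def)
qed

lemma integrable_inverse_quadratic:
  assumes \<theta>: "0 < (\<theta>::real)"
  shows "integrable lborel (\<lambda>t. 1 / (\<theta>\<^sup>2 + t\<^sup>2))" "(LBINT t. 1 / (\<theta>\<^sup>2 + t\<^sup>2)) = pi / \<theta>"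
proof -
  have "integrable lborel (\<lambda>x. inverse (1 + x\<^sup>2) :: real)"
    using integrable_inverse_1_plus_square by (simp add: set_integrable_def)
  moreover have "(LBINT x. inverse (1 + x\<^sup>2) :: real) = pi"
    using LBINT_inverse_1_plus_square
    by (simp add: interval_lebesgue_integral_def set_lebesgue_integral_def)
  moreover have "(\<lambda>x. 1 / (\<theta>\<^sup>2 + (0 + \<theta> * x)\<^sup>2)) = (\<lambda>x. 1 / \<theta>\<^sup>2 * inverse (1 + x\<^sup>2))"
  proof
    fix x :: real
    have "\<theta>\<^sup>2 + (0 + \<theta> * x)\<^sup>2 = \<theta>\<^sup>2 * (1 + x\<^sup>2)" by (simp add: algebra_simps)
    thus "1 / (\<theta>\<^sup>2 + (0 + \<theta> * x)\<^sup>2) = 1 / \<theta>\<^sup>2 * inverse (1 + x\<^sup>2)" by (simp add: divide_simps)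
  qed
  ultimately show "integrable lborel (\<lambda>t. 1 / (\<theta>\<^sup>2 + t\<^sup>2))" "(LBINT t. 1 / (\<theta>\<^sup>2 + t\<^sup>2)) = pi / \<theta>"
    using \<theta> lborel_integrable_real_affine_iff[of \<theta> "\<lambda>t. 1 / (\<theta>\<^sup>2 + t\<^sup>2)" 0]
      lborel_integral_real_affine[of \<theta> "\<lambda>t. 1 / (\<theta>\<^sup>2 + t\<^sup>2)" 0]
    by (simp_all only: integral_mult_right_zero) (auto simp: power2_eq_square)
qed

lemma integrable_exp_neg_square_half: "integrable lborel (\<lambda>x. exp (- x\<^sup>2 / 2) :: real)"
  and integral_exp_neg_square_half: "(LBINT x. exp (- x\<^sup>2 / 2) :: real) = sqrt (2 * pi)"
proof -
  have e: "exp (- x\<^sup>2 / 2) = sqrt (2 * pi) * std_normal_density x" for x :: real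
    by (simp add: std_normal_density_def)
  show "integrable lborel (\<lambda>x. exp (- x\<^sup>2 / 2) :: real)"
    unfolding e by (intro integrable_mult_right integrable_normal_density zero_less_one)
  show "(LBINT x. exp (- x\<^sup>2 / 2) :: real) = sqrt (2 * pi)"
    unfolding e integral_mult_right_zero by (subst integral_normal_density) (rule zero_less_one, rule mult_1_right)
qed

text \<open>The substitution t = m v reduces the integral to the characteristic function of the
  standard normal law.\<close>

lemma fourier_gaussian:
  assumes m: "0 < (m::real)"
  shows "(LBINT t. complex_of_real (exp (- (t / m)\<^sup>2 / 2)) * iexp (t * u))
           = complex_of_real (m * sqrt (2 * pi) * exp (- (m * u)\<^sup>2 / 2))"
proof -
  have "(LBINT t. complex_of_real (exp (- (t / m)\<^sup>2 / 2)) * iexp (t * u))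
      = m *\<^sub>R (LBINT v. complex_of_real (exp (- v\<^sup>2 / 2)) * iexp (m * u * v))"
    using m by (subst lborel_integral_real_affine[of m _ 0]) (simp_all add: mult_ac)
  also have "(LBINT v. complex_of_real (exp (- v\<^sup>2 / 2)) * iexp (m * u * v))
      = (LBINT v. complex_of_real (sqrt (2 * pi)) * (std_normal_density v *\<^sub>R iexp (m * u * v)))"
    by (intro Bochner_Integration.integral_cong) (auto simp: std_normal_density_def scaleR_conv_of_real)
  also have "\<dots> = complex_of_real (sqrt (2 * pi)) * char std_normal_distribution (m * u)"
    unfolding integral_mult_right_zero char_def by (subst integral_density) auto
  finally show ?thesis
    by (simp add: char_std_normal_distribution scaleR_conv_of_real)
qed

text \<open>The exponential \<open>iexp (- t * x)\<close> decays nowhere, so the inversion is regularised by the factor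
  \<open>exp (- (t / m)\<^sup>2 / 2)\<close>, which turns the right-hand side into a Gaussian average of the ramp.\<close>

lemma ramp_exp_regularised:
  assumes \<theta>: "0 < (\<theta>::real)" and m: "0 < (m::real)"
  defines "q \<equiv> (\<lambda>x. max 0 x * exp (- \<theta> * x))"
  shows "(LBINT t. complex_of_real (exp (- (t / m)\<^sup>2 / 2)) * iexp (t * y) / (complex_of_real \<theta> + \<i> * complex_of_real t)\<^sup>2)
    = complex_of_real (sqrt (2 * pi) * (LBINT v. q (y + v / m) * exp (- v\<^sup>2 / 2)))"
proof -
  define g where "g = (\<lambda>t. exp (- (t / m)\<^sup>2 / 2))"
  have [measurable]: "q \<in> borel_measurable borel" "g \<in> borel_measurable borel"
    unfolding q_def g_def by measurable
  have q: "integrable lborel q" unfolding q_def by (rule integrable_ramp_exp[OF \<theta>])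
  have q0: "0 \<le> q x" for x by (simp add: q_def)
  have g: "integrable lborel g"
    using m lborel_integrable_real_affine[OF integrable_exp_neg_square_half, of "1 / m" 0]
    by (simp add: g_def)
  \<comment> \<open>The Gaussian factor makes the double integrand absolutely integrable: its
    modulus is the product \<open>g t * q x\<close>. Integrating in x first gives the transform of
    the ramp, integrating in t first gives a Gaussian kernel of width 1/m around y.\<close>
  define H where "H = (\<lambda>x t. complex_of_real (g t) * iexp (t * y) * (complex_of_real (q x) * iexp (- t * x)))"
  have [measurable]: "case_prod H \<in> borel_measurable (lborel \<Otimes>\<^sub>M lborel)"
    unfolding H_def by measurable
  have norm_H: "norm (H x t) = g t * q x" for x t
    by (simp add: H_def norm_mult g_def q0)
  have H: "integrable (lborel \<Otimes>\<^sub>M lborel) (case_prod H)"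
  proof (rule lborel_pair.Fubini_integrable)
    show "integrable lborel (\<lambda>x. LBINT t. norm (case_prod H (x, t)))"
      using q by (simp add: norm_H)
    show "AE x in lborel. integrable lborel (\<lambda>t. case_prod H (x, t))"
    proof (rule AE_I2)
      fix x
      have "integrable lborel (\<lambda>t. g t * q x)" using g by simp
      thus "integrable lborel (\<lambda>t. case_prod H (x, t))"
        by (rule Bochner_Integration.integrable_bound) (auto simp: norm_H g_def q0)
    qed
  qed measurable
  have "(LBINT t. complex_of_real (g t) * iexp (t * y) / (complex_of_real \<theta> + \<i> * complex_of_real t)\<^sup>2)
     = (LBINT t. LBINT x. H x t)"
    unfolding H_def integral_mult_right_zero q_def fourier_ramp_exp[OF \<theta>] by simp
  also have "\<dots> = (LBINT x. LBINT t. H x t)"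
    by (rule lborel_pair.Fubini_integral[OF H])
  also have "\<dots> = (LBINT x. complex_of_real (m * sqrt (2 * pi) * (q x * exp (- (m * (y - x))\<^sup>2 / 2))))"
  proof (rule Bochner_Integration.integral_cong)
    fix x
    have "(LBINT t. H x t) = (LBINT t. complex_of_real (q x) * (complex_of_real (g t) * iexp (t * (y - x))))"
      unfolding H_def by (intro Bochner_Integration.integral_cong)
        (auto simp: exp_add[symmetric] algebra_simps)
    also have "\<dots> = complex_of_real (m * sqrt (2 * pi) * (q x * exp (- (m * (y - x))\<^sup>2 / 2)))"
      unfolding integral_mult_right_zero g_def fourier_gaussian[OF m] by simp
    finally show "(LBINT t. H x t) = complex_of_real (m * sqrt (2 * pi) * (q x * exp (- (m * (y - x))\<^sup>2 / 2)))" .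
  qed simp
  also have "\<dots> = complex_of_real (m * sqrt (2 * pi) * (LBINT x. q x * exp (- (m * (y - x))\<^sup>2 / 2)))"
    by (simp only: integral_complex_of_real integral_mult_right_zero)
  also have "(LBINT x. q x * exp (- (m * (y - x))\<^sup>2 / 2)) = (1 / m) * (LBINT v. q (y + v / m) * exp (- v\<^sup>2 / 2))"
    using m by (subst lborel_integral_real_affine[of "1 / m" _ y]) simp_all
  finally show ?thesis using m by (simp add: g_def)
qed

text \<open>The regularisation is removed by letting m tend to infinity on both sides. The
  dominating functions are 1/(\<theta>^2 + t^2) on the frequency side and exp(-v^2/2)/\<theta> on
  the other, where \<open>q\<close> is continuous and bounded by 1/\<theta>.\<close>

lemma ramp_inversion_normalised:
  assumes \<theta>: "0 < (\<theta>::real)"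
  shows "(LBINT t. iexp (t * y) / (complex_of_real \<theta> + \<i> * complex_of_real t)\<^sup>2)
    = complex_of_real (2 * pi * (max 0 y * exp (- \<theta> * y)))"
proof -
  define q where "q = (\<lambda>x. max 0 x * exp (- \<theta> * x))"
  define I where "I = (\<lambda>n t. complex_of_real (exp (- (t / real (Suc n))\<^sup>2 / 2)) * iexp (t * y) / (complex_of_real \<theta> + \<i> * complex_of_real t)\<^sup>2)"
  define J where "J = (\<lambda>n v. q (y + v / real (Suc n)) * exp (- v\<^sup>2 / 2))"
  have inv: "(\<lambda>n. c / real (Suc n)) \<longlonglongrightarrow> 0" for c
    using tendsto_mult_right_zero[OF LIMSEQ_inverse_real_of_nat, of c] by (simp add: divide_inverse)
  have q_le: "q x \<le> 1 / \<theta>" and q0: "0 \<le> q x" for x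
  proof -
    show "0 \<le> q x" by (simp add: q_def)
    have "\<theta> * x \<le> exp (\<theta> * x)" using exp_ge_add_one_self[of "\<theta> * x"] by linarith
    hence "\<theta> * x * exp (- \<theta> * x) \<le> 1" by (simp add: exp_minus field_simps)
    thus "q x \<le> 1 / \<theta>" using \<theta> by (auto simp: q_def max_def field_simps)
  qed
  have "(\<lambda>n. LBINT t. I n t) \<longlonglongrightarrow> (LBINT t. iexp (t * y) / (complex_of_real \<theta> + \<i> * complex_of_real t)\<^sup>2)"
  proof (rule integral_dominated_convergence)
    show "integrable lborel (\<lambda>t. 1 / (\<theta>\<^sup>2 + t\<^sup>2))" by (rule integrable_inverse_quadratic[OF \<theta>])
    show "AE t in lborel. (\<lambda>n. I n t) \<longlonglongrightarrow> iexp (t * y) / (complex_of_real \<theta> + \<i> * complex_of_real t)\<^sup>2"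
    proof (rule AE_I2)
      fix t
      have "(\<lambda>n. I n t) \<longlonglongrightarrow> complex_of_real (exp (- 0\<^sup>2 / 2)) * iexp (t * y) / (complex_of_real \<theta> + \<i> * complex_of_real t)\<^sup>2"
        unfolding I_def using Re_pos_imp_plus_ii_nonzero[OF \<theta>]
        by (intro tendsto_intros inv) auto
      thus "(\<lambda>n. I n t) \<longlonglongrightarrow> iexp (t * y) / (complex_of_real \<theta> + \<i> * complex_of_real t)\<^sup>2" by simp
    qed
    show "AE t in lborel. norm (I n t) \<le> 1 / (\<theta>\<^sup>2 + t\<^sup>2)" for n
      by (rule AE_I2) (auto simp: I_def norm_mult norm_divide norm_plus_ii_power2 intro!: divide_right_mono)
  qed (auto simp: I_def)
  moreover have "(\<lambda>n. LBINT v. J n v) \<longlonglongrightarrow> (LBINT v. q y * exp (- v\<^sup>2 / 2))"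
  proof (rule integral_dominated_convergence)
    show "integrable lborel (\<lambda>v. 1 / \<theta> * exp (- v\<^sup>2 / 2))"
      using integrable_exp_neg_square_half by simp
    show "AE v in lborel. (\<lambda>n. J n v) \<longlonglongrightarrow> q y * exp (- v\<^sup>2 / 2)"
    proof (rule AE_I2)
      fix v
      have "(\<lambda>n. J n v) \<longlonglongrightarrow> q (y + 0) * exp (- v\<^sup>2 / 2)"
        unfolding J_def q_def by (intro tendsto_intros inv)
      thus "(\<lambda>n. J n v) \<longlonglongrightarrow> q y * exp (- v\<^sup>2 / 2)" by simp
    qed
    show "AE v in lborel. norm (J n v) \<le> 1 / \<theta> * exp (- v\<^sup>2 / 2)" for n
      using q_le q0 by (intro AE_I2) (auto simp: J_def abs_mult intro!: mult_right_mono simp del: times_divide_eq_left)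
  qed (auto simp: J_def q_def)
  hence "(\<lambda>n. complex_of_real (sqrt (2 * pi) * (LBINT v. J n v))) \<longlonglongrightarrow> complex_of_real (sqrt (2 * pi) * (q y * sqrt (2 * pi)))"
    unfolding integral_mult_right_zero integral_exp_neg_square_half by (intro tendsto_intros)
  moreover have "(LBINT t. I n t) = complex_of_real (sqrt (2 * pi) * (LBINT v. J n v))" for n
    unfolding I_def J_def q_def by (rule ramp_exp_regularised[OF \<theta>]) simp
  ultimately have "(LBINT t. iexp (t * y) / (complex_of_real \<theta> + \<i> * complex_of_real t)\<^sup>2)
      = complex_of_real (sqrt (2 * pi) * (q y * sqrt (2 * pi)))"
    using LIMSEQ_unique by (simp only:)
  also have "sqrt (2 * pi) * (q y * sqrt (2 * pi)) = 2 * pi * q y" by simp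
  finally show ?thesis by (simp add: q_def)
qed

lemma ramp_inversion:
  assumes \<theta>: "0 < (\<theta>::real)"
  shows "(LBINT t. exp ((complex_of_real \<theta> + \<i> * complex_of_real t) * complex_of_real y)
      / (complex_of_real \<theta> + \<i> * complex_of_real t)\<^sup>2) = complex_of_real (2 * pi * max 0 y)"
proof -
  have "(LBINT t. exp ((complex_of_real \<theta> + \<i> * complex_of_real t) * complex_of_real y)
      / (complex_of_real \<theta> + \<i> * complex_of_real t)\<^sup>2)
    = (LBINT t. exp (complex_of_real (\<theta> * y)) * (iexp (t * y) / (complex_of_real \<theta> + \<i> * complex_of_real t)\<^sup>2))"
    by (intro Bochner_Integration.integral_cong) (auto simp: algebra_simps exp_add)
  also have "\<dots> = complex_of_real (2 * pi * max 0 y)"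
    unfolding integral_mult_right_zero ramp_inversion_normalised[OF \<theta>]
    by (simp add: exp_of_real[symmetric] exp_minus)
  finally show ?thesis .
qed

section \<open>Stop-loss transforms\<close>

definition stop_loss :: "real measure \<Rightarrow> real \<Rightarrow> real" where
  "stop_loss \<mu> a = (LINT x|\<mu>. max 0 (x - a))"

definition cmgf :: "real measure \<Rightarrow> complex \<Rightarrow> complex" where
  "cmgf \<mu> z = (LINT x|\<mu>. exp (z * complex_of_real x))"

lemma ramp_le_exp:
  assumes "0 < (\<theta>::real)"
  shows "max 0 y \<le> exp (\<theta> * y) / \<theta>"
proof -
  have "\<theta> * y \<le> exp (\<theta> * y)" using exp_ge_add_one_self[of "\<theta> * y"] by linarith
  thus ?thesis using assms by (auto simp: max_def field_simps)
qed

context real_distribution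
begin

lemma integrable_ramp:
  assumes "0 < \<theta>" "integrable M (\<lambda>x. exp (\<theta> * x))"
  shows "integrable M (\<lambda>x. max 0 (x - a))"
proof (rule Bochner_Integration.integrable_bound)
  show "integrable M (\<lambda>x. exp (- \<theta> * a) / \<theta> * exp (\<theta> * x))" using assms by simp
  show "AE x in M. norm (max 0 (x - a)) \<le> norm (exp (- \<theta> * a) / \<theta> * exp (\<theta> * x))"
    using ramp_le_exp[OF assms(1), of "x - a" for x] assms(1)
    by (intro AE_I2) (auto simp: exp_add[symmetric] algebra_simps)
qed simp

lemma stop_loss_nonneg: "0 \<le> stop_loss M a"
  unfolding stop_loss_def by (rule Bochner_Integration.integral_nonneg) simp

text \<open>An exponential moment turns into exponential decay of the stop-loss transform. This
  makes the weighted supremum norm finite and the later Laplace integrals convergent.\<close>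

lemma stop_loss_le:
  assumes "0 < \<theta>" "integrable M (\<lambda>x. exp (\<theta> * x))"
  shows "exp (\<theta> * a) * stop_loss M a \<le> (LINT x|M. exp (\<theta> * x)) / \<theta>"
proof -
  have "exp (\<theta> * a) * stop_loss M a = (LINT x|M. exp (\<theta> * a) * max 0 (x - a))"
    by (simp add: stop_loss_def)
  also have "\<dots> \<le> (LINT x|M. exp (\<theta> * x) / \<theta>)"
  proof (rule integral_mono)
    fix x
    have "exp (\<theta> * a) * max 0 (x - a) \<le> exp (\<theta> * a) * (exp (\<theta> * (x - a)) / \<theta>)"
      by (intro mult_left_mono ramp_le_exp assms) simp
    thus "exp (\<theta> * a) * max 0 (x - a) \<le> exp (\<theta> * x) / \<theta>"
      by (simp add: exp_add[symmetric] algebra_simps)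
  qed (use integrable_ramp[OF assms] assms in auto)
  finally show ?thesis by simp
qed

lemma norm_cmgf_le:
  shows "norm (cmgf M z) \<le> (LINT x|M. exp (Re z * x))"
  unfolding cmgf_def by (rule order_trans[OF integral_norm_bound]) simp

lemma cmgf_measurable [measurable]: "cmgf M \<in> borel_measurable borel"
  unfolding cmgf_def by measurable

text \<open>The inversion formula at y = x - a is integrated over the law of x. Fubini applies
  because the modulus of \<open>H\<close> splits into exp(\<theta> x) and 1/(\<theta>^2 + t^2), up
  to a constant.\<close>

lemma stop_loss_fourier:
  assumes \<theta>: "0 < \<theta>" and int: "integrable M (\<lambda>x. exp (\<theta> * x))"
  shows "integrable lborel (\<lambda>t. exp (- (complex_of_real \<theta> + \<i> * complex_of_real t) * complex_of_real a)
           * cmgf M (complex_of_real \<theta> + \<i> * complex_of_real t) / (complex_of_real \<theta> + \<i> * complex_of_real t)\<^sup>2)" (is "integrable lborel ?f")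
    and "complex_of_real (2 * pi * stop_loss M a) =
       (LBINT t. exp (- (complex_of_real \<theta> + \<i> * complex_of_real t) * complex_of_real a)
           * cmgf M (complex_of_real \<theta> + \<i> * complex_of_real t) / (complex_of_real \<theta> + \<i> * complex_of_real t)\<^sup>2)"
proof -
  interpret pair_sigma_finite lborel M ..
  define H where "H = (\<lambda>t x. exp ((complex_of_real \<theta> + \<i> * complex_of_real t) * complex_of_real (x - a))
      / (complex_of_real \<theta> + \<i> * complex_of_real t)\<^sup>2)"
  have [measurable]: "case_prod H \<in> borel_measurable (lborel \<Otimes>\<^sub>M M)"
    unfolding H_def by measurable
  have norm_H: "norm (H t x) = exp (- \<theta> * a) * exp (\<theta> * x) * (1 / (\<theta>\<^sup>2 + t\<^sup>2))" for t x
    by (simp add: H_def norm_divide norm_plus_ii_power2 exp_add[symmetric] algebra_simps)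
  have H: "integrable (lborel \<Otimes>\<^sub>M M) (case_prod H)"
  proof (rule Fubini_integrable)
    show "integrable lborel (\<lambda>t. LINT x|M. norm (case_prod H (t, x)))"
      unfolding prod.case norm_H integral_mult_left_zero
      by (intro integrable_mult_right integrable_inverse_quadratic(1)[OF \<theta>])
    show "AE t in lborel. integrable M (\<lambda>x. case_prod H (t, x))"
    proof (rule AE_I2)
      fix t
      have "integrable M (\<lambda>x. exp (- \<theta> * a) * exp (\<theta> * x) * (1 / (\<theta>\<^sup>2 + t\<^sup>2)))"
        using int by simp
      thus "integrable M (\<lambda>x. case_prod H (t, x))"
        by (rule Bochner_Integration.integrable_bound) (auto simp: norm_H)
    qed
  qed measurable
  have inner: "(LINT x|M. H t x) = ?f t" for t
  proof -
    have "(LINT x|M. H t x) = (LINT x|M. exp (- (complex_of_real \<theta> + \<i> * complex_of_real t) * complex_of_real a)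
        / (complex_of_real \<theta> + \<i> * complex_of_real t)\<^sup>2 * exp ((complex_of_real \<theta> + \<i> * complex_of_real t) * complex_of_real x))"
      unfolding H_def by (intro Bochner_Integration.integral_cong)
        (auto simp: exp_add[symmetric] algebra_simps)
    thus ?thesis unfolding integral_mult_right_zero cmgf_def by simp
  qed
  show "integrable lborel ?f"
    using integrable_fst[OF H] unfolding inner .
  have "(LBINT t. ?f t) = (LINT x|M. (LBINT t. H t x))"
    unfolding inner[symmetric] by (rule Fubini_integral[OF H, symmetric])
  also have "\<dots> = (LINT x|M. complex_of_real (2 * pi * max 0 (x - a)))"
    unfolding H_def ramp_inversion[OF \<theta>] ..
  also have "\<dots> = complex_of_real (2 * pi * stop_loss M a)"
    by (simp only: integral_complex_of_real integral_mult_right_zero stop_loss_def)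
  finally show "complex_of_real (2 * pi * stop_loss M a) = (LBINT t. ?f t)" ..
qed

end

lemma integrable_cmgf_diff:
  assumes "real_distribution \<mu>" "real_distribution \<nu>" and \<theta>: "0 < \<theta>"
  shows "integrable lborel (\<lambda>t. cmod (cmgf \<mu> (complex_of_real \<theta> + \<i> * complex_of_real t)
      - cmgf \<nu> (complex_of_real \<theta> + \<i> * complex_of_real t)) / (\<theta>\<^sup>2 + t\<^sup>2))"
proof (rule Bochner_Integration.integrable_bound)
  interpret \<mu>: real_distribution \<mu> by fact
  interpret \<nu>: real_distribution \<nu> by fact
  let ?C = "(LINT x|\<mu>. exp (\<theta> * x)) + (LINT x|\<nu>. exp (\<theta> * x))"
  show "integrable lborel (\<lambda>t. ?C * (1 / (\<theta>\<^sup>2 + t\<^sup>2)))"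
    by (intro integrable_mult_right integrable_inverse_quadratic[OF \<theta>])
  have "cmod (cmgf \<mu> (complex_of_real \<theta> + \<i> * complex_of_real t)
      - cmgf \<nu> (complex_of_real \<theta> + \<i> * complex_of_real t)) \<le> ?C" for t
    using \<mu>.norm_cmgf_le[of "complex_of_real \<theta> + \<i> * complex_of_real t"]
      \<nu>.norm_cmgf_le[of "complex_of_real \<theta> + \<i> * complex_of_real t"]
    by (intro norm_triangle_le_diff) simp
  hence *: "norm (cmod (cmgf \<mu> (complex_of_real \<theta> + \<i> * complex_of_real t)
      - cmgf \<nu> (complex_of_real \<theta> + \<i> * complex_of_real t)) / (\<theta>\<^sup>2 + t\<^sup>2)) \<le> ?C * (1 / (\<theta>\<^sup>2 + t\<^sup>2))" for t
    by (auto intro!: divide_right_mono)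
  show "AE t in lborel. norm (cmod (cmgf \<mu> (complex_of_real \<theta> + \<i> * complex_of_real t)
      - cmgf \<nu> (complex_of_real \<theta> + \<i> * complex_of_real t)) / (\<theta>\<^sup>2 + t\<^sup>2))
      \<le> norm (?C * (1 / (\<theta>\<^sup>2 + t\<^sup>2)))"
    by (rule AE_I2, rule order_trans[OF *]) (simp only: real_norm_def abs_ge_self)
  show "(\<lambda>t. cmod (cmgf \<mu> (complex_of_real \<theta> + \<i> * complex_of_real t)
      - cmgf \<nu> (complex_of_real \<theta> + \<i> * complex_of_real t)) / (\<theta>\<^sup>2 + t\<^sup>2)) \<in> borel_measurable lborel"
    by measurable
qed

text \<open>On the line Re z = \<theta> the factor exp(-z a) has modulus exp(-\<theta> a), so the
  weight cancels exactly and the bound is independent of \<open>a\<close>.\<close>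

lemma stop_loss_diff_le:
  assumes "real_distribution \<mu>" "real_distribution \<nu>" and \<theta>: "0 < \<theta>"
    and int: "integrable \<mu> (\<lambda>x. exp (\<theta> * x))" "integrable \<nu> (\<lambda>x. exp (\<theta> * x))"
  shows "exp (\<theta> * a) * \<bar>stop_loss \<mu> a - stop_loss \<nu> a\<bar>
    \<le> (LBINT t. cmod (cmgf \<mu> (complex_of_real \<theta> + \<i> * complex_of_real t)
         - cmgf \<nu> (complex_of_real \<theta> + \<i> * complex_of_real t)) / (\<theta>\<^sup>2 + t\<^sup>2)) / (2 * pi)"
proof -
  interpret \<mu>: real_distribution \<mu> by fact
  interpret \<nu>: real_distribution \<nu> by fact
  let ?z = "\<lambda>t. complex_of_real \<theta> + \<i> * complex_of_real t"
  let ?f = "\<lambda>\<mu> t. exp (- ?z t * complex_of_real a) * cmgf \<mu> (?z t) / (?z t)\<^sup>2"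
  have "2 * pi * \<bar>stop_loss \<mu> a - stop_loss \<nu> a\<bar>
      = cmod (complex_of_real (2 * pi * stop_loss \<mu> a) - complex_of_real (2 * pi * stop_loss \<nu> a))"
    by (simp only: of_real_diff[symmetric] norm_of_real right_diff_distrib[symmetric] abs_mult) simp
  also have "\<dots> = cmod (LBINT t. ?f \<mu> t - ?f \<nu> t)"
    using \<mu>.stop_loss_fourier[OF \<theta> int(1), of a] \<nu>.stop_loss_fourier[OF \<theta> int(2), of a]
    by (subst Bochner_Integration.integral_diff) simp_all
  also have "\<dots> \<le> (LBINT t. cmod (?f \<mu> t - ?f \<nu> t))"
    by (rule integral_norm_bound)
  also have "\<dots> = (LBINT t. exp (- \<theta> * a) * (cmod (cmgf \<mu> (?z t) - cmgf \<nu> (?z t)) / (\<theta>\<^sup>2 + t\<^sup>2)))"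
  proof (rule Bochner_Integration.integral_cong)
    fix t
    have "?f \<mu> t - ?f \<nu> t = exp (- ?z t * complex_of_real a) * (cmgf \<mu> (?z t) - cmgf \<nu> (?z t)) / (?z t)\<^sup>2"
      by (simp add: algebra_simps diff_divide_distrib)
    also have "cmod \<dots> = exp (- \<theta> * a) * (cmod (cmgf \<mu> (?z t) - cmgf \<nu> (?z t)) / (\<theta>\<^sup>2 + t\<^sup>2))"
      by (simp add: norm_mult norm_divide norm_plus_ii_power2)
    finally show "cmod (?f \<mu> t - ?f \<nu> t) = exp (- \<theta> * a) * (cmod (cmgf \<mu> (?z t) - cmgf \<nu> (?z t)) / (\<theta>\<^sup>2 + t\<^sup>2))" .
  qed simp
  also have "\<dots> = exp (- \<theta> * a) * (LBINT t. cmod (cmgf \<mu> (?z t) - cmgf \<nu> (?z t)) / (\<theta>\<^sup>2 + t\<^sup>2))"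
    by (rule integral_mult_right_zero)
  finally have "exp (\<theta> * a) * (2 * pi * \<bar>stop_loss \<mu> a - stop_loss \<nu> a\<bar>)
      \<le> exp (\<theta> * a) * (exp (- \<theta> * a) * (LBINT t. cmod (cmgf \<mu> (?z t) - cmgf \<nu> (?z t)) / (\<theta>\<^sup>2 + t\<^sup>2)))"
    by (rule mult_left_mono) simp
  also have "\<dots> = (LBINT t. cmod (cmgf \<mu> (?z t) - cmgf \<nu> (?z t)) / (\<theta>\<^sup>2 + t\<^sup>2))"
    by (simp add: exp_minus)
  finally show ?thesis by (simp add: field_simps)
qed

section \<open>Stationary laws of the Lindley recursion\<close>

text \<open>Service and interarrival times enter only through their difference, so a single
  increment law \<mu> is kept. The queue and the maximum of the Gaussian walk become instances of
  the same notion.\<close>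

definition lindley_stationary :: "real measure \<Rightarrow> real measure \<Rightarrow> bool" where
  "lindley_stationary \<mu> L \<longleftrightarrow> real_distribution \<mu> \<and> real_distribution L \<and> (AE w in L. 0 \<le> w) \<and>
     distr (L \<Otimes>\<^sub>M \<mu>) borel (\<lambda>(w, x). max 0 (w + x)) = L"

lemma lindley_stationary_integral:
  fixes f :: "real \<Rightarrow> 'b :: {banach, second_countable_topology}"
  assumes "lindley_stationary \<mu> L" and f: "integrable L f"
  shows "(LINT w|L. f w) = (LINT w|L. LINT x|\<mu>. f (max 0 (w + x)))"
proof -
  interpret \<mu>: real_distribution \<mu> using assms(1) by (simp add: lindley_stationary_def)
  interpret L: real_distribution L using assms(1) by (simp add: lindley_stationary_def)
  interpret pair_sigma_finite L \<mu> ..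
  have st: "distr (L \<Otimes>\<^sub>M \<mu>) borel (\<lambda>(w, x). max 0 (w + x)) = L"
    using assms(1) by (simp add: lindley_stationary_def)
  have [measurable]: "(\<lambda>(w, x). max 0 (w + x)) \<in> borel_measurable (L \<Otimes>\<^sub>M \<mu>)"
    "f \<in> borel_measurable borel"
    using borel_measurable_integrable[OF f] by (simp_all cong: measurable_cong_sets)
  have "integrable (distr (L \<Otimes>\<^sub>M \<mu>) borel (\<lambda>(w, x). max 0 (w + x))) f"
    unfolding st by (rule f)
  hence int: "integrable (L \<Otimes>\<^sub>M \<mu>) (\<lambda>(w, x). f (max 0 (w + x)))"
    by (subst (asm) integrable_distr_eq) (auto simp: case_prod_beta')
  have "(LINT w|L. f w) = (LINT w|distr (L \<Otimes>\<^sub>M \<mu>) borel (\<lambda>(w, x). max 0 (w + x)). f w)"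
    unfolding st ..
  also have "\<dots> = (LINT p|(L \<Otimes>\<^sub>M \<mu>). (\<lambda>(w, x). f (max 0 (w + x))) p)"
    by (subst integral_distr) (auto simp: case_prod_beta')
  also have "\<dots> = (LINT w|L. LINT x|\<mu>. f (max 0 (w + x)))"
    using integral_fst[OF int] by simp
  finally show ?thesis .
qed

text \<open>The exponential moment is not known to be finite beforehand, so the drift inequality is applied
  to the truncations \<open>min (exp (\<theta> * w)) N\<close>.\<close>

lemma lindley_stationary_exp_moment:
  assumes st: "lindley_stationary \<mu> L" and \<theta>: "0 < \<theta>"
    and int: "integrable \<mu> (\<lambda>x. exp (\<theta> * x))" and less: "(LINT x|\<mu>. exp (\<theta> * x)) < 1"
  shows "integrable L (\<lambda>w. exp (\<theta> * w))"
    and "(LINT w|L. exp (\<theta> * w)) \<le> 1 / (1 - (LINT x|\<mu>. exp (\<theta> * x)))"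
proof -
  interpret \<mu>: real_distribution \<mu> using st by (simp add: lindley_stationary_def)
  interpret L: real_distribution L using st by (simp add: lindley_stationary_def)
  define l where "l = (LINT x|\<mu>. exp (\<theta> * x))"
  have l: "0 \<le> l" "l < 1" using less by (auto simp: l_def intro!: Bochner_Integration.integral_nonneg)
  have bnd: "integrable L (\<lambda>w. min (c * exp (\<theta> * w)) (real N))" if "0 \<le> c" for N c
    by (rule L.integrable_const_bound[of _ "real N"]) (use that in auto)
  have trunc: "(1 - l) * (LINT w|L. exp (\<theta> * w) * indicator {w. exp (\<theta> * w) \<le> real N} w) \<le> 1"
    if N: "1 \<le> N" for N :: nat
  proof -
    let ?f = "\<lambda>w. min (exp (\<theta> * w)) (real N)"
    have "(LINT w|L. ?f w) = (LINT w|L. LINT x|\<mu>. ?f (max 0 (w + x)))"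
      using bnd[of 1 N] by (intro lindley_stationary_integral[OF st]) simp
    also have "\<dots> \<le> (LINT w|L. 1 + min (l * exp (\<theta> * w)) (real N))"
    proof (rule integral_mono)
      show "integrable L (\<lambda>w. LINT x|\<mu>. ?f (max 0 (w + x)))"
      proof (rule L.integrable_const_bound[of _ "real N"])
        have "norm (LINT x|\<mu>. ?f (max 0 (w + x))) \<le> real N" for w
        proof -
          have "norm (LINT x|\<mu>. ?f (max 0 (w + x))) \<le> (LINT x|\<mu>. norm (?f (max 0 (w + x))))"
            by (rule integral_norm_bound)
          also have "\<dots> \<le> (LINT x|\<mu>. real N)"
            by (intro integral_mono \<mu>.integrable_const_bound[of _ "real N"]) auto
          finally show ?thesis using \<mu>.prob_space[simplified] by simp
        qed
        thus "AE w in L. norm (LINT x|\<mu>. ?f (max 0 (w + x))) \<le> real N" by simp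
      qed measurable
      show "integrable L (\<lambda>w. 1 + min (l * exp (\<theta> * w)) (real N))"
        using bnd[OF l(1)] by simp
      fix w
      \<comment> \<open>This is exp(\<theta> max(0,y)) \<le> 1 + exp(\<theta> y) at y = w + x, which
        survives truncation at N \<ge> 1.\<close>
      have pt: "?f (max 0 (w + x)) \<le> 1 + min (exp (\<theta> * w) * exp (\<theta> * x)) (real N)" for x
        using N by (auto simp: max_def min_def exp_add distrib_left)
      have i1: "integrable \<mu> (\<lambda>x. min (exp (\<theta> * w) * exp (\<theta> * x)) (real N))"
        by (rule \<mu>.integrable_const_bound[of _ "real N"]) auto
      have "(LINT x|\<mu>. ?f (max 0 (w + x))) \<le> (LINT x|\<mu>. 1 + min (exp (\<theta> * w) * exp (\<theta> * x)) (real N))"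
        by (rule integral_mono[OF \<mu>.integrable_const_bound[of _ "real N"] _ pt]) (use i1 in auto)
      also have "\<dots> = 1 + (LINT x|\<mu>. min (exp (\<theta> * w) * exp (\<theta> * x)) (real N))"
        using i1 by (simp add: \<mu>.prob_space[simplified])
      also have "(LINT x|\<mu>. min (exp (\<theta> * w) * exp (\<theta> * x)) (real N)) \<le> min (l * exp (\<theta> * w)) (real N)"
      proof (rule min.boundedI)
        have "(LINT x|\<mu>. min (exp (\<theta> * w) * exp (\<theta> * x)) (real N)) \<le> (LINT x|\<mu>. exp (\<theta> * w) * exp (\<theta> * x))"
          using int by (intro integral_mono i1) auto
        thus "(LINT x|\<mu>. min (exp (\<theta> * w) * exp (\<theta> * x)) (real N)) \<le> l * exp (\<theta> * w)"
          by (simp add: l_def mult.commute)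
        have "(LINT x|\<mu>. min (exp (\<theta> * w) * exp (\<theta> * x)) (real N)) \<le> (LINT x|\<mu>. real N)"
          by (intro integral_mono i1) auto
        thus "(LINT x|\<mu>. min (exp (\<theta> * w) * exp (\<theta> * x)) (real N)) \<le> real N"
          by (simp add: \<mu>.prob_space[simplified])
      qed
      finally show "(LINT x|\<mu>. ?f (max 0 (w + x))) \<le> 1 + min (l * exp (\<theta> * w)) (real N)" by simp
    qed
    also have "\<dots> = 1 + (LINT w|L. min (l * exp (\<theta> * w)) (real N))"
      using bnd[OF l(1)] by (simp add: L.prob_space[simplified])
    \<comment> \<open>Both truncated means are finite and may be subtracted. Since l < 1 the
      remaining integrand is nonnegative, and it is at least (1 - l) exp(\<theta> w) where
      exp(\<theta> w) \<le> N.\<close>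
    finally have "(LINT w|L. ?f w - min (l * exp (\<theta> * w)) (real N)) \<le> 1"
      using bnd[OF l(1), of N] bnd[of 1 N] by (subst Bochner_Integration.integral_diff) auto
    moreover have "(LINT w|L. (1 - l) * (exp (\<theta> * w) * indicator {w. exp (\<theta> * w) \<le> real N} w))
        \<le> (LINT w|L. ?f w - min (l * exp (\<theta> * w)) (real N))"
    proof (rule integral_mono)
      show "integrable L (\<lambda>w. (1 - l) * (exp (\<theta> * w) * indicator {w. exp (\<theta> * w) \<le> real N} w))"
        by (intro integrable_mult_right L.integrable_const_bound[of _ "real N"]) (auto simp: indicator_def)
      show "integrable L (\<lambda>w. ?f w - min (l * exp (\<theta> * w)) (real N))"
        using bnd[OF l(1), of N] bnd[of 1 N] by auto
      fix w
      have "l * exp (\<theta> * w) \<le> 1 * exp (\<theta> * w)" using l by (intro mult_right_mono) auto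
      thus "(1 - l) * (exp (\<theta> * w) * indicator {w. exp (\<theta> * w) \<le> real N} w) \<le> ?f w - min (l * exp (\<theta> * w)) (real N)"
        by (auto simp: indicator_def algebra_simps)
    qed
    ultimately show ?thesis by simp
  qed
  have "(\<integral>\<^sup>+w. ennreal (exp (\<theta> * w)) \<partial>L)
      = (\<integral>\<^sup>+w. (SUP N. ennreal (exp (\<theta> * w) * indicator {w. exp (\<theta> * w) \<le> real N} w)) \<partial>L)"
  proof (rule nn_integral_cong)
    fix w
    obtain N where N: "exp (\<theta> * w) \<le> real N" using real_arch_simple by blast
    show "ennreal (exp (\<theta> * w)) = (SUP N. ennreal (exp (\<theta> * w) * indicator {w. exp (\<theta> * w) \<le> real N} w))"
    proof (rule antisym)
      show "ennreal (exp (\<theta> * w)) \<le> (SUP N. ennreal (exp (\<theta> * w) * indicator {w. exp (\<theta> * w) \<le> real N} w))"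
        by (rule SUP_upper2[of N]) (use N in auto)
      show "(SUP N. ennreal (exp (\<theta> * w) * indicator {w. exp (\<theta> * w) \<le> real N} w)) \<le> ennreal (exp (\<theta> * w))"
        by (rule SUP_least) (auto simp: indicator_def)
    qed
  qed
  also have "\<dots> = (SUP N. \<integral>\<^sup>+w. ennreal (exp (\<theta> * w) * indicator {w. exp (\<theta> * w) \<le> real N} w) \<partial>L)"
    by (rule nn_integral_monotone_convergence_SUP)
       (auto simp: incseq_def le_fun_def indicator_def)
  also have "\<dots> \<le> ennreal (1 / (1 - l))"
  proof (rule SUP_least)
    \<comment> \<open>\<open>trunc\<close> starts at N = 1, so \<open>N\<close> is first enlarged to
      \<open>Suc N\<close>.\<close>
    fix N :: nat
    have "(\<integral>\<^sup>+w. ennreal (exp (\<theta> * w) * indicator {w. exp (\<theta> * w) \<le> real N} w) \<partial>L)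
       \<le> (\<integral>\<^sup>+w. ennreal (exp (\<theta> * w) * indicator {w. exp (\<theta> * w) \<le> real (Suc N)} w) \<partial>L)"
      by (rule nn_integral_mono) (auto simp: indicator_def)
    also have "\<dots> = ennreal (LINT w|L. exp (\<theta> * w) * indicator {w. exp (\<theta> * w) \<le> real (Suc N)} w)"
      by (intro nn_integral_eq_integral L.integrable_const_bound[of _ "real (Suc N)"]) (auto simp: indicator_def)
    also have "\<dots> \<le> ennreal (1 / (1 - l))"
      using trunc[of "Suc N"] l by (intro ennreal_leI) (simp add: field_simps)
    finally show "(\<integral>\<^sup>+w. ennreal (exp (\<theta> * w) * indicator {w. exp (\<theta> * w) \<le> real N} w) \<partial>L) \<le> ennreal (1 / (1 - l))" .
  qed
  finally have *: "(\<integral>\<^sup>+w. ennreal (exp (\<theta> * w)) \<partial>L) \<le> ennreal (1 / (1 - l))" .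
  show i: "integrable L (\<lambda>w. exp (\<theta> * w))"
    using * by (intro integrableI_bounded) (auto intro: le_less_trans)
  have "ennreal (LINT w|L. exp (\<theta> * w)) \<le> ennreal (1 / (1 - l))"
    using * by (subst nn_integral_eq_integral[OF i, symmetric]) auto
  thus "(LINT w|L. exp (\<theta> * w)) \<le> 1 / (1 - (LINT x|\<mu>. exp (\<theta> * x)))"
    using l by (simp add: l_def[symmetric])
qed

text \<open>For a \<le> 0 the ramp is affine on the support. The difference of two such transforms
  is therefore constant on the negative half-line, and its size there is controlled by its value at
  0.\<close>

lemma (in real_distribution) stop_loss_nonpos:
  assumes "AE w in M. 0 \<le> w" "0 < \<theta>" "integrable M (\<lambda>x. exp (\<theta> * x))" "a \<le> 0"
  shows "stop_loss M a = stop_loss M 0 - a"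
proof -
  have "stop_loss M a = (LINT w|M. max 0 (w - 0) - a)"
    unfolding stop_loss_def
  proof (rule integral_cong_AE)
    show "AE w in M. max 0 (w - a) = max 0 (w - 0) - a"
      using assms(1) by eventually_elim (use assms(4) in auto)
  qed measurable
  also have "\<dots> = stop_loss M 0 - a"
    using integrable_ramp[OF assms(2,3), of 0] prob_space by (simp add: stop_loss_def)
  finally show ?thesis .
qed

lemma integrable_pair_ramp:
  assumes "real_distribution \<mu>" "real_distribution L" and \<theta>: "0 < \<theta>"
    and int: "integrable \<mu> (\<lambda>x. exp (\<theta> * x))" "integrable L (\<lambda>x. exp (\<theta> * x))"
  shows "integrable (L \<Otimes>\<^sub>M \<mu>) (\<lambda>(w, x). max 0 (w + x - a))"
proof -
  interpret \<mu>: real_distribution \<mu> by fact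
  interpret L: real_distribution L by fact
  interpret pair_sigma_finite L \<mu> ..
  have "integrable (L \<Otimes>\<^sub>M \<mu>) (\<lambda>(w, x). exp (\<theta> * w) * (exp (\<theta> * x) * (exp (- \<theta> * a) / \<theta>)))"
  proof (rule Fubini_integrable)
    show "integrable L (\<lambda>w. LINT x|\<mu>. norm (case (w, x) of (w, x) \<Rightarrow> exp (\<theta> * w) * (exp (\<theta> * x) * (exp (- \<theta> * a) / \<theta>))))"
      using int \<theta> by (simp add: abs_mult)
  qed (use int in auto)
  thus ?thesis
  proof (rule Bochner_Integration.integrable_bound)
    show "AE p in L \<Otimes>\<^sub>M \<mu>. norm (case p of (w, x) \<Rightarrow> max 0 (w + x - a))
        \<le> norm (case p of (w, x) \<Rightarrow> exp (\<theta> * w) * (exp (\<theta> * x) * (exp (- \<theta> * a) / \<theta>)))"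
    proof (rule AE_I2)
      fix p :: "real \<times> real"
      obtain w x where p: "p = (w, x)" by fastforce
      show "norm (case p of (w, x) \<Rightarrow> max 0 (w + x - a))
        \<le> norm (case p of (w, x) \<Rightarrow> exp (\<theta> * w) * (exp (\<theta> * x) * (exp (- \<theta> * a) / \<theta>)))"
        using ramp_le_exp[OF \<theta>, of "w + x - a"] \<theta>
        by (simp add: p exp_add[symmetric] algebra_simps)
    qed
  qed measurable
qed

lemma lindley_stationary_stop_loss:
  assumes st: "lindley_stationary \<mu> L" and \<theta>: "0 < \<theta>" and a: "0 \<le> a"
    and int: "integrable L (\<lambda>x. exp (\<theta> * x))"
  shows "stop_loss L a = (LINT w|L. stop_loss \<mu> (a - w))"
proof -
  interpret L: real_distribution L using st by (simp add: lindley_stationary_def)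
  have "stop_loss L a = (LINT w|L. LINT x|\<mu>. max 0 (max 0 (w + x) - a))"
    unfolding stop_loss_def by (rule lindley_stationary_integral[OF st L.integrable_ramp[OF \<theta> int]])
  also have "\<dots> = (LINT w|L. stop_loss \<mu> (a - w))"
    unfolding stop_loss_def using a
    by (intro Bochner_Integration.integral_cong) (auto simp: max_def)
  finally show ?thesis .
qed

text \<open>Both iterated integrals equal the expected ramp of an independent sum. The exchange
  allows the error of the increments to be averaged over \<open>L\<close> and the error of the
  stationary laws over the increment.\<close>

lemma stop_loss_swap:
  assumes "real_distribution \<mu>" "real_distribution L" and \<theta>: "0 < \<theta>"
    and int: "integrable \<mu> (\<lambda>x. exp (\<theta> * x))" "integrable L (\<lambda>x. exp (\<theta> * x))"
  shows "(LINT w|L. stop_loss \<mu> (a - w)) = (LINT x|\<mu>. stop_loss L (a - x))"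
    and "integrable L (\<lambda>w. stop_loss \<mu> (a - w))" and "integrable \<mu> (\<lambda>x. stop_loss L (a - x))"
proof -
  interpret \<mu>: real_distribution \<mu> by fact
  interpret L: real_distribution L by fact
  interpret pair_sigma_finite L \<mu> ..
  note I = integrable_pair_ramp[OF assms, of a]
  have 1: "(LINT x|\<mu>. max 0 (w + x - a)) = stop_loss \<mu> (a - w)" for w
    unfolding stop_loss_def by (simp add: algebra_simps)
  have 2: "(LINT w|L. max 0 (w + x - a)) = stop_loss L (a - x)" for x
    unfolding stop_loss_def by (simp add: algebra_simps)
  show "(LINT w|L. stop_loss \<mu> (a - w)) = (LINT x|\<mu>. stop_loss L (a - x))"
    using Fubini_integral[OF I] unfolding 1 2 by simp
  show "integrable L (\<lambda>w. stop_loss \<mu> (a - w))" "integrable \<mu> (\<lambda>x. stop_loss L (a - x))"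
    using integrable_fst[OF I] integrable_snd[OF I] unfolding 1 2 by simp_all
qed

text \<open>One step of the recursion contracts the weighted supremum norm of the difference of stop-loss
  transforms by the factor \<open>LINT x|\<nu>. exp (\<theta> * x)\<close>.\<close>

lemma stationary_stop_loss_diff_le:
  assumes L: "lindley_stationary \<mu> L" and K: "lindley_stationary \<nu> K" and \<theta>: "0 < \<theta>"
    and int\<mu>: "integrable \<mu> (\<lambda>x. exp (\<theta> * x))" and less\<mu>: "(LINT x|\<mu>. exp (\<theta> * x)) < 1"
    and int\<nu>: "integrable \<nu> (\<lambda>x. exp (\<theta> * x))" and less\<nu>: "(LINT x|\<nu>. exp (\<theta> * x)) < 1"
    and D: "\<And>a. exp (\<theta> * a) * \<bar>stop_loss \<mu> a - stop_loss \<nu> a\<bar> \<le> D"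
    and a: "0 \<le> a"
  shows "exp (\<theta> * a) * \<bar>stop_loss L a - stop_loss K a\<bar>
    \<le> D / ((1 - (LINT x|\<mu>. exp (\<theta> * x))) * (1 - (LINT x|\<nu>. exp (\<theta> * x))))"
proof -
  have rd: "real_distribution \<mu>" "real_distribution \<nu>" "real_distribution L" "real_distribution K"
    using L K by (auto simp: lindley_stationary_def)
  interpret \<mu>: real_distribution \<mu> by fact
  interpret \<nu>: real_distribution \<nu> by fact
  interpret L: real_distribution L by fact
  interpret K: real_distribution K by fact
  define l where "l = (LINT x|\<mu>. exp (\<theta> * x))"
  define k where "k = (LINT x|\<nu>. exp (\<theta> * x))"
  have k: "0 \<le> k" "k < 1" using less\<nu> by (auto simp: k_def intro!: Bochner_Integration.integral_nonneg)
  have D0: "0 \<le> D" using D[of 0] by (meson abs_ge_zero exp_ge_zero mult_nonneg_nonneg order_trans)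
  note mL = lindley_stationary_exp_moment[OF L \<theta> int\<mu> less\<mu>]
  note mK = lindley_stationary_exp_moment[OF K \<theta> int\<nu> less\<nu>]
  \<comment> \<open>The weighted supremum norm. Its finiteness, \<open>bdd\<close>, is what permits
    the term \<open>k * N\<close> to be absorbed at the end.\<close>
  define N where "N = (SUP a\<in>{0..}. exp (\<theta> * a) * \<bar>stop_loss L a - stop_loss K a\<bar>)"
  have bdd: "bdd_above ((\<lambda>a. exp (\<theta> * a) * \<bar>stop_loss L a - stop_loss K a\<bar>) ` {0..})"
  proof (rule bdd_aboveI2)
    fix a
    have "exp (\<theta> * a) * \<bar>stop_loss L a - stop_loss K a\<bar> \<le> exp (\<theta> * a) * (stop_loss L a + stop_loss K a)"
      using L.stop_loss_nonneg[of a] K.stop_loss_nonneg[of a] by (intro mult_left_mono) auto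
    also have "\<dots> \<le> (LINT x|L. exp (\<theta> * x)) / \<theta> + (LINT x|K. exp (\<theta> * x)) / \<theta>"
      using L.stop_loss_le[OF \<theta> mL(1), of a] K.stop_loss_le[OF \<theta> mK(1), of a] by (simp add: distrib_left)
    finally show "exp (\<theta> * a) * \<bar>stop_loss L a - stop_loss K a\<bar> \<le> (LINT x|L. exp (\<theta> * x)) / \<theta> + (LINT x|K. exp (\<theta> * x)) / \<theta>" .
  qed
  have le_N: "exp (\<theta> * a) * \<bar>stop_loss L a - stop_loss K a\<bar> \<le> N" if "0 \<le> a" for a
    unfolding N_def using that by (intro cSUP_upper bdd) auto
  have "AE w in L. 0 \<le> w" "AE w in K. 0 \<le> w" using L K by (auto simp: lindley_stationary_def)
  hence neg: "stop_loss L a - stop_loss K a = stop_loss L 0 - stop_loss K 0" if "a < 0" for a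
    using L.stop_loss_nonpos[OF _ \<theta> mL(1), of a] K.stop_loss_nonpos[OF _ \<theta> mK(1), of a] that by simp
  have step: "exp (\<theta> * a) * \<bar>stop_loss L a - stop_loss K a\<bar> \<le> D / (1 - l) + k * N" if a: "0 \<le> a" for a
  proof -
    have eqL: "stop_loss L a = (LINT w|L. stop_loss \<mu> (a - w))"
      by (rule lindley_stationary_stop_loss[OF L \<theta> a mL(1)])
    have eqK: "stop_loss K a = (LINT x|\<nu>. stop_loss K (a - x))"
      unfolding lindley_stationary_stop_loss[OF K \<theta> a mK(1)]
      by (rule stop_loss_swap[OF rd(2,4) \<theta> int\<nu> mK(1)])
    note swL\<mu> = stop_loss_swap[OF rd(1,3) \<theta> int\<mu> mL(1), of a]
    note swL = stop_loss_swap[OF rd(2,3) \<theta> int\<nu> mL(1), of a]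
    note swK = stop_loss_swap[OF rd(2,4) \<theta> int\<nu> mK(1), of a]
    \<comment> \<open>The mixed term, the expected ramp for an independent pair from
      \<open>L\<close> and \<nu>, is inserted. The first difference then compares increments, the
      second compares stationary laws.\<close>
    have "stop_loss L a - stop_loss K a
        = (LINT w|L. stop_loss \<mu> (a - w) - stop_loss \<nu> (a - w)) + (LINT x|\<nu>. stop_loss L (a - x) - stop_loss K (a - x))"
      unfolding eqL eqK Bochner_Integration.integral_diff[OF swL\<mu>(2) swL(2)]
        Bochner_Integration.integral_diff[OF swL(3) swK(3)] swL(1) by simp
    hence "\<bar>stop_loss L a - stop_loss K a\<bar>
        \<le> (LINT w|L. \<bar>stop_loss \<mu> (a - w) - stop_loss \<nu> (a - w)\<bar>) + (LINT x|\<nu>. \<bar>stop_loss L (a - x) - stop_loss K (a - x)\<bar>)"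
      by (simp only:) (rule order_trans[OF abs_triangle_ineq add_mono[OF integral_abs_bound integral_abs_bound]])
    also have "(LINT w|L. \<bar>stop_loss \<mu> (a - w) - stop_loss \<nu> (a - w)\<bar>) \<le> (LINT w|L. exp (- \<theta> * a) * D * exp (\<theta> * w))"
    proof (rule integral_mono)
      fix w
      have "exp (\<theta> * a) * exp (- (\<theta> * w)) * \<bar>stop_loss \<mu> (a - w) - stop_loss \<nu> (a - w)\<bar> \<le> D"
        using D[of "a - w"] by (simp add: right_diff_distrib exp_diff exp_minus divide_inverse)
      thus "\<bar>stop_loss \<mu> (a - w) - stop_loss \<nu> (a - w)\<bar> \<le> exp (- \<theta> * a) * D * exp (\<theta> * w)"
        by (simp add: exp_minus field_simps)
    qed (use swL\<mu>(2) swL(2) mL(1) in auto)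
    also have "\<dots> = exp (- \<theta> * a) * D * (LINT w|L. exp (\<theta> * w))" by simp
    also have "(LINT x|\<nu>. \<bar>stop_loss L (a - x) - stop_loss K (a - x)\<bar>) \<le> (LINT x|\<nu>. exp (- \<theta> * a) * N * exp (\<theta> * x))"
    proof (rule integral_mono)
      fix x
      show "\<bar>stop_loss L (a - x) - stop_loss K (a - x)\<bar> \<le> exp (- \<theta> * a) * N * exp (\<theta> * x)"
      proof (cases "0 \<le> a - x")
        case True
        from le_N[OF this] have "exp (\<theta> * a) * exp (- (\<theta> * x)) * \<bar>stop_loss L (a - x) - stop_loss K (a - x)\<bar> \<le> N"
          by (simp add: right_diff_distrib exp_diff exp_minus divide_inverse)
        thus ?thesis by (simp add: exp_minus field_simps)
      next
        \<comment> \<open>Left of 0 the difference has its value at 0. As a < x, the weight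
          exp(\<theta> (x - a)) is at least 1, so the bound persists.\<close>
        case False
        have N0: "\<bar>stop_loss L 0 - stop_loss K 0\<bar> \<le> N" using le_N[of 0] by simp
        hence "0 \<le> N" by linarith
        moreover have "exp (\<theta> * a) \<le> exp (\<theta> * x)" using False \<theta> by simp
        ultimately have "1 * N \<le> exp (\<theta> * x - \<theta> * a) * N" by (intro mult_right_mono) auto
        with N0 have "\<bar>stop_loss L 0 - stop_loss K 0\<bar> \<le> exp (- \<theta> * a) * N * exp (\<theta> * x)"
          by (simp add: exp_diff exp_minus divide_inverse mult_ac)
        thus ?thesis using neg[of "a - x"] False by simp
      qed
    qed (use swL(3) swK(3) int\<nu> in auto)
    also have "\<dots> = exp (- \<theta> * a) * N * k" by (simp add: k_def)
    finally have "exp (\<theta> * a) * \<bar>stop_loss L a - stop_loss K a\<bar>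
        \<le> exp (\<theta> * a) * (exp (- \<theta> * a) * D * (LINT w|L. exp (\<theta> * w)) + exp (- \<theta> * a) * N * k)"
      by (intro mult_left_mono) auto
    also have "\<dots> = D * (LINT w|L. exp (\<theta> * w)) + k * N"
      by (simp add: exp_minus field_simps)
    also have "D * (LINT w|L. exp (\<theta> * w)) \<le> D * (1 / (1 - l))"
      using mL(2) D0 by (intro mult_left_mono) (auto simp: l_def)
    finally show ?thesis by simp
  qed
  have "N \<le> D / (1 - l) + k * N"
    by (subst N_def, rule cSUP_least) (use step in auto)
  hence "N * (1 - k) \<le> D / (1 - l)" by (simp add: algebra_simps)
  hence "N \<le> D / ((1 - l) * (1 - k))"
    using k by (simp add: pos_le_divide_eq[symmetric])
  thus ?thesis using le_N[OF a] by (simp add: l_def k_def)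
qed

section \<open>From stop-loss transforms to Laplace transforms\<close>

lemma has_bochner_integral_exp_neg:
  assumes c: "0 < (c::real)"
  shows "has_bochner_integral lborel (\<lambda>a. indicator {0..} a * exp (- c * a)) (1 / c)"
proof -
  interpret prob_space "density lborel (erlang_density 0 c)"
    using c by (rule prob_space_erlang_density)
  have eq: "erlang_density 0 c a = c * (indicator {0..} a * exp (- c * a))" for a
    by (auto simp: erlang_density_def)
  have "integrable (density lborel (erlang_density 0 c)) (\<lambda>x. 1::real)" by (rule integrable_const)
  hence i: "integrable lborel (\<lambda>a. c * (indicator {0..} a * exp (- c * a)))"
    using c unfolding eq[symmetric] by (subst (asm) integrable_density) auto
  have "(LINT x|density lborel (erlang_density 0 c). 1::real) = 1"
    by (simp add: prob_space[simplified])
  hence "(LBINT a. c * (indicator {0..} a * exp (- c * a))) = 1"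
    using c unfolding eq[symmetric] by (subst (asm) integral_density) auto
  moreover have "integrable lborel (\<lambda>a. inverse c * (c * (indicator {0..} a * exp (- c * a))))"
    by (intro integrable_mult_right i)
  moreover have "inverse c * (c * z) = z" for z using c by simp
  ultimately show ?thesis
    using c unfolding has_bochner_integral_iff by (simp add: eq_divide_eq mult.commute)
qed

text \<open>Taylor's formula with integral remainder: \<open>F\<close> is an antiderivative in a of
  s^2 exp(-s a) (w - a), with F(w) = exp(-s w) and F(0) = 1 - s w. The linear term is written with
  \<open>max 0 (w - 0)\<close> so that its mean is literally \<open>stop_loss M 0\<close>.\<close>

lemma exp_ramp_expansion:
  assumes w: "0 \<le> w"
  shows "exp (- s * complex_of_real w) = 1 - s * complex_of_real (max 0 (w - 0))
    + s\<^sup>2 * (LBINT a. indicator {0..} a *\<^sub>R (exp (- s * complex_of_real a) * complex_of_real (max 0 (w - a))))"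
proof -
  define F where "F = (\<lambda>a. exp (- s * complex_of_real a) * (1 - s * (complex_of_real w - complex_of_real a)))"
  have "(LBINT a. indicator {0..w} a *\<^sub>R (s\<^sup>2 * (exp (- s * complex_of_real a) * complex_of_real (w - a)))) = F w - F 0"
  proof (rule integral_FTC_Icc[OF w])
    fix a assume "0 \<le> a" "a \<le> w"
    have "((\<lambda>z. exp (- s * z) * (1 - s * (complex_of_real w - z))) has_field_derivative
        s\<^sup>2 * (exp (- s * complex_of_real a) * complex_of_real (w - a))) (at (complex_of_real a))"
      by (auto intro!: derivative_eq_intros simp: power2_eq_square algebra_simps)
    hence "(F has_vector_derivative s\<^sup>2 * (exp (- s * complex_of_real a) * complex_of_real (w - a))) (at a)"
      unfolding F_def by (rule has_vector_derivative_real_field[unfolded o_def])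
    thus "(F has_vector_derivative s\<^sup>2 * (exp (- s * complex_of_real a) * complex_of_real (w - a))) (at a within {0..w})"
      by (rule has_vector_derivative_at_within)
  qed (intro continuous_intros)
  also have "(\<lambda>a. indicator {0..w} a *\<^sub>R (s\<^sup>2 * (exp (- s * complex_of_real a) * complex_of_real (w - a))))
     = (\<lambda>a. s\<^sup>2 * (indicator {0..} a *\<^sub>R (exp (- s * complex_of_real a) * complex_of_real (max 0 (w - a)))))"
    by (auto simp: indicator_def max_def)
  finally show ?thesis using w unfolding integral_mult_right_zero by (simp add: F_def algebra_simps)
qed

text \<open>The pointwise expansion is integrated over the law. The transform decays like
  exp(-\<theta> a) while |exp(-s a)| \<le> exp(\<theta>' a), so the gap between \<theta>' and
  \<theta> is what makes Fubini applicable.\<close>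

lemma (in real_distribution) laplace_stop_loss:
  assumes nonneg: "AE w in M. 0 \<le> w" and \<theta>: "0 < \<theta>" and int: "integrable M (\<lambda>x. exp (\<theta> * x))"
    and s: "- \<theta>' \<le> Re s" "\<theta>' < \<theta>"
  shows "integrable M (\<lambda>w. exp (- s * complex_of_real w))"
    and "integrable lborel (\<lambda>a. indicator {0..} a *\<^sub>R (exp (- s * complex_of_real a) * complex_of_real (stop_loss M a)))"
    and "cmgf M (- s) = 1 - s * complex_of_real (stop_loss M 0)
      + s\<^sup>2 * (LBINT a. indicator {0..} a *\<^sub>R (exp (- s * complex_of_real a) * complex_of_real (stop_loss M a)))"
proof -
  interpret pair_sigma_finite lborel M ..
  show i1: "integrable M (\<lambda>w. exp (- s * complex_of_real w))"
  proof (rule Bochner_Integration.integrable_bound[OF int])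
    show "AE w in M. norm (exp (- s * complex_of_real w)) \<le> norm (exp (\<theta> * w))"
      using nonneg
    proof eventually_elim
      case (elim w)
      have "(- Re s) * w \<le> \<theta> * w" using s elim by (intro mult_right_mono) auto
      thus ?case by simp
    qed
  qed measurable
  define H where "H = (\<lambda>a w. indicator {0..} a *\<^sub>R (exp (- s * complex_of_real a) * complex_of_real (max 0 (w - a))))"
  have [measurable]: "case_prod H \<in> borel_measurable (lborel \<Otimes>\<^sub>M M)"
    unfolding H_def by measurable
  have norm_H: "norm (H a w) = indicator {0..} a * (exp (- Re s * a) * max 0 (w - a))" for a w
    by (simp add: H_def norm_mult)
  have inner: "(LINT w|M. H a w) = indicator {0..} a *\<^sub>R (exp (- s * complex_of_real a) * complex_of_real (stop_loss M a))" for a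
    unfolding H_def stop_loss_def by simp
  have inner_norm: "(LINT w|M. norm (H a w)) = indicator {0..} a * (exp (- Re s * a) * stop_loss M a)" for a
    unfolding norm_H stop_loss_def by simp
  have H: "integrable (lborel \<Otimes>\<^sub>M M) (case_prod H)"
  proof (rule Fubini_integrable)
    show "AE a in lborel. integrable M (\<lambda>w. case_prod H (a, w))"
      unfolding H_def using integrable_ramp[OF \<theta> int] by auto
    let ?C = "(LINT x|M. exp (\<theta> * x)) / \<theta>"
    show "integrable lborel (\<lambda>a. LINT w|M. norm (case_prod H (a, w)))"
      unfolding prod.case inner_norm
    proof (rule Bochner_Integration.integrable_bound)
      show "integrable lborel (\<lambda>a. ?C * (indicator {0..} a * exp (- (\<theta> - \<theta>') * a)))"
        using has_bochner_integral_exp_neg[of "\<theta> - \<theta>'"] s by (intro integrable_mult_right) (simp add: has_bochner_integral_iff)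
      show "(\<lambda>a. indicator {0..} a * (exp (- Re s * a) * stop_loss M a)) \<in> borel_measurable lborel"
        unfolding stop_loss_def by measurable
      show "AE a in lborel. norm (indicator {0..} a * (exp (- Re s * a) * stop_loss M a))
          \<le> norm (?C * (indicator {0..} a * exp (- (\<theta> - \<theta>') * a)))"
      proof (rule AE_I2)
        fix a :: real
        have "exp (- Re s * a) * stop_loss M a \<le> ?C * exp (- (\<theta> - \<theta>') * a)" if "0 \<le> a"
        proof -
          have "exp (- Re s * a) * stop_loss M a \<le> exp (\<theta>' * a) * stop_loss M a"
            using s mult_right_mono[of "- Re s" \<theta>' a] that stop_loss_nonneg by (intro mult_right_mono) auto
          also have "\<dots> = exp (- (\<theta> - \<theta>') * a) * (exp (\<theta> * a) * stop_loss M a)"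
            by (simp add: exp_add[symmetric] algebra_simps)
          also have "\<dots> \<le> exp (- (\<theta> - \<theta>') * a) * ?C"
            by (intro mult_left_mono stop_loss_le \<theta> int) simp
          finally show ?thesis by (simp add: mult_ac)
        qed
        moreover have "0 \<le> ?C" using \<theta> by (auto intro!: Bochner_Integration.integral_nonneg)
        ultimately show "norm (indicator {0..} a * (exp (- Re s * a) * stop_loss M a))
          \<le> norm (?C * (indicator {0..} a * exp (- (\<theta> - \<theta>') * a)))"
          using stop_loss_nonneg[of a] \<theta> by (auto simp: indicator_def abs_mult)
      qed
    qed
  qed measurable
  show "integrable lborel (\<lambda>a. indicator {0..} a *\<^sub>R (exp (- s * complex_of_real a) * complex_of_real (stop_loss M a)))"
    using integrable_fst[OF H] unfolding inner .
  define R where "R = (\<lambda>w. complex_of_real (max 0 (w - 0)))"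
  have ramp: "integrable M R"
    unfolding R_def using integrable_ramp[OF \<theta> int] by (intro integrable_of_real)
  have R_int: "(LINT w|M. R w) = complex_of_real (stop_loss M 0)"
    unfolding R_def stop_loss_def by (rule integral_complex_of_real)
  have i2: "integrable M (\<lambda>w. LBINT a. H a w)"
    by (rule integrable_snd[OF H])
  have "cmgf M (- s) = (LINT w|M. 1 - s * R w + s\<^sup>2 * (LBINT a. H a w))"
    unfolding cmgf_def
  proof (rule integral_cong_AE)
    show "AE w in M. exp (- s * complex_of_real w) = 1 - s * R w + s\<^sup>2 * (LBINT a. H a w)"
      using nonneg by eventually_elim (unfold H_def R_def, rule exp_ramp_expansion)
  qed (unfold R_def, measurable)
  also have "\<dots> = 1 - s * complex_of_real (stop_loss M 0) + s\<^sup>2 * (LINT w|M. (LBINT a. H a w))"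
  proof -
    have i3: "integrable M (\<lambda>w. s * R w)" "integrable M (\<lambda>w. s\<^sup>2 * (LBINT a. H a w))"
      using ramp i2 by (intro integrable_mult_right; simp)+
    have one: "(LINT w|M. (1::complex)) = 1" using prob_space by simp
    show ?thesis
      unfolding Bochner_Integration.integral_add[OF Bochner_Integration.integrable_diff[OF integrable_const i3(1)] i3(2)]
        Bochner_Integration.integral_diff[OF integrable_const i3(1)] integral_mult_right_zero R_int one ..
  qed
  also have "(LINT w|M. (LBINT a. H a w)) = (LBINT a. (LINT w|M. H a w))"
    by (rule Fubini_integral[OF H])
  finally show "cmgf M (- s) = 1 - s * complex_of_real (stop_loss M 0)
      + s\<^sup>2 * (LBINT a. indicator {0..} a *\<^sub>R (exp (- s * complex_of_real a) * complex_of_real (stop_loss M a)))"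
    unfolding inner .
qed

text \<open>The constant terms of the two expansions cancel. The linear term costs N |s|, and in the
  integral the weight leaves exp(-(\<theta> - \<theta>') a), whose integral is the reciprocal of the
  margin.\<close>

lemma laplace_diff_le:
  assumes "real_distribution L" "real_distribution K"
    and "AE w in L. 0 \<le> w" "AE w in K. 0 \<le> w" and \<theta>: "0 < \<theta>"
    and int: "integrable L (\<lambda>x. exp (\<theta> * x))" "integrable K (\<lambda>x. exp (\<theta> * x))"
    and s: "- \<theta>' \<le> Re s" "\<theta>' < \<theta>"
    and N: "\<And>a. 0 \<le> a \<Longrightarrow> exp (\<theta> * a) * \<bar>stop_loss L a - stop_loss K a\<bar> \<le> N"
  shows "cmod (cmgf L (- s) - cmgf K (- s)) \<le> N * (cmod s + (cmod s)\<^sup>2 / (\<theta> - \<theta>'))"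
proof -
  interpret L: real_distribution L by fact
  interpret K: real_distribution K by fact
  note l = L.laplace_stop_loss[OF assms(3) \<theta> int(1) s]
  note k = K.laplace_stop_loss[OF assms(4) \<theta> int(2) s]
  let ?d = "\<lambda>a. stop_loss L a - stop_loss K a"
  let ?g = "\<lambda>a. indicator {0..} a *\<^sub>R (exp (- s * complex_of_real a) * complex_of_real (?d a))"
  have N0: "0 \<le> N" using N[of 0] by simp
  have g: "?g = (\<lambda>a. indicator {0..} a *\<^sub>R (exp (- s * complex_of_real a) * complex_of_real (stop_loss L a))
      - indicator {0..} a *\<^sub>R (exp (- s * complex_of_real a) * complex_of_real (stop_loss K a)))"
    by (simp add: algebra_simps)
  have ig: "integrable lborel ?g" unfolding g using l(2) k(2) by simp
  have "cmgf L (- s) - cmgf K (- s) = - s * complex_of_real (?d 0) + s\<^sup>2 * (LBINT a. ?g a)"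
    unfolding l(3) k(3) g Bochner_Integration.integral_diff[OF l(2) k(2)] by (simp add: algebra_simps)
  hence "cmod (cmgf L (- s) - cmgf K (- s)) \<le> cmod s * \<bar>?d 0\<bar> + (cmod s)\<^sup>2 * cmod (LBINT a. ?g a)"
    by (simp only:) (rule norm_triangle_le, simp add: norm_mult norm_power del: of_real_diff)
  also have "\<dots> \<le> cmod s * N + (cmod s)\<^sup>2 * (N / (\<theta> - \<theta>'))"
  proof (intro add_mono mult_left_mono)
    show "\<bar>?d 0\<bar> \<le> N" using N[of 0] by simp
    have e: "has_bochner_integral lborel (\<lambda>a. indicator {0..} a * exp (- (\<theta> - \<theta>') * a)) (1 / (\<theta> - \<theta>'))"
      using s by (intro has_bochner_integral_exp_neg) simp
    have "cmod (LBINT a. ?g a) \<le> (LBINT a. cmod (?g a))" by (rule integral_norm_bound)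
    also have "\<dots> \<le> (LBINT a. N * (indicator {0..} a * exp (- (\<theta> - \<theta>') * a)))"
    proof (rule integral_mono)
      show "integrable lborel (\<lambda>a. N * (indicator {0..} a * exp (- (\<theta> - \<theta>') * a)))"
        using e by (intro integrable_mult_right) (simp add: has_bochner_integral_iff)
      fix a :: real
      show "cmod (?g a) \<le> N * (indicator {0..} a * exp (- (\<theta> - \<theta>') * a))"
      proof (cases "0 \<le> a")
        case True
        have "exp (- Re s * a) * \<bar>?d a\<bar> \<le> exp (\<theta>' * a) * \<bar>?d a\<bar>"
          using s mult_right_mono[of "- Re s" \<theta>' a] True by (intro mult_right_mono) auto
        also have "\<dots> = exp (- (\<theta> - \<theta>') * a) * (exp (\<theta> * a) * \<bar>?d a\<bar>)"
          by (simp add: exp_add[symmetric] algebra_simps)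
        also have "\<dots> \<le> exp (- (\<theta> - \<theta>') * a) * N"
          by (intro mult_left_mono N True) simp
        finally show ?thesis using True by (simp add: norm_mult mult_ac del: of_real_diff)
      qed simp
    qed (rule integrable_norm[OF ig])
    also have "\<dots> = N / (\<theta> - \<theta>')"
      using e by (simp add: has_bochner_integral_iff)
    finally show "cmod (LBINT a. ?g a) \<le> N / (\<theta> - \<theta>')" .
  qed auto
  finally show ?thesis by (simp add: algebra_simps)
qed

section \<open>The maximum of a random walk\<close>

text \<open>On the null set of unbounded walks \<open>walk_max\<close> is the junk value \<open>Sup UNIV\<close>; this value does not
  depend on the walk, so \<open>walk_max\<close> is measurable everywhere.\<close>

lemma Sup_real_unbounded:
  assumes "\<not> bdd_above (X :: real set)"
  shows "Sup X = Sup UNIV"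
proof -
  have "(\<lambda>z. \<forall>x\<in>X. x \<le> z) = (\<lambda>z. False)"
    using assms by (auto simp: bdd_above_def fun_eq_iff)
  moreover have "(\<lambda>z::real. \<forall>x\<in>UNIV. x \<le> z) = (\<lambda>z. False)"
  proof
    fix z :: real show "(\<forall>x\<in>UNIV. x \<le> z) = False" by (auto intro: gt_ex[of z] simp: not_le)
  qed
  ultimately show ?thesis unfolding Sup_real_def by simp
qed

lemma walk_max_measurable:
  assumes "sets \<mu> = sets borel"
  shows "walk_max \<in> borel_measurable (\<Pi>\<^sub>M i\<in>(UNIV::nat set). \<mu>)"
proof -
  note [measurable_cong] = assms
  \<comment> \<open>The extended-real supremum is measurable as a countable supremum.
    \<open>walk_max\<close> is then recovered from it by a case distinction on the value
    infinity.\<close>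
  define S where "S = (\<lambda>x. SUP k::nat. ereal (\<Sum>i<k. x i))"
  have eq: "walk_max = (\<lambda>x. if S x = \<infinity> then Sup UNIV else real_of_ereal (S x))"
  proof
    fix x
    show "walk_max x = (if S x = \<infinity> then Sup UNIV else real_of_ereal (S x))"
    proof (cases "S x = \<infinity>")
      case True
      have "\<not> bdd_above (range (\<lambda>k. \<Sum>i<k. x i))"
      proof
        assume "bdd_above (range (\<lambda>k. \<Sum>i<k. x i))"
        then obtain c where "(\<Sum>i<k. x i) \<le> c" for k by (auto simp: bdd_above_def)
        hence "S x \<le> ereal c" unfolding S_def by (intro SUP_least) simp
        with True show False by simp
      qed
      thus ?thesis using True by (simp add: walk_max_def Sup_real_unbounded)
    next
      case False
      have "ereal (\<Sum>i<0. x i) \<le> S x" unfolding S_def by (rule SUP_upper) simp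
      with False have "\<bar>S x\<bar> \<noteq> \<infinity>" by auto
      hence "ereal (walk_max x) = S x" unfolding walk_max_def S_def by (rule ereal_SUP)
      thus ?thesis using False by (metis real_of_ereal.simps(1))
    qed
  qed
  have [measurable]: "S \<in> borel_measurable (\<Pi>\<^sub>M i\<in>(UNIV::nat set). \<mu>)"
    unfolding S_def by measurable
  have "(\<lambda>x. if S x = \<infinity> then Sup UNIV else real_of_ereal (S x)) \<in> borel_measurable (\<Pi>\<^sub>M i\<in>(UNIV::nat set). \<mu>)"
    by measurable
  thus ?thesis unfolding eq .
qed

text \<open>The pathwise form of the Lindley recursion: after a step \<open>s\<close> is prepended,
  the partial sums are 0 and \<open>s\<close> plus the old ones. Boundedness ensures that the
  suprema are genuine.\<close>

lemma walk_max_case_nat: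
  assumes "bdd_above (range (\<lambda>k. \<Sum>i<k. \<omega> i))"
  shows "walk_max (case_nat s \<omega>) = max 0 (walk_max \<omega> + s)"
proof -
  have sums: "(\<Sum>i<Suc k. case_nat s \<omega> i) = s + (\<Sum>i<k. \<omega> i)" for k
    by (subst sum.lessThan_Suc_shift) simp
  have le: "(\<Sum>i<k. \<omega> i) \<le> walk_max \<omega>" for k
    unfolding walk_max_def by (rule cSUP_upper[OF _ assms]) simp
  have up: "(\<Sum>i<k. case_nat s \<omega> i) \<le> max 0 (walk_max \<omega> + s)" for k
  proof (cases k)
    case (Suc j)
    thus ?thesis unfolding Suc sums using le[of j] by auto
  qed simp
  hence bdd: "bdd_above (range (\<lambda>k. \<Sum>i<k. case_nat s \<omega> i))" by (rule bdd_aboveI2)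
  show ?thesis
  proof (rule antisym)
    show "walk_max (case_nat s \<omega>) \<le> max 0 (walk_max \<omega> + s)"
      unfolding walk_max_def[of "case_nat s \<omega>"] by (rule cSUP_least) (use up in auto)
    have "(\<Sum>i<0. case_nat s \<omega> i) \<le> walk_max (case_nat s \<omega>)"
      unfolding walk_max_def by (rule cSUP_upper[OF _ bdd]) simp
    moreover have "walk_max \<omega> \<le> walk_max (case_nat s \<omega>) - s"
      unfolding walk_max_def[of \<omega>]
    proof (rule cSUP_least)
      fix k
      have "(\<Sum>i<Suc k. case_nat s \<omega> i) \<le> walk_max (case_nat s \<omega>)"
        unfolding walk_max_def by (rule cSUP_upper[OF _ bdd]) simp
      thus "(\<Sum>i<k. \<omega> i) \<le> walk_max (case_nat s \<omega>) - s" unfolding sums by simp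
    qed simp
    ultimately show "max 0 (walk_max \<omega> + s) \<le> walk_max (case_nat s \<omega>)" by simp
  qed
qed

section \<open>Finiteness and stationarity of the walk maximum\<close>

context
  fixes \<mu> :: "real measure" and \<theta> :: real
  assumes \<mu>: "real_distribution \<mu>" and \<theta>: "0 < \<theta>"
    and int: "integrable \<mu> (\<lambda>x. exp (\<theta> * x))" and less: "(LINT x|\<mu>. exp (\<theta> * x)) < 1"
begin

interpretation \<mu>: real_distribution \<mu> by (fact \<mu>)
interpretation sequence_space \<mu> ..

text \<open>The law of an i.i.d. sequence is unchanged when an independent step is
  prepended.\<close>

lemma nn_integral_PiM_case_nat:
  assumes "f \<in> borel_measurable S"
  shows "(\<integral>\<^sup>+\<omega>. f \<omega> \<partial>S) = (\<integral>\<^sup>+s. (\<integral>\<^sup>+\<omega>. f (case_nat s \<omega>) \<partial>S) \<partial>\<mu>)"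
proof -
  have [measurable]: "(\<lambda>(s, \<omega>). case_nat s \<omega>) \<in> measurable (\<mu> \<Otimes>\<^sub>M S) S" by measurable
  note assms[measurable]
  have "(\<integral>\<^sup>+\<omega>. f \<omega> \<partial>S) = (\<integral>\<^sup>+\<omega>. f \<omega> \<partial>distr (\<mu> \<Otimes>\<^sub>M S) S (\<lambda>(s, \<omega>). case_nat s \<omega>))"
    unfolding PiM_iter ..
  also have "\<dots> = (\<integral>\<^sup>+p. f (case p of (s, \<omega>) \<Rightarrow> case_nat s \<omega>) \<partial>(\<mu> \<Otimes>\<^sub>M S))"
    by (rule nn_integral_distr) measurable
  also have "\<dots> = (\<integral>\<^sup>+s. (\<integral>\<^sup>+\<omega>. f (case_nat s \<omega>) \<partial>S) \<partial>\<mu>)"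
    by (subst nn_integral_fst[symmetric]) auto
  finally show ?thesis .
qed

lemma nn_integral_exp_walk:
  "(\<integral>\<^sup>+\<omega>. ennreal (exp (\<theta> * (\<Sum>i<k. \<omega> i))) \<partial>S) = ennreal ((LINT x|\<mu>. exp (\<theta> * x)) ^ k)"
proof (induction k)
  case 0
  show ?case by (simp add: emeasure_space_1)
next
  case (Suc k)
  let ?l = "LINT x|\<mu>. exp (\<theta> * x)"
  have l: "0 \<le> ?l" by (rule Bochner_Integration.integral_nonneg) simp
  have sums: "(\<Sum>i<Suc k. case_nat s \<omega> i) = s + (\<Sum>i<k. \<omega> i)" for s \<omega>
    by (subst sum.lessThan_Suc_shift) simp
  have "(\<integral>\<^sup>+\<omega>. ennreal (exp (\<theta> * (\<Sum>i<Suc k. \<omega> i))) \<partial>S)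
     = (\<integral>\<^sup>+s. (\<integral>\<^sup>+\<omega>. ennreal (exp (\<theta> * (\<Sum>i<Suc k. case_nat s \<omega> i))) \<partial>S) \<partial>\<mu>)"
    by (rule nn_integral_PiM_case_nat) measurable
  also have "\<dots> = (\<integral>\<^sup>+s. (\<integral>\<^sup>+\<omega>. ennreal (exp (\<theta> * s)) * ennreal (exp (\<theta> * (\<Sum>i<k. \<omega> i))) \<partial>S) \<partial>\<mu>)"
    by (simp only: sums distrib_left exp_add ennreal_mult'[OF exp_ge_zero])
  also have "\<dots> = (\<integral>\<^sup>+s. ennreal (exp (\<theta> * s)) * ennreal (?l ^ k) \<partial>\<mu>)"
    unfolding Suc.IH[symmetric] by (intro nn_integral_cong nn_integral_cmult) measurable
  also have "\<dots> = ennreal ?l * ennreal (?l ^ k)"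
    by (subst nn_integral_multc) (auto simp: nn_integral_eq_integral[OF int])
  finally show ?case using l by (simp add: ennreal_mult[symmetric])
qed

text \<open>The sum over k of exp(\<theta> S_k) has geometric mean values and hence finite
  expectation, so it is almost surely finite. It dominates each of its terms, and y \<le> exp y
  turns this into a bound on all S_k.\<close>

lemma AE_bdd_above_walk: "AE \<omega> in S. bdd_above (range (\<lambda>k. \<Sum>i<k. \<omega> i))"
proof -
  have term_le: "f k \<le> suminf f" for f :: "nat \<Rightarrow> ennreal" and k
    using sum_le_suminf[of f "{k}"] by simp
  let ?l = "LINT x|\<mu>. exp (\<theta> * x)"
  have l: "0 \<le> ?l" by (rule Bochner_Integration.integral_nonneg) simp
  have "(\<integral>\<^sup>+\<omega>. (\<Sum>k. ennreal (exp (\<theta> * (\<Sum>i<k. \<omega> i)))) \<partial>S) = (\<Sum>k. ennreal (?l ^ k))"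
    unfolding nn_integral_exp_walk[symmetric] by (rule nn_integral_suminf) measurable
  also have "\<dots> = ennreal (1 / (1 - ?l))"
    using l less by (intro suminf_ennreal_eq geometric_sums) auto
  finally have "(\<integral>\<^sup>+\<omega>. (\<Sum>k. ennreal (exp (\<theta> * (\<Sum>i<k. \<omega> i)))) \<partial>S) \<noteq> \<infinity>" by simp
  hence "AE \<omega> in S. (\<Sum>k. ennreal (exp (\<theta> * (\<Sum>i<k. \<omega> i)))) \<noteq> \<infinity>"
    by (intro nn_integral_PInf_AE) measurable
  thus ?thesis
  proof eventually_elim
    case (elim \<omega>)
    have "\<exists>c\<ge>0. y = ennreal c" if "y \<noteq> \<infinity>" for y :: ennreal
      using that by (cases y) auto
    from this[OF elim] obtain c where c: "(\<Sum>k. ennreal (exp (\<theta> * (\<Sum>i<k. \<omega> i)))) = ennreal c" "0 \<le> c"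
      by blast
    show ?case
    proof (rule bdd_aboveI2)
      fix k
      have "ennreal (exp (\<theta> * (\<Sum>i<k. \<omega> i))) \<le> (\<Sum>k. ennreal (exp (\<theta> * (\<Sum>i<k. \<omega> i))))"
        by (rule term_le)
      hence "exp (\<theta> * (\<Sum>i<k. \<omega> i)) \<le> c" unfolding c(1) using c(2) by simp
      moreover have "\<theta> * (\<Sum>i<k. \<omega> i) \<le> exp (\<theta> * (\<Sum>i<k. \<omega> i))"
        using exp_ge_add_one_self[of "\<theta> * (\<Sum>i<k. \<omega> i)"] by linarith
      ultimately show "(\<Sum>i<k. \<omega> i) \<le> c / \<theta>" using \<theta> by (simp add: field_simps)
    qed
  qed
qed

text \<open>Prepending a step preserves the law of the sequence and almost surely acts on
  \<open>walk_max\<close> as one step of the recursion.\<close>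

lemma lindley_stationary_walk_max: "lindley_stationary \<mu> (distr S borel walk_max)"
proof -
  have [measurable]: "walk_max \<in> borel_measurable S" by (rule walk_max_measurable) simp
  interpret W: real_distribution "distr S borel walk_max" by (rule real_distribution_distr) measurable
  interpret pair_sigma_finite "distr S borel walk_max" \<mu> ..
  interpret S\<mu>: pair_sigma_finite S \<mu> ..
  have "AE w in distr S borel walk_max. 0 \<le> w"
  proof (subst AE_distr_iff)
    show "AE \<omega> in S. 0 \<le> walk_max \<omega>" using AE_bdd_above_walk
    proof eventually_elim
      case (elim \<omega>)
      have "(\<Sum>i<0. \<omega> i) \<le> walk_max \<omega>" unfolding walk_max_def by (rule cSUP_upper[OF _ elim]) simp
      thus ?case by simp
    qed
  qed auto
  moreover have "distr (distr S borel walk_max \<Otimes>\<^sub>M \<mu>) borel (\<lambda>(w, x). max 0 (w + x)) = distr S borel walk_max"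
    (is "?D = ?L")
  proof (rule measure_eqI)
    fix A assume "A \<in> sets ?D"
    hence [measurable]: "A \<in> sets borel" by simp
    have [measurable]: "(\<lambda>(w, x). max 0 (w + x)) \<in> borel_measurable (?L \<Otimes>\<^sub>M \<mu>)" by measurable
    have "emeasure ?D A = (\<integral>\<^sup>+p. indicator A (case p of (w, x) \<Rightarrow> max 0 (w + x)) \<partial>(?L \<Otimes>\<^sub>M \<mu>))"
      by (subst nn_integral_indicator[symmetric], simp, subst nn_integral_distr) auto
    also have "\<dots> = (\<integral>\<^sup>+x. (\<integral>\<^sup>+w. indicator A (max 0 (w + x)) \<partial>?L) \<partial>\<mu>)"
      by (subst nn_integral_snd[symmetric]) auto
    also have "\<dots> = (\<integral>\<^sup>+x. (\<integral>\<^sup>+\<omega>. indicator A (max 0 (walk_max \<omega> + x)) \<partial>S) \<partial>\<mu>)"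
      by (subst nn_integral_distr) auto
    also have "\<dots> = (\<integral>\<^sup>+x. (\<integral>\<^sup>+\<omega>. indicator A (walk_max (case_nat x \<omega>)) \<partial>S) \<partial>\<mu>)"
      by (intro nn_integral_cong nn_integral_cong_AE)
         (use AE_bdd_above_walk in \<open>auto elim!: eventually_mono simp: walk_max_case_nat\<close>)
    also have "\<dots> = (\<integral>\<^sup>+\<omega>. indicator A (walk_max \<omega>) \<partial>S)"
      by (rule nn_integral_PiM_case_nat[symmetric]) measurable
    also have "\<dots> = emeasure ?L A"
      by (subst nn_integral_indicator[symmetric], simp, subst nn_integral_distr) auto
    finally show "emeasure ?D A = emeasure ?L A" .
  qed simp
  ultimately show ?thesis
    unfolding lindley_stationary_def using \<mu> W.real_distribution_axioms by blast
qed

end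

section \<open>The normal step law under exponential tilting\<close>

lemma real_distribution_normal: "real_distribution (density lborel (normal_density (- \<beta>) 1))"
  unfolding real_distribution_def real_distribution_axioms_def
  by (auto intro: prob_space_normal_density)

text \<open>Completing the square: the exponent \<beta> recentres the normal law with mean -\<beta>.
  This is the reason for taking \<theta> = \<beta>, and exp(-\<beta>^2/2) becomes the contraction
  factor of the Gaussian walk.\<close>

lemma normal_density_tilt: "normal_density (- \<beta>) 1 x * exp (\<beta> * x) = exp (- \<beta>\<^sup>2 / 2) * std_normal_density x"
  by (simp add: normal_density_def exp_add[symmetric] power2_eq_square field_simps)

lemma normal_tilted_moments:
  shows "integrable (density lborel (normal_density (- \<beta>) 1)) (\<lambda>x. exp (\<beta> * x))"
    and "(LINT x|density lborel (normal_density (- \<beta>) 1). exp (\<beta> * x)) = exp (- \<beta>\<^sup>2 / 2)"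
    and "cmgf (density lborel (normal_density (- \<beta>) 1)) (complex_of_real \<beta> + \<i> * complex_of_real t)
      = complex_of_real (exp (- (\<beta>\<^sup>2 + t\<^sup>2) / 2))"
proof -
  have "integrable lborel (\<lambda>x. exp (- \<beta>\<^sup>2 / 2) * std_normal_density x)"
    by (intro integrable_mult_right integrable_normal_density zero_less_one)
  thus "integrable (density lborel (normal_density (- \<beta>) 1)) (\<lambda>x. exp (\<beta> * x))"
    by (subst integrable_density) (auto simp: normal_density_tilt)
  show "(LINT x|density lborel (normal_density (- \<beta>) 1). exp (\<beta> * x)) = exp (- \<beta>\<^sup>2 / 2)"
    by (subst integral_density) (auto simp: normal_density_tilt)
  have "cmgf (density lborel (normal_density (- \<beta>) 1)) (complex_of_real \<beta> + \<i> * complex_of_real t)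
      = (LBINT x. normal_density (- \<beta>) 1 x *\<^sub>R exp ((complex_of_real \<beta> + \<i> * complex_of_real t) * complex_of_real x))"
    unfolding cmgf_def by (subst integral_density) auto
  also have "\<dots> = (LBINT x. complex_of_real (exp (- \<beta>\<^sup>2 / 2)) * (std_normal_density x *\<^sub>R iexp (t * x)))"
  proof (rule Bochner_Integration.integral_cong)
    fix x
    have "normal_density (- \<beta>) 1 x *\<^sub>R exp ((complex_of_real \<beta> + \<i> * complex_of_real t) * complex_of_real x)
      = complex_of_real (normal_density (- \<beta>) 1 x * exp (\<beta> * x)) * iexp (t * x)"
      by (simp add: scaleR_conv_of_real exp_of_real[symmetric] exp_add[symmetric] algebra_simps)
    thus "normal_density (- \<beta>) 1 x *\<^sub>R exp ((complex_of_real \<beta> + \<i> * complex_of_real t) * complex_of_real x)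
      = complex_of_real (exp (- \<beta>\<^sup>2 / 2)) * (std_normal_density x *\<^sub>R iexp (t * x))"
      unfolding normal_density_tilt by (simp add: scaleR_conv_of_real)
  qed simp
  also have "\<dots> = complex_of_real (exp (- \<beta>\<^sup>2 / 2)) * char std_normal_distribution t"
    unfolding integral_mult_right_zero char_def by (subst integral_density) auto
  also have "\<dots> = complex_of_real (exp (- (\<beta>\<^sup>2 + t\<^sup>2) / 2))"
    unfolding char_std_normal_distribution of_real_mult[symmetric] exp_add[symmetric]
    by (simp add: add_divide_distrib)
  finally show "cmgf (density lborel (normal_density (- \<beta>) 1)) (complex_of_real \<beta> + \<i> * complex_of_real t)
      = complex_of_real (exp (- (\<beta>\<^sup>2 + t\<^sup>2) / 2))" .
qed

section \<open>The increments of the queue\<close>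

lemma sample_mean_law_cmgf:
  fixes z :: complex
  assumes "prob_space M" "X \<in> borel_measurable M" and n: "1 \<le> n"
    and int: "integrable M (\<lambda>\<omega>. exp (z / of_nat n * complex_of_real (X \<omega>)))"
  shows "integrable (sample_mean_law M X n) (\<lambda>x. exp (z * complex_of_real x))"
    and "cmgf (sample_mean_law M X n) z = (LINT \<omega>|M. exp (z / of_nat n * complex_of_real (X \<omega>))) ^ n"
proof -
  interpret M: prob_space M by fact
  note [measurable] = assms(2)
  interpret D: prob_space "distr M borel X" by (rule M.prob_space_distr) measurable
  interpret product_sigma_finite "\<lambda>_::nat. distr M borel X" ..
  let ?f = "\<lambda>(k::nat) x. exp (z / of_nat n * complex_of_real x)"
  have eq: "exp (z * complex_of_real ((\<Sum>k = 1..n. x k) / real n)) = (\<Prod>k\<in>{1..n}. ?f k (x k))" for x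
    by (simp add: exp_sum[symmetric] sum_distrib_left sum_divide_distrib)
  have i: "integrable (distr M borel X) (?f k)" for k
    using int by (subst integrable_distr_eq) auto
  have m: "(\<lambda>x. (\<Sum>k = 1..n. x k) / real n) \<in> borel_measurable (\<Pi>\<^sub>M k\<in>{1..n}. distr M borel X)"
    by measurable
  show "integrable (sample_mean_law M X n) (\<lambda>x. exp (z * complex_of_real x))"
    unfolding sample_mean_law_def
    by (subst integrable_distr_eq[OF m]) (simp, unfold eq, rule product_integrable_prod[OF finite_atLeastAtMost i])
  have "cmgf (sample_mean_law M X n) z = (LINT x|(\<Pi>\<^sub>M k\<in>{1..n}. distr M borel X). (\<Prod>k\<in>{1..n}. ?f k (x k)))"
    unfolding cmgf_def sample_mean_law_def by (subst integral_distr[OF m]) (simp, unfold eq, rule refl)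
  also have "\<dots> = (\<Prod>k\<in>{1..n}. integral\<^sup>L (distr M borel X) (?f k))"
    by (rule product_integral_prod[OF finite_atLeastAtMost i])
  also have "\<dots> = (LINT \<omega>|M. exp (z / of_nat n * complex_of_real (X \<omega>))) ^ n"
    by (simp add: integral_distr)
  finally show "cmgf (sample_mean_law M X n) z = (LINT \<omega>|M. exp (z / of_nat n * complex_of_real (X \<omega>))) ^ n" .
qed

lemma real_distribution_sample_mean_law:
  assumes "prob_space M" "X \<in> borel_measurable M"
  shows "real_distribution (sample_mean_law M X n)"
proof -
  interpret M: prob_space M by fact
  note [measurable] = assms(2)
  interpret D: prob_space "distr M borel X" by (rule M.prob_space_distr) measurable
  interpret prob_space "\<Pi>\<^sub>M k\<in>{1..n}. distr M borel X" by (intro prob_space_PiM D.prob_space_axioms)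
  show ?thesis unfolding sample_mean_law_def by (rule real_distribution_distr) measurable
qed

text \<open>The scale \<open>c\<close> is built in so that this is the increment of the rescaled
  waiting time; it is later sqrt n / \<sigma>.\<close>

definition increment_law :: "real measure \<Rightarrow> real measure \<Rightarrow> real \<Rightarrow> real \<Rightarrow> real measure" where
  "increment_law A B r c = distr (A \<Otimes>\<^sub>M B) borel (\<lambda>(v, u). c * (v - 1 / r * u))"

lemma real_distribution_increment_law:
  assumes "real_distribution A" "real_distribution B"
  shows "real_distribution (increment_law A B r c)"
proof -
  interpret A: real_distribution A by fact
  interpret B: real_distribution B by fact
  interpret pair_prob_space A B ..
  show ?thesis unfolding increment_law_def by (rule real_distribution_distr) measurable
qed

lemma increment_law_cmgf:
  assumes "real_distribution A" "real_distribution B"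
    and A: "integrable A (\<lambda>v. exp (z * complex_of_real c * complex_of_real v))"
    and B: "integrable B (\<lambda>u. exp (- (z * complex_of_real c / complex_of_real r) * complex_of_real u))"
  shows "integrable (increment_law A B r c) (\<lambda>x. exp (z * complex_of_real x))"
    and "cmgf (increment_law A B r c) z
      = cmgf A (z * complex_of_real c) * cmgf B (- (z * complex_of_real c / complex_of_real r))"
proof -
  interpret A: real_distribution A by fact
  interpret B: real_distribution B by fact
  interpret pair_sigma_finite A B ..
  let ?f = "\<lambda>v. exp (z * complex_of_real c * complex_of_real v)"
  let ?g = "\<lambda>u. exp (- (z * complex_of_real c / complex_of_real r) * complex_of_real u)"
  have eq: "exp (z * complex_of_real (case p of (v, u) \<Rightarrow> c * (v - 1 / r * u))) = (case p of (v, u) \<Rightarrow> ?f v * ?g u)" for p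
    by (cases p) (simp add: exp_add[symmetric] algebra_simps)
  have m: "(\<lambda>(v, u). c * (v - 1 / r * u)) \<in> borel_measurable (A \<Otimes>\<^sub>M B)" by measurable
  have H: "integrable (A \<Otimes>\<^sub>M B) (\<lambda>(v, u). ?f v * ?g u)"
  proof (rule Fubini_integrable)
    show "integrable A (\<lambda>v. LINT u|B. norm (case (v, u) of (v, u) \<Rightarrow> ?f v * ?g u))"
      unfolding prod.case norm_mult integral_mult_right_zero
      by (intro integrable_mult_left integrable_norm A)
    show "AE v in A. integrable B (\<lambda>u. case (v, u) of (v, u) \<Rightarrow> ?f v * ?g u)"
      unfolding prod.case by (intro AE_I2 integrable_mult_right B)
  qed measurable
  show "integrable (increment_law A B r c) (\<lambda>x. exp (z * complex_of_real x))"
    unfolding increment_law_def by (subst integrable_distr_eq[OF m]) (simp, unfold eq, rule H)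
  have "cmgf (increment_law A B r c) z = (LINT p|(A \<Otimes>\<^sub>M B). (case p of (v, u) \<Rightarrow> ?f v * ?g u))"
    unfolding cmgf_def increment_law_def by (subst integral_distr[OF m]) (simp, unfold eq, rule refl)
  also have "\<dots> = (LINT v|A. LINT u|B. ?f v * ?g u)"
    using integral_fst[OF H] by simp
  also have "\<dots> = cmgf A (z * complex_of_real c) * cmgf B (- (z * complex_of_real c / complex_of_real r))"
    unfolding cmgf_def integral_mult_right_zero integral_mult_left_zero ..
  finally show "cmgf (increment_law A B r c) z
      = cmgf A (z * complex_of_real c) * cmgf B (- (z * complex_of_real c / complex_of_real r))" .
qed

text \<open>Multiplication by c > 0 commutes with the positive part, so scaling the stationary law
  and the increment together preserves the recursion.\<close>

lemma steady_state_lindley_stationary: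
  assumes "steady_state_waiting_time M V U r n Q W" and c: "0 < c"
    and rA: "real_distribution (sample_mean_law M V n)" and rB: "real_distribution (sample_mean_law M U n)"
  shows "lindley_stationary (increment_law (sample_mean_law M V n) (sample_mean_law M U n) r c)
    (distr Q borel (\<lambda>\<omega>. c * W \<omega>))"
proof -
  define A where "A = sample_mean_law M V n"
  define B where "B = sample_mean_law M U n"
  have W: "prob_space Q" "AE \<omega> in Q. 0 \<le> W \<omega>" "distr Q borel W = lindley_step A B r (distr Q borel W)"
    and [measurable]: "W \<in> borel_measurable Q"
    using assms(1) unfolding steady_state_waiting_time_def A_def B_def by auto
  interpret A: real_distribution A unfolding A_def by (rule rA)
  interpret B: real_distribution B unfolding B_def by (rule rB)
  interpret AB: pair_prob_space A B ..
  interpret Q: prob_space Q by fact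
  define L where "L = distr Q borel W"
  interpret L: real_distribution L unfolding L_def by (rule Q.real_distribution_distr) measurable
  interpret LAB: pair_sigma_finite L "A \<Otimes>\<^sub>M B" ..
  have scaled: "distr Q borel (\<lambda>\<omega>. c * W \<omega>) = distr L borel ((*) c)"
    unfolding L_def by (subst distr_distr) (auto simp: o_def)
  interpret R: real_distribution "distr Q borel (\<lambda>\<omega>. c * W \<omega>)" by (rule Q.real_distribution_distr) measurable
  have \<mu>: "real_distribution (increment_law A B r c)"
    by (intro real_distribution_increment_law A.real_distribution_axioms B.real_distribution_axioms)
  interpret \<mu>: real_distribution "increment_law A B r c" by (rule \<mu>)
  have [measurable]: "(\<lambda>(w, x :: real). max 0 (w + x)) \<in> borel_measurable (borel \<Otimes>\<^sub>M borel)"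
    by measurable
  have [measurable]: "(\<lambda>(v, u). c * (v - 1 / r * u)) \<in> borel_measurable (A \<Otimes>\<^sub>M B)" by measurable
  have [measurable]: "(\<lambda>(w, p). (c * w, case p of (v, u) \<Rightarrow> c * (v - 1 / r * u)))
      \<in> measurable (L \<Otimes>\<^sub>M (A \<Otimes>\<^sub>M B)) (borel \<Otimes>\<^sub>M borel)" by measurable
  have [measurable]: "(\<lambda>(w, v, u). max 0 (w + v - 1 / r * u)) \<in> borel_measurable (L \<Otimes>\<^sub>M (A \<Otimes>\<^sub>M B))"
    by measurable
  have "distr L borel ((*) c) \<Otimes>\<^sub>M increment_law A B r c
      = distr (L \<Otimes>\<^sub>M (A \<Otimes>\<^sub>M B)) (borel \<Otimes>\<^sub>M borel) (\<lambda>(w, p). (c * w, case p of (v, u) \<Rightarrow> c * (v - 1 / r * u)))"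
    unfolding increment_law_def
    by (rule pair_measure_distr) (simp, measurable, fold increment_law_def, rule \<mu>.sigma_finite_measure_axioms)
  hence "distr (distr L borel ((*) c) \<Otimes>\<^sub>M increment_law A B r c) borel (\<lambda>(w, x). max 0 (w + x))
      = distr (L \<Otimes>\<^sub>M (A \<Otimes>\<^sub>M B)) borel
          ((\<lambda>(w, x). max 0 (w + x)) \<circ> (\<lambda>(w, p). (c * w, case p of (v, u) \<Rightarrow> c * (v - 1 / r * u))))"
    by (simp only:) (rule distr_distr, measurable)
  also have "((\<lambda>(w, x). max 0 (w + x)) \<circ> (\<lambda>(w, p). (c * w, case p of (v, u) \<Rightarrow> c * (v - 1 / r * u))))
      = (*) c \<circ> (\<lambda>(w, v, u). max 0 (w + v - 1 / r * u))"
  proof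
    fix p :: "real \<times> real \<times> real"
    obtain w v u where p: "p = (w, v, u)" by (cases p) auto
    have "c * w + c * (v - 1 / r * u) = c * (w + v - 1 / r * u)" by (simp add: algebra_simps)
    thus "((\<lambda>(w, x). max 0 (w + x)) \<circ> (\<lambda>(w, p). (c * w, case p of (v, u) \<Rightarrow> c * (v - 1 / r * u)))) p
      = ((*) c \<circ> (\<lambda>(w, v, u). max 0 (w + v - 1 / r * u))) p"
      using c by (simp add: p max_mult_distrib_left)
  qed
  also have "distr (L \<Otimes>\<^sub>M (A \<Otimes>\<^sub>M B)) borel ((*) c \<circ> (\<lambda>(w, v, u). max 0 (w + v - 1 / r * u)))
      = distr (lindley_step A B r L) borel ((*) c)"
    unfolding lindley_step_def by (rule distr_distr[symmetric]) measurable
  also have "lindley_step A B r L = L" using W(3) unfolding L_def[symmetric] by simp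
  finally have "distr (distr L borel ((*) c) \<Otimes>\<^sub>M increment_law A B r c) borel (\<lambda>(w, x). max 0 (w + x))
      = distr L borel ((*) c)" .
  moreover have "AE w in distr Q borel (\<lambda>\<omega>. c * W \<omega>). 0 \<le> w"
    by (subst AE_distr_iff) (use W(2) c in auto)
  ultimately show ?thesis
    unfolding lindley_stationary_def A_def[symmetric] B_def[symmetric] scaled
    using \<mu> R.real_distribution_axioms scaled by simp
qed

lemma psi_eq_mult:
  assumes "prob_space M" and ind: "prob_space.indep_var M borel V borel U"
    and "integrable M (\<lambda>\<omega>. exp (s * complex_of_real (V \<omega>)))"
    and "integrable M (\<lambda>\<omega>. exp (- (s / complex_of_real r) * complex_of_real (U \<omega>)))"
  shows "psi M V U r s = (LINT \<omega>|M. exp (s * complex_of_real (V \<omega>)))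
    * (LINT \<omega>|M. exp (- (s / complex_of_real r) * complex_of_real (U \<omega>)))"
proof -
  interpret prob_space M by fact
  have "indep_var borel ((\<lambda>x. exp (s * complex_of_real x)) \<circ> V) borel ((\<lambda>x. exp (- (s / complex_of_real r) * complex_of_real x)) \<circ> U)"
    by (rule indep_var_compose[OF ind]) measurable
  hence "(LINT \<omega>|M. exp (s * complex_of_real (V \<omega>)) * exp (- (s / complex_of_real r) * complex_of_real (U \<omega>)))
     = (LINT \<omega>|M. exp (s * complex_of_real (V \<omega>))) * (LINT \<omega>|M. exp (- (s / complex_of_real r) * complex_of_real (U \<omega>)))"
    using assms(3,4) by (intro indep_var_lebesgue_integral) (simp_all add: o_def)
  thus ?thesis unfolding psi_def by (simp add: exp_add[symmetric] algebra_simps)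
qed

text \<open>Averaging n independent copies turns the transform into an n-th power at an argument
  divided by n. The argument \<open>s\<close> enters through an equation so that it can be
  instantiated with the tilted point x + i u.\<close>

lemma increment_law_sample_mean_cmgf:
  assumes M: "prob_space M" and ind: "prob_space.indep_var M borel V borel U"
    and n: "1 \<le> n" and s: "s = z * complex_of_real c / of_nat n"
    and V: "integrable M (\<lambda>\<omega>. exp (s * complex_of_real (V \<omega>)))"
    and U: "integrable M (\<lambda>\<omega>. exp (- (s / complex_of_real r) * complex_of_real (U \<omega>)))"
  shows "integrable (increment_law (sample_mean_law M V n) (sample_mean_law M U n) r c) (\<lambda>x. exp (z * complex_of_real x))"
    and "cmgf (increment_law (sample_mean_law M V n) (sample_mean_law M U n) r c) z = psi M V U r s ^ n"
proof -
  interpret prob_space M by fact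
  have meas: "V \<in> borel_measurable M" "U \<in> borel_measurable M"
    using indep_var_rv1[OF ind] indep_var_rv2[OF ind] by auto
  have V': "integrable M (\<lambda>\<omega>. exp (z * complex_of_real c / of_nat n * complex_of_real (V \<omega>)))"
    using V unfolding s .
  have s': "- (z * complex_of_real c / complex_of_real r) / of_nat n = - (s / complex_of_real r)"
    unfolding s by simp
  have U': "integrable M (\<lambda>\<omega>. exp (- (z * complex_of_real c / complex_of_real r) / of_nat n * complex_of_real (U \<omega>)))"
    using U unfolding s' .
  note A = sample_mean_law_cmgf[OF M meas(1) n V']
  note B = sample_mean_law_cmgf[OF M meas(2) n U']
  note I = increment_law_cmgf[OF real_distribution_sample_mean_law[OF M meas(1), of n]
      real_distribution_sample_mean_law[OF M meas(2), of n] A(1) B(1)]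
  show "integrable (increment_law (sample_mean_law M V n) (sample_mean_law M U n) r c) (\<lambda>x. exp (z * complex_of_real x))"
    by (rule I(1))
  show "cmgf (increment_law (sample_mean_law M V n) (sample_mean_law M U n) r c) z = psi M V U r s ^ n"
    unfolding I(2) A(2) B(2) psi_eq_mult[OF M ind V U] s' power_mult_distrib by (simp add: s)
qed

section \<open>Exponentially tilted moments\<close>

lemma power_le_fact_exp:
  assumes "0 \<le> (y::real)"
  shows "y ^ k \<le> fact k * exp y"
proof -
  have "(\<Sum>j\<in>{k}. y ^ j /\<^sub>R fact j) \<le> (\<Sum>j. y ^ j /\<^sub>R fact j)"
    using assms by (intro sum_le_suminf summable_exp_generic) auto
  thus ?thesis by (simp add: exp_def field_simps)
qed

text \<open>\<delta> and \<open>B\<close> are parameters rather than quantities extracted from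
  \<open>Y\<close>. The variable changes with n, but constants expressed through \<delta> and
  \<open>B\<close> are then the same for all n.\<close>

locale exp_moment = prob_space M for M :: "'a measure" +
  fixes Y :: "'a \<Rightarrow> real" and \<delta> B :: real
  assumes rv [measurable]: "Y \<in> borel_measurable M"
    and \<delta>_pos: "0 < \<delta>"
    and int_exp_abs: "integrable M (\<lambda>\<omega>. exp (\<delta> * \<bar>Y \<omega>\<bar>))"
    and exp_abs_le: "expectation (\<lambda>\<omega>. exp (\<delta> * \<bar>Y \<omega>\<bar>)) \<le> B"
begin

text \<open>The k-th derivative of the real moment generating function. Zeros of
  \<open>moment 1\<close> are the saddle points with reversed sign.\<close>

definition moment :: "nat \<Rightarrow> real \<Rightarrow> real" where
  "moment k x = expectation (\<lambda>\<omega>. Y \<omega> ^ k * exp (x * Y \<omega>))"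

text \<open>Half of \<delta> pays for the power, by y^k \<le> k! exp y at \<delta>|y|/2, and the
  other half pays for a tilt by at most \<delta>/2.\<close>

definition bnd :: "nat \<Rightarrow> real" where
  "bnd k = fact k * (2 / \<delta>) ^ k * B"

lemma power_exp_le:
  assumes "\<bar>x\<bar> \<le> \<delta> / 2"
  shows "\<bar>y\<bar> ^ k * exp (\<bar>x\<bar> * \<bar>y\<bar>) \<le> fact k * (2 / \<delta>) ^ k * exp (\<delta> * \<bar>y\<bar>)"
proof -
  have "(\<delta> / 2 * \<bar>y\<bar>) ^ k \<le> fact k * exp (\<delta> / 2 * \<bar>y\<bar>)"
    using \<delta>_pos by (intro power_le_fact_exp) auto
  hence "(2 / \<delta>) ^ k * (\<delta> / 2 * \<bar>y\<bar>) ^ k \<le> (2 / \<delta>) ^ k * (fact k * exp (\<delta> / 2 * \<bar>y\<bar>))"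
    using \<delta>_pos by (intro mult_left_mono) auto
  hence 1: "\<bar>y\<bar> ^ k \<le> fact k * (2 / \<delta>) ^ k * exp (\<delta> / 2 * \<bar>y\<bar>)"
    using \<delta>_pos by (simp add: power_mult_distrib[symmetric] mult_ac)
  have 2: "exp (\<bar>x\<bar> * \<bar>y\<bar>) \<le> exp (\<delta> / 2 * \<bar>y\<bar>)"
    using assms mult_right_mono[of "\<bar>x\<bar>" "\<delta> / 2" "\<bar>y\<bar>"] by simp
  have "\<bar>y\<bar> ^ k * exp (\<bar>x\<bar> * \<bar>y\<bar>) \<le> (fact k * (2 / \<delta>) ^ k * exp (\<delta> / 2 * \<bar>y\<bar>)) * exp (\<delta> / 2 * \<bar>y\<bar>)"
    using 1 2 \<delta>_pos by (intro mult_mono) auto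
  also have "\<dots> = fact k * (2 / \<delta>) ^ k * exp (\<delta> * \<bar>y\<bar>)"
    by (simp add: exp_add[symmetric] algebra_simps)
  finally show ?thesis .
qed

lemma integrable_power_exp_abs:
  assumes "\<bar>x\<bar> \<le> \<delta> / 2"
  shows "integrable M (\<lambda>\<omega>. \<bar>Y \<omega>\<bar> ^ k * exp (\<bar>x\<bar> * \<bar>Y \<omega>\<bar>))"
    and "expectation (\<lambda>\<omega>. \<bar>Y \<omega>\<bar> ^ k * exp (\<bar>x\<bar> * \<bar>Y \<omega>\<bar>)) \<le> bnd k"
proof -
  have i: "integrable M (\<lambda>\<omega>. fact k * (2 / \<delta>) ^ k * exp (\<delta> * \<bar>Y \<omega>\<bar>))"
    by (intro integrable_mult_right int_exp_abs)
  show 1: "integrable M (\<lambda>\<omega>. \<bar>Y \<omega>\<bar> ^ k * exp (\<bar>x\<bar> * \<bar>Y \<omega>\<bar>))"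
  proof (rule Bochner_Integration.integrable_bound[OF i])
    show "AE \<omega> in M. norm (\<bar>Y \<omega>\<bar> ^ k * exp (\<bar>x\<bar> * \<bar>Y \<omega>\<bar>)) \<le> norm (fact k * (2 / \<delta>) ^ k * exp (\<delta> * \<bar>Y \<omega>\<bar>))"
      using power_exp_le[OF assms] \<delta>_pos by (intro AE_I2) (simp add: abs_mult power_abs)
  qed measurable
  have "expectation (\<lambda>\<omega>. \<bar>Y \<omega>\<bar> ^ k * exp (\<bar>x\<bar> * \<bar>Y \<omega>\<bar>)) \<le> fact k * (2 / \<delta>) ^ k * expectation (\<lambda>\<omega>. exp (\<delta> * \<bar>Y \<omega>\<bar>))"
    unfolding integral_mult_right_zero[symmetric] by (intro integral_mono 1 i power_exp_le assms)
  also have "\<dots> \<le> bnd k"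
    unfolding bnd_def using \<delta>_pos exp_abs_le by (intro mult_left_mono) auto
  finally show "expectation (\<lambda>\<omega>. \<bar>Y \<omega>\<bar> ^ k * exp (\<bar>x\<bar> * \<bar>Y \<omega>\<bar>)) \<le> bnd k" .
qed

lemma integrable_power_exp:
  assumes "\<bar>x\<bar> \<le> \<delta> / 2"
  shows "integrable M (\<lambda>\<omega>. Y \<omega> ^ k * exp (x * Y \<omega>))"
proof (rule Bochner_Integration.integrable_bound[OF integrable_power_exp_abs(1)[OF assms, of k]])
  have "x * y \<le> \<bar>x\<bar> * \<bar>y\<bar>" for y :: real by (metis abs_ge_self abs_mult)
  thus "AE \<omega> in M. norm (Y \<omega> ^ k * exp (x * Y \<omega>)) \<le> norm (\<bar>Y \<omega>\<bar> ^ k * exp (\<bar>x\<bar> * \<bar>Y \<omega>\<bar>))"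
    by (intro AE_I2) (auto simp: abs_mult power_abs intro!: mult_left_mono)
qed measurable

lemma abs_moment_le:
  assumes "\<bar>x\<bar> \<le> \<delta> / 2"
  shows "\<bar>moment k x\<bar> \<le> bnd k"
proof -
  have le: "x * y \<le> \<bar>x\<bar> * \<bar>y\<bar>" for y :: real by (metis abs_ge_self abs_mult)
  have "\<bar>moment k x\<bar> \<le> expectation (\<lambda>\<omega>. \<bar>Y \<omega> ^ k * exp (x * Y \<omega>)\<bar>)"
    unfolding moment_def by (rule integral_abs_bound)
  also have "\<dots> \<le> expectation (\<lambda>\<omega>. \<bar>Y \<omega>\<bar> ^ k * exp (\<bar>x\<bar> * \<bar>Y \<omega>\<bar>))"
    using le by (intro integral_mono integrable_power_exp_abs integrable_abs integrable_power_exp assms)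
      (auto simp: abs_mult power_abs intro!: mult_left_mono)
  also have "\<dots> \<le> bnd k" by (rule integrable_power_exp_abs(2)[OF assms])
  finally show ?thesis .
qed

lemma moment_pos:
  assumes "\<bar>x\<bar> \<le> \<delta> / 2"
  shows "0 < moment 0 x"
proof -
  have "integrable M (\<lambda>\<omega>. exp (x * Y \<omega>))" using integrable_power_exp[OF assms, of 0] by simp
  thus ?thesis unfolding moment_def
    by (auto intro!: expectation_less simp: expectation_greater)
qed

lemma moment_0_0: "moment 0 0 = 1"
  unfolding moment_def using prob_space by simp

lemma bnd_ge_0: "0 \<le> bnd k"
  using abs_moment_le[of 0 k] \<delta>_pos by simp

text \<open>A quantitative differentiation under the integral sign, from |exp(h y) - 1 - h y| \<le>
  exp|h y| (h y)^2. The remainder is tilted by |x| + |h|, which therefore has to stay below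
  \<delta>/2.\<close>

lemma moment_quadratic:
  assumes "\<bar>x\<bar> + \<bar>h\<bar> \<le> \<delta> / 2"
  shows "\<bar>moment k (x + h) - moment k x - h * moment (Suc k) x\<bar> \<le> h\<^sup>2 * bnd (k + 2)"
proof -
  \<comment> \<open>The nested absolute value presents the tilt |x| + |h| in the form in which
    \<open>integrable_power_exp_abs\<close> takes its parameter.\<close>
  have x: "\<bar>x\<bar> \<le> \<delta> / 2" "\<bar>x + h\<bar> \<le> \<delta> / 2" "\<bar>\<bar>x\<bar> + \<bar>h\<bar>\<bar> \<le> \<delta> / 2" using assms by linarith+
  have pt: "\<bar>y ^ k * exp ((x + h) * y) - y ^ k * exp (x * y) - h * (y ^ Suc k * exp (x * y))\<bar>
      \<le> h\<^sup>2 * (\<bar>y\<bar> ^ (k + 2) * exp (\<bar>\<bar>x\<bar> + \<bar>h\<bar>\<bar> * \<bar>y\<bar>))" for y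
  proof -
    have "\<bar>exp (h * y) - (1 + h * y)\<bar> \<le> exp \<bar>h * y\<bar> * \<bar>h * y\<bar>\<^sup>2"
      using Taylor_exp_field[of "h * y" 1] by (simp add: numeral_2_eq_2)
    hence "\<bar>y\<bar> ^ k * exp (x * y) * \<bar>exp (h * y) - (1 + h * y)\<bar> \<le> \<bar>y\<bar> ^ k * exp (\<bar>x\<bar> * \<bar>y\<bar>) * (exp \<bar>h * y\<bar> * \<bar>h * y\<bar>\<^sup>2)"
      by (intro mult_mono) (auto, metis abs_ge_self abs_mult)
    also have "\<dots> = h\<^sup>2 * (\<bar>y\<bar> ^ (k + 2) * exp (\<bar>\<bar>x\<bar> + \<bar>h\<bar>\<bar> * \<bar>y\<bar>))"
      by (simp add: abs_mult power2_eq_square power_add exp_add[symmetric] algebra_simps)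
    finally have le: "\<bar>y\<bar> ^ k * exp (x * y) * \<bar>exp (h * y) - (1 + h * y)\<bar> \<le> \<dots>" .
    have eq: "y ^ k * exp ((x + h) * y) - y ^ k * exp (x * y) - h * (y ^ Suc k * exp (x * y))
        = y ^ k * exp (x * y) * (exp (h * y) - (1 + h * y))"
      by (simp add: exp_add algebra_simps)
    show ?thesis
      unfolding eq abs_mult power_abs abs_exp_cancel by (rule le)
  qed
  have i3: "integrable M (\<lambda>\<omega>. h * (Y \<omega> ^ Suc k * exp (x * Y \<omega>)))"
    by (intro integrable_mult_right integrable_power_exp x)
  note i = integrable_power_exp[OF x(2), of k] integrable_power_exp[OF x(1), of k] i3
  have eq: "moment k (x + h) - moment k x - h * moment (Suc k) x
     = expectation (\<lambda>\<omega>. Y \<omega> ^ k * exp ((x + h) * Y \<omega>) - Y \<omega> ^ k * exp (x * Y \<omega>) - h * (Y \<omega> ^ Suc k * exp (x * Y \<omega>)))"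
    unfolding moment_def integral_mult_right_zero[symmetric]
    by (simp only: Bochner_Integration.integral_diff[OF Bochner_Integration.integrable_diff[OF i(1,2)] i(3)] Bochner_Integration.integral_diff[OF i(1,2)])
  have "\<bar>moment k (x + h) - moment k x - h * moment (Suc k) x\<bar> \<le> expectation (\<lambda>\<omega>. \<bar>Y \<omega> ^ k * exp ((x + h) * Y \<omega>) - Y \<omega> ^ k * exp (x * Y \<omega>) - h * (Y \<omega> ^ Suc k * exp (x * Y \<omega>))\<bar>)"
    unfolding eq by (rule integral_abs_bound)
  also have "\<dots> \<le> expectation (\<lambda>\<omega>. h\<^sup>2 * (\<bar>Y \<omega>\<bar> ^ (k + 2) * exp (\<bar>\<bar>x\<bar> + \<bar>h\<bar>\<bar> * \<bar>Y \<omega>\<bar>)))"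
    by (rule integral_mono, intro integrable_abs Bochner_Integration.integrable_diff i, intro integrable_mult_right integrable_power_exp_abs(1) x(3), rule pt)
  also have "\<dots> \<le> h\<^sup>2 * bnd (k + 2)"
    unfolding integral_mult_right_zero by (intro mult_left_mono integrable_power_exp_abs(2) x(3)) simp
  finally show ?thesis .
qed

lemma moment_has_derivative:
  assumes "\<bar>x\<bar> < \<delta> / 2"
  shows "(moment k has_real_derivative moment (Suc k) x) (at x)"
  unfolding DERIV_def
proof (rule LIM_zero_cancel, rule Lim_null_comparison)
  show "((\<lambda>h. \<bar>h\<bar> * bnd (k + 2)) \<longlongrightarrow> 0) (at 0)" by (auto intro!: tendsto_eq_intros)
  have "\<forall>\<^sub>F h in at 0. \<bar>h\<bar> < \<delta> / 2 - \<bar>x\<bar> \<and> h \<noteq> 0"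
    using assms by (auto simp: eventually_at intro!: exI[of _ "\<delta> / 2 - \<bar>x\<bar>"])
  thus "\<forall>\<^sub>F h in at 0. norm ((moment k (x + h) - moment k x) / h - moment (Suc k) x) \<le> \<bar>h\<bar> * bnd (k + 2)"
  proof eventually_elim
    case (elim h)
    have "norm ((moment k (x + h) - moment k x) / h - moment (Suc k) x) = \<bar>moment k (x + h) - moment k x - h * moment (Suc k) x\<bar> / \<bar>h\<bar>"
      using elim by (simp add: abs_divide[symmetric] diff_divide_distrib)
    also have "\<dots> \<le> h\<^sup>2 * bnd (k + 2) / \<bar>h\<bar>"
      using elim by (intro divide_right_mono moment_quadratic) auto
    also have "\<dots> = \<bar>h\<bar> * bnd (k + 2)"
      using elim by (simp add: power2_eq_square abs_if)
    finally show ?case .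
  qed
qed

lemma moment_lipschitz:
  assumes "\<bar>x\<bar> < \<delta> / 2" "\<bar>y\<bar> < \<delta> / 2"
  shows "\<bar>moment k x - moment k y\<bar> \<le> bnd (Suc k) * \<bar>x - y\<bar>"
proof -
  have "norm (moment k x - moment k y) \<le> bnd (Suc k) * norm (x - y)"
  proof (rule field_differentiable_bound[of "{- \<delta> / 2<..<\<delta> / 2}"])
    fix z assume "z \<in> {- \<delta> / 2<..<\<delta> / 2}"
    hence z: "\<bar>z\<bar> < \<delta> / 2" by auto
    show "(moment k has_field_derivative moment (Suc k) z) (at z within {- \<delta> / 2<..<\<delta> / 2})"
      by (rule has_field_derivative_at_within[OF moment_has_derivative[OF z]])
    show "norm (moment (Suc k) z) \<le> bnd (Suc k)" using abs_moment_le[of z "Suc k"] z by simp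
  qed (use assms in auto)
  thus ?thesis by simp
qed

lemma norm_expectation_exp_le:
  "cmod (LINT \<omega>|M. exp ((complex_of_real x + \<i> * complex_of_real u) * complex_of_real (Y \<omega>))) \<le> moment 0 x"
  unfolding moment_def by (rule order_trans[OF integral_norm_bound]) simp

text \<open>At a zero of the first moment function the first-order term of the expansion in \<open>u\<close> is absent.\<close>

lemma expectation_exp_quadratic:
  assumes x: "\<bar>x\<bar> \<le> \<delta> / 2" and crit: "moment 1 x = 0"
  shows "cmod ((LINT \<omega>|M. exp ((complex_of_real x + \<i> * complex_of_real u) * complex_of_real (Y \<omega>)))
      - complex_of_real (moment 0 x - u\<^sup>2 / 2 * moment 2 x)) \<le> \<bar>u\<bar> ^ 3 * bnd 3"
proof -
  define z where "z = (\<lambda>\<omega>. \<i> * complex_of_real (u * Y \<omega>))"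
  let ?e = "\<lambda>\<omega>. exp ((complex_of_real x + \<i> * complex_of_real u) * complex_of_real (Y \<omega>))"
  let ?m = "\<lambda>k \<omega>. Y \<omega> ^ k * exp (x * Y \<omega>)"
  let ?q = "\<lambda>\<omega>. complex_of_real (?m 0 \<omega>) + \<i> * complex_of_real u * complex_of_real (?m 1 \<omega>)
      - complex_of_real (u\<^sup>2 / 2) * complex_of_real (?m 2 \<omega>)"
  have i: "integrable M (\<lambda>\<omega>. complex_of_real (?m k \<omega>))" for k
    by (intro integrable_of_real integrable_power_exp x)
  have ie: "integrable M ?e"
    by (rule Bochner_Integration.integrable_bound[OF i[of 0]]) auto
  have ic: "integrable M (\<lambda>\<omega>. c * complex_of_real (?m k \<omega>))" for k c
    by (rule integrable_mult_right) (use i in auto)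
  have iq: "integrable M ?q"
    by (rule Bochner_Integration.integrable_diff[OF Bochner_Integration.integrable_add[OF i ic] ic])
  have mk: "(LINT \<omega>|M. complex_of_real (?m k \<omega>)) = complex_of_real (moment k x)" for k
    unfolding moment_def by (rule integral_complex_of_real)
  have "(LINT \<omega>|M. ?q \<omega>) = complex_of_real (moment 0 x) + \<i> * complex_of_real u * complex_of_real (moment 1 x) - complex_of_real (u\<^sup>2 / 2) * complex_of_real (moment 2 x)"
    unfolding Bochner_Integration.integral_diff[OF Bochner_Integration.integrable_add[OF i ic] ic]
      Bochner_Integration.integral_add[OF i ic] integral_mult_right_zero mk ..
  hence q: "(LINT \<omega>|M. ?q \<omega>) = complex_of_real (moment 0 x - u\<^sup>2 / 2 * moment 2 x)"
    unfolding crit by simp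
  have pt: "cmod (?e \<omega> - ?q \<omega>) \<le> \<bar>u\<bar> ^ 3 * (\<bar>Y \<omega>\<bar> ^ 3 * exp (\<bar>x\<bar> * \<bar>Y \<omega>\<bar>))" for \<omega>
  proof -
    \<comment> \<open>\<open>z \<omega>\<close> is purely imaginary, so the factor exp|Re z| in the
      Taylor remainder is 1.\<close>
    have "cmod (exp (z \<omega>) - (1 + z \<omega> + (z \<omega>)\<^sup>2 / 2)) \<le> cmod (z \<omega>) ^ 3 / 2"
      using Taylor_exp[of "z \<omega>" 2] by (simp add: numeral_2_eq_2 numeral_3_eq_3 z_def)
    also have "\<dots> \<le> cmod (z \<omega>) ^ 3" by simp
    also have "cmod (z \<omega>) ^ 3 = \<bar>u\<bar> ^ 3 * \<bar>Y \<omega>\<bar> ^ 3"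
      by (simp add: z_def norm_mult abs_mult power_mult_distrib)
    finally have 1: "cmod (exp (z \<omega>) - (1 + z \<omega> + (z \<omega>)\<^sup>2 / 2)) \<le> \<bar>u\<bar> ^ 3 * \<bar>Y \<omega>\<bar> ^ 3" .
    have "?e \<omega> - ?q \<omega> = complex_of_real (exp (x * Y \<omega>)) * (exp (z \<omega>) - (1 + z \<omega> + (z \<omega>)\<^sup>2 / 2))"
      by (simp add: z_def exp_of_real[symmetric] exp_add algebra_simps power2_eq_square)
    hence "cmod (?e \<omega> - ?q \<omega>) = exp (x * Y \<omega>) * cmod (exp (z \<omega>) - (1 + z \<omega> + (z \<omega>)\<^sup>2 / 2))"
      by (simp only: norm_mult norm_of_real abs_exp_cancel)
    also have "\<dots> \<le> exp (\<bar>x\<bar> * \<bar>Y \<omega>\<bar>) * (\<bar>u\<bar> ^ 3 * \<bar>Y \<omega>\<bar> ^ 3)"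
      by (intro mult_mono 1) (auto, metis abs_ge_self abs_mult)
    finally show ?thesis by (simp add: mult_ac)
  qed
  have eq: "(LINT \<omega>|M. ?e \<omega>) - complex_of_real (moment 0 x - u\<^sup>2 / 2 * moment 2 x) = (LINT \<omega>|M. ?e \<omega> - ?q \<omega>)"
    unfolding q[symmetric] by (rule Bochner_Integration.integral_diff[OF ie iq, symmetric])
  have "cmod ((LINT \<omega>|M. ?e \<omega>) - complex_of_real (moment 0 x - u\<^sup>2 / 2 * moment 2 x)) \<le> (LINT \<omega>|M. cmod (?e \<omega> - ?q \<omega>))"
    unfolding eq by (rule integral_norm_bound)
  also have "\<dots> \<le> (LINT \<omega>|M. \<bar>u\<bar> ^ 3 * (\<bar>Y \<omega>\<bar> ^ 3 * exp (\<bar>x\<bar> * \<bar>Y \<omega>\<bar>)))"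
    by (rule integral_mono, intro integrable_norm Bochner_Integration.integrable_diff ie iq, intro integrable_mult_right integrable_power_exp_abs(1) x, rule pt)
  also have "\<dots> \<le> \<bar>u\<bar> ^ 3 * bnd 3"
    unfolding integral_mult_right_zero by (intro mult_left_mono integrable_power_exp_abs(2) x) simp
  finally show ?thesis .
qed

text \<open>The value 1 at tilt 0 is expanded about the critical point x, not the other way round,
  because the first-order term vanishes there. The remainder carries both exp(x Y) and exp|x Y|,
  hence the tilt 2x and the restriction to \<delta>/4.\<close>

lemma moment_cubic:
  assumes x: "0 \<le> x" "x \<le> \<delta> / 4" and crit: "moment 1 x = 0"
  shows "\<bar>1 - moment 0 x - x\<^sup>2 / 2 * moment 2 x\<bar> \<le> x ^ 3 * bnd 3"
proof -
  have x': "\<bar>x\<bar> \<le> \<delta> / 2" "\<bar>2 * x\<bar> \<le> \<delta> / 2" using x by auto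
  let ?m = "\<lambda>k \<omega>. Y \<omega> ^ k * exp (x * Y \<omega>)"
  let ?q = "\<lambda>\<omega>. ?m 0 \<omega> - x * ?m 1 \<omega> + x\<^sup>2 / 2 * ?m 2 \<omega>"
  have i: "integrable M (?m k)" for k by (intro integrable_power_exp x')
  have ic: "integrable M (\<lambda>\<omega>. c * ?m k \<omega>)" for k c by (rule integrable_mult_right) (use i in auto)
  have iq: "integrable M ?q"
    by (rule Bochner_Integration.integrable_add[OF Bochner_Integration.integrable_diff[OF i ic] ic])
  have "expectation ?q = moment 0 x - x * moment 1 x + x\<^sup>2 / 2 * moment 2 x"
    unfolding Bochner_Integration.integral_add[OF Bochner_Integration.integrable_diff[OF i ic] ic]
      Bochner_Integration.integral_diff[OF i ic] integral_mult_right_zero moment_def ..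
  hence q: "expectation ?q = moment 0 x + x\<^sup>2 / 2 * moment 2 x" unfolding crit by simp
  have pt: "\<bar>1 - ?q \<omega>\<bar> \<le> x ^ 3 * (\<bar>Y \<omega>\<bar> ^ 3 * exp (\<bar>2 * x\<bar> * \<bar>Y \<omega>\<bar>))" for \<omega>
  proof -
    let ?w = "- (x * Y \<omega>)"
    have "\<bar>exp ?w - (1 + ?w + ?w\<^sup>2 / 2)\<bar> \<le> exp \<bar>?w\<bar> * \<bar>?w\<bar> ^ 3 / 2"
      using Taylor_exp_field[of ?w 2] by (simp add: numeral_2_eq_2 numeral_3_eq_3)
    also have "\<dots> \<le> exp \<bar>?w\<bar> * \<bar>?w\<bar> ^ 3" by simp
    finally have 1: "\<bar>exp ?w - (1 + ?w + ?w\<^sup>2 / 2)\<bar> \<le> exp \<bar>?w\<bar> * \<bar>?w\<bar> ^ 3" .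
    have "1 - ?q \<omega> = exp (x * Y \<omega>) * (exp ?w - (1 + ?w + ?w\<^sup>2 / 2))"
      by (simp add: exp_minus algebra_simps power2_eq_square)
    hence "\<bar>1 - ?q \<omega>\<bar> = exp (x * Y \<omega>) * \<bar>exp ?w - (1 + ?w + ?w\<^sup>2 / 2)\<bar>"
      by (simp only: abs_mult abs_exp_cancel)
    also have "\<dots> \<le> exp \<bar>?w\<bar> * (exp \<bar>?w\<bar> * \<bar>?w\<bar> ^ 3)"
      by (intro mult_mono 1) auto
    also have "\<dots> = x ^ 3 * (\<bar>Y \<omega>\<bar> ^ 3 * exp (\<bar>2 * x\<bar> * \<bar>Y \<omega>\<bar>))"
      using x by (simp add: abs_mult power_mult_distrib exp_add[symmetric])
    finally show ?thesis .
  qed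
  have eq: "1 - moment 0 x - x\<^sup>2 / 2 * moment 2 x = expectation (\<lambda>\<omega>. 1 - ?q \<omega>)"
    by (subst Bochner_Integration.integral_diff[OF integrable_const iq]) (simp only: q, simp add: prob_space)
  have "\<bar>1 - moment 0 x - x\<^sup>2 / 2 * moment 2 x\<bar> \<le> expectation (\<lambda>\<omega>. \<bar>1 - ?q \<omega>\<bar>)" unfolding eq by (rule integral_abs_bound)
  also have "\<dots> \<le> expectation (\<lambda>\<omega>. x ^ 3 * (\<bar>Y \<omega>\<bar> ^ 3 * exp (\<bar>2 * x\<bar> * \<bar>Y \<omega>\<bar>)))"
    by (rule integral_mono, intro integrable_abs Bochner_Integration.integrable_diff integrable_const iq, intro integrable_mult_right integrable_power_exp_abs(1) x', rule pt)
  also have "\<dots> \<le> x ^ 3 * bnd 3"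
    unfolding integral_mult_right_zero using x by (intro mult_left_mono integrable_power_exp_abs(2) x') simp
  finally show ?thesis .
qed

end

section \<open>The saddle point and the tilted characteristic function\<close>

text \<open>Division by \<open>E\<close> reduces this to the unit disc. The factor
  \<open>E ^ (n - 1)\<close> is kept because it later supplies the Gaussian decay that absorbs the
  cubic growth of the error in t.\<close>

lemma norm_power_diff_scaled:
  fixes z w :: complex
  assumes "cmod z \<le> E" "cmod w \<le> E" "0 < E" "1 \<le> n"
  shows "cmod (z ^ n - w ^ n) \<le> real n * cmod (z - w) * E ^ (n - 1)"
proof -
  let ?E = "complex_of_real E"
  have "cmod ((z / ?E) ^ n - (w / ?E) ^ n) \<le> real n * cmod (z / ?E - w / ?E)"
    using assms by (intro norm_power_diff) (auto simp: norm_divide)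
  moreover have "(z / ?E) ^ n - (w / ?E) ^ n = (z ^ n - w ^ n) / ?E ^ n"
    by (simp add: power_divide diff_divide_distrib)
  moreover have "z / ?E - w / ?E = (z - w) / ?E" by (simp add: diff_divide_distrib)
  ultimately have "cmod (z ^ n - w ^ n) / E ^ n \<le> real n * cmod (z - w) / E"
    using assms by (simp add: norm_divide norm_power)
  moreover have "E ^ n = E * E ^ (n - 1)" using assms by (simp add: power_eq_if)
  ultimately show ?thesis using assms by (simp add: field_simps)
qed

text \<open>With s = t^2/8 one has |t|^3 \<le> 1 + t^4 and t^4 = 64 s^2 \<le> 128 exp s; the
  remaining 2 is at most 2 exp s, which makes 130.\<close>

lemma cube_exp_le: "(1 + \<bar>t\<bar> ^ 3) * exp (- t\<^sup>2 / 8) \<le> (130::real)"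
proof -
  let ?s = "t\<^sup>2 / 8"
  have "?s ^ 2 \<le> fact 2 * exp ?s" "?s ^ 0 \<le> fact 0 * exp ?s" by (rule power_le_fact_exp, simp)+
  hence s: "?s\<^sup>2 \<le> 2 * exp ?s" "1 \<le> exp ?s" by (simp_all add: numeral_2_eq_2)
  have "\<bar>t\<bar> ^ 3 \<le> 1 + t ^ 4"
  proof (cases "\<bar>t\<bar> \<le> 1")
    case True
    hence "\<bar>t\<bar> ^ 3 \<le> 1" by (simp add: power_le_one)
    moreover have "0 \<le> t ^ 4" by simp
    ultimately show ?thesis by linarith
  next
    case False
    hence "\<bar>t\<bar> ^ 3 \<le> \<bar>t\<bar> ^ 4" by (intro power_increasing) auto
    thus ?thesis by simp
  qed
  moreover have "t ^ 4 = 64 * ?s\<^sup>2" by (simp add: power2_eq_square numeral_eq_Suc field_simps)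
  ultimately have "1 + \<bar>t\<bar> ^ 3 \<le> 130 * exp ?s" using s by linarith
  thus ?thesis by (simp add: exp_minus field_simps)
qed

text \<open>With r = p + q, exp(-r) lies between 1 - r and 1 - r + r^2/2, while the product is 1 - r
  + p q with p q \<le> r^2/4. The upper bound comes from (1 - r + r^2/2)(1 + r + r^2/2) \<ge>
  1.\<close>

lemma gaussian_factor_approx:
  assumes p: "0 \<le> p" "0 \<le> (q::real)"
  shows "\<bar>(1 - p) * (1 - q) - exp (- (p + q))\<bar> \<le> (p + q)\<^sup>2"
proof -
  have 1: "1 - (p + q) \<le> exp (- (p + q))" using exp_ge_add_one_self[of "- (p + q)"] by linarith
  have "exp (- (p + q)) \<le> 1 - (p + q) + (p + q)\<^sup>2 / 2"
  proof -
    have prod: "(1 - r + r\<^sup>2 / 2) * (1 + r + r\<^sup>2 / 2) = 1 + r ^ 4 / 4" for r :: real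
      by (simp add: field_simps power2_eq_square power4_eq_xxxx)
    have nonneg: "0 \<le> 1 - r + r\<^sup>2 / 2" for r :: real
      using zero_le_power2[of "1 - r"] by (simp add: power2_eq_square algebra_simps)
    have "1 + (p + q) + (p + q)\<^sup>2 / 2 \<le> exp (p + q)"
      using p by (intro exp_lower_Taylor_quadratic) simp
    from mult_left_mono[OF this nonneg[of "p + q"]]
    have "1 + (p + q) ^ 4 / 4 \<le> (1 - (p + q) + (p + q)\<^sup>2 / 2) * exp (p + q)"
      unfolding prod .
    moreover have "0 \<le> (p + q) ^ 4 / 4" by simp
    ultimately have "1 \<le> (1 - (p + q) + (p + q)\<^sup>2 / 2) * exp (p + q)" by linarith
    moreover have "exp (- r) \<le> X" if "1 \<le> X * exp r" for r X :: real
      using that by (simp add: exp_minus field_simps)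
    ultimately show ?thesis by blast
  qed
  moreover have "0 \<le> p * q" "4 * (p * q) \<le> (p + q)\<^sup>2"
  proof -
    have "0 \<le> (p - q)\<^sup>2" by simp
    thus "4 * (p * q) \<le> (p + q)\<^sup>2" by (simp add: power2_eq_square algebra_simps)
  qed (use p in simp)
  moreover have "(1 - p) * (1 - q) = 1 - (p + q) + p * q" by (simp add: algebra_simps)
  ultimately show ?thesis using 1 zero_le_power2[of "p + q"] by linarith
qed

text \<open>Beyond T the kernel satisfies 2/(b^2 + t^2) \<le> 4/(T^2 + t^2), and the integral of the
  latter over the whole line is 4 pi/T. This yields the order 1/T with no separate tail
  integral.\<close>

lemma integral_split_bound:
  fixes f :: "real \<Rightarrow> real"
  assumes b: "0 < b" and T: "0 < T" and A: "0 \<le> A"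
    and int: "integrable lborel (\<lambda>t. f t / (b\<^sup>2 + t\<^sup>2))"
    and le: "\<And>t. \<bar>t\<bar> \<le> T \<Longrightarrow> f t \<le> A" and le2: "\<And>t. f t \<le> 2"
  shows "(LBINT t. f t / (b\<^sup>2 + t\<^sup>2)) \<le> pi * (A / b + 4 / T)"
proof -
  have "(LBINT t. f t / (b\<^sup>2 + t\<^sup>2)) \<le> (LBINT t. A * (1 / (b\<^sup>2 + t\<^sup>2)) + 4 * (1 / (T\<^sup>2 + t\<^sup>2)))"
  proof (rule integral_mono[OF int])
    show "integrable lborel (\<lambda>t. A * (1 / (b\<^sup>2 + t\<^sup>2)) + 4 * (1 / (T\<^sup>2 + t\<^sup>2)))"
      by (intro Bochner_Integration.integrable_add integrable_mult_right integrable_inverse_quadratic b T)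
    fix t :: real
    have pos: "0 < b\<^sup>2 + t\<^sup>2" "0 < T\<^sup>2 + t\<^sup>2" using b T by (simp_all add: add_pos_nonneg)
    show "f t / (b\<^sup>2 + t\<^sup>2) \<le> A * (1 / (b\<^sup>2 + t\<^sup>2)) + 4 * (1 / (T\<^sup>2 + t\<^sup>2))"
    proof (cases "\<bar>t\<bar> \<le> T")
      case True
      have "f t / (b\<^sup>2 + t\<^sup>2) \<le> A * (1 / (b\<^sup>2 + t\<^sup>2))"
        using divide_right_mono[OF le[OF True], of "b\<^sup>2 + t\<^sup>2"] pos by simp
      moreover have "0 \<le> 4 * (1 / (T\<^sup>2 + t\<^sup>2))" using pos by simp
      ultimately show ?thesis by linarith
    next
      case False
      hence "T\<^sup>2 \<le> \<bar>t\<bar>\<^sup>2" using T by (intro power_mono) auto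
      hence "T\<^sup>2 \<le> t\<^sup>2" by simp
      hence "T\<^sup>2 + t\<^sup>2 \<le> 2 * (b\<^sup>2 + t\<^sup>2)" using zero_le_power2[of b] unfolding distrib_left by linarith
      hence "2 / (b\<^sup>2 + t\<^sup>2) \<le> 4 * (1 / (T\<^sup>2 + t\<^sup>2))" using pos by (simp add: field_simps)
      moreover have "f t / (b\<^sup>2 + t\<^sup>2) \<le> 2 / (b\<^sup>2 + t\<^sup>2)"
        using le2[of t] pos by (intro divide_right_mono) auto
      moreover have "0 \<le> A * (1 / (b\<^sup>2 + t\<^sup>2))" using A pos by simp
      ultimately show ?thesis by linarith
    qed
  qed
  also have "\<dots> = A * (pi / b) + 4 * (pi / T)"
    using integrable_inverse_quadratic[OF b] integrable_inverse_quadratic[OF T]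
    by (subst Bochner_Integration.integral_add) (simp_all only: integrable_mult_right integral_mult_right_zero)
  finally show ?thesis by (simp add: algebra_simps)
qed

context exp_moment
begin

text \<open>\<open>v\<close> is a lower bound for the second moment at 0 and \<eta> a radius of
  tilts. The last two conditions keep \<open>moment 2\<close> above v/2 and \<open>moment 0\<close>
  above 1/2 on this range; \<delta>/4 is the range of \<open>moment_cubic\<close>.\<close>

definition admissible :: "real \<Rightarrow> real \<Rightarrow> bool" where
  "admissible v \<eta> \<longleftrightarrow> 0 < v \<and> 0 < \<eta> \<and> \<eta> \<le> \<delta> / 4 \<and> \<eta> * bnd 3 \<le> v / 2 \<and> \<eta> * bnd 1 \<le> 1 / 2"

lemma moment_2_ge:
  assumes "admissible v \<eta>" "v \<le> moment 2 0" "\<bar>x\<bar> \<le> \<eta>"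
  shows "v / 2 \<le> moment 2 x"
proof -
  have "\<bar>moment 2 x - moment 2 0\<bar> \<le> bnd 3 * \<bar>x\<bar>"
    using moment_lipschitz[of x 0 2] assms \<delta>_pos by (simp add: admissible_def eval_nat_numeral)
  also have "\<dots> \<le> bnd 3 * \<eta>" using assms bnd_ge_0 by (intro mult_left_mono) auto
  also have "\<dots> \<le> v / 2" using assms by (simp add: admissible_def mult.commute)
  finally show ?thesis using assms by linarith
qed

lemma moment_0_ge:
  assumes "admissible v \<eta>" "\<bar>x\<bar> \<le> \<eta>"
  shows "1 / 2 \<le> moment 0 x"
proof -
  have "\<bar>moment 0 x - moment 0 0\<bar> \<le> bnd 1 * \<bar>x\<bar>"
    using moment_lipschitz[of x 0 0] assms \<delta>_pos by (simp add: admissible_def)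
  also have "\<dots> \<le> bnd 1 * \<eta>" using assms bnd_ge_0 by (intro mult_left_mono) auto
  also have "\<dots> \<le> 1 / 2" using assms by (simp add: admissible_def mult.commute)
  finally show ?thesis unfolding moment_0_0 by linarith
qed

text \<open>Strong convexity of the moment generating function with modulus v/2. It gives uniqueness
  of the saddle point and bounds its distance from 0 by the drift.\<close>

lemma moment_1_increasing:
  assumes "admissible v \<eta>" "v \<le> moment 2 0" "- \<eta> \<le> x" "x \<le> y" "y \<le> \<eta>"
  shows "v / 2 * (y - x) \<le> moment 1 y - moment 1 x"
proof (cases "x = y")
  case False
  have "\<exists>z>x. z < y \<and> moment 1 y - moment 1 x = (y - x) * moment 2 z"
  proof (rule MVT2)
    fix z assume "x \<le> z" "z \<le> y"
    hence "\<bar>z\<bar> < \<delta> / 2" using assms \<delta>_pos by (auto simp: admissible_def)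
    thus "(moment 1 has_real_derivative moment 2 z) (at z)"
      using moment_has_derivative[of z 1] by (simp add: numeral_2_eq_2)
  qed (use False assms in auto)
  then obtain z where z: "x < z" "z < y" "moment 1 y - moment 1 x = (y - x) * moment 2 z" by blast
  have "v / 2 \<le> moment 2 z" using z assms by (intro moment_2_ge[OF assms(1,2)]) auto
  thus ?thesis using z assms by (simp add: mult.commute mult_left_mono)
qed simp

lemma ex1_critical:
  assumes adm: "admissible v \<eta>" "v \<le> moment 2 0" and d: "0 < d" "d \<le> \<eta>"
    and "moment 1 0 \<le> 0" "- moment 1 0 \<le> v / 2 * d"
  shows "\<exists>!x. x \<in> {0..d} \<and> moment 1 x = 0"
proof -
  have "v / 2 * (d - 0) \<le> moment 1 d - moment 1 0"
    using d adm by (intro moment_1_increasing[OF adm]) (auto simp: admissible_def)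
  hence "0 \<le> moment 1 d" using assms by simp
  moreover have "continuous_on {0..d} (moment 1)"
  proof (rule continuous_at_imp_continuous_on, rule ballI)
    fix x assume "x \<in> {0..d}"
    hence "\<bar>x\<bar> < \<delta> / 2" using d adm \<delta>_pos by (auto simp: admissible_def)
    thus "isCont (moment 1) x" by (rule DERIV_isCont[OF moment_has_derivative])
  qed
  ultimately obtain x where x: "0 \<le> x" "x \<le> d" "moment 1 x = 0"
    using IVT'[of "moment 1" 0 0 d] assms by auto
  moreover have "y = z" if "y \<in> {0..d}" "z \<in> {0..d}" "moment 1 y = 0" "moment 1 z = 0" "y \<le> z" for y z
  proof -
    have "v / 2 * (z - y) \<le> moment 1 z - moment 1 y"
      using that d by (intro moment_1_increasing[OF adm]) auto
    hence "v * (z - y) \<le> 0" using that by simp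
    thus ?thesis using that adm(1) by (auto simp: admissible_def mult_le_0_iff)
  qed
  ultimately show ?thesis by (metis atLeastAtMost_iff linorder_linear)
qed

text \<open>The critical point is comparable to the drift, and the variance of the tilted law lies
  between positive constants; together these give the two-sided bounds on \<sigma> and \<beta>.
  \<open>moment 0\<close> is at most 1 at x since by convexity it decreases on the way from 0 to x.
  The last estimate compares its value with 1 - \<beta>^2/(2n).\<close>

lemma critical_bounds:
  assumes adm: "admissible v \<eta>" "v \<le> moment 2 0" and x: "0 \<le> x" "x \<le> \<eta>" "moment 1 x = 0"
  shows "v / 2 * x \<le> - moment 1 0" "- moment 1 0 \<le> bnd 2 * x" "moment 0 x \<le> 1"
    and "v / 2 \<le> moment 2 x / moment 0 x" "moment 2 x / moment 0 x \<le> 2 * bnd 2"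
    and "\<bar>moment 0 x - (1 - moment 2 x / moment 0 x * x\<^sup>2 / 2)\<bar> \<le> (bnd 3 + bnd 2 * bnd 1) * x ^ 3"
proof -
  have x': "\<bar>x\<bar> < \<delta> / 2" "\<bar>x\<bar> \<le> \<delta> / 2" "x \<le> \<delta> / 4" using x adm \<delta>_pos by (auto simp: admissible_def)
  show "v / 2 * x \<le> - moment 1 0"
    using moment_1_increasing[OF adm, of 0 x] x adm by (auto simp: admissible_def)
  show "- moment 1 0 \<le> bnd 2 * x"
    using moment_lipschitz[of x 0 1] x x' \<delta>_pos by (simp add: numeral_2_eq_2)
  show m1: "moment 0 x \<le> 1"
  proof (cases "x = 0")
    case False
    have "\<exists>z>0. z < x \<and> moment 0 x - moment 0 0 = (x - 0) * moment 1 z"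
    proof (rule MVT2)
      fix z assume "0 \<le> z" "z \<le> x"
      hence "\<bar>z\<bar> < \<delta> / 2" using x' by auto
      thus "(moment 0 has_real_derivative moment 1 z) (at z)"
        using moment_has_derivative[of z 0] by simp
    qed (use False x in auto)
    then obtain z where z: "0 < z" "z < x" "moment 0 x - moment 0 0 = x * moment 1 z" by auto
    have "v / 2 * (x - z) \<le> moment 1 x - moment 1 z"
      using z x by (intro moment_1_increasing[OF adm]) auto
    moreover have "0 \<le> v / 2 * (x - z)" using z adm by (auto simp: admissible_def)
    ultimately have "moment 1 z \<le> 0" using x by simp
    hence "x * moment 1 z \<le> 0" using x by (intro mult_nonneg_nonpos) auto
    thus ?thesis using z(3) unfolding moment_0_0 by linarith
  qed (simp add: moment_0_0)
  have m2: "v / 2 \<le> moment 2 x" using x by (intro moment_2_ge[OF adm]) auto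
  have m0: "1 / 2 \<le> moment 0 x" using x by (intro moment_0_ge[OF adm(1)]) auto
  have v: "0 < v" using adm by (simp add: admissible_def)
  have "v / 2 * moment 0 x \<le> v / 2 * 1" using m1 v by (intro mult_left_mono) auto
  thus "v / 2 \<le> moment 2 x / moment 0 x" using m2 m0 by (simp add: pos_le_divide_eq)
  have m2': "moment 2 x \<le> bnd 2" using abs_moment_le[OF x'(2), of 2] by linarith
  have "bnd 2 * (1 / 2) \<le> bnd 2 * moment 0 x" using m0 bnd_ge_0 by (intro mult_left_mono) auto
  thus s: "moment 2 x / moment 0 x \<le> 2 * bnd 2" using m2' m0 by (simp add: pos_divide_le_eq)
  \<comment> \<open>\<open>S\<close> is the tilted variance. Passing from \<open>moment 2 x\<close>
    to \<open>S\<close> costs a factor \<open>moment 0 x\<close>, that is an error S x^2/2 |moment 0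
    x - 1|, which is again cubic in x.\<close>
  define S where "S = moment 2 x / moment 0 x"
  have S: "moment 2 x = S * moment 0 x" "0 \<le> S" "S \<le> 2 * bnd 2"
    using m0 m2 v s by (auto simp: S_def)
  have "\<bar>moment 0 x - 1\<bar> \<le> bnd 1 * x"
    using moment_lipschitz[of x 0 0] x x' \<delta>_pos by (simp add: moment_0_0)
  hence "S * x\<^sup>2 / 2 * \<bar>moment 0 x - 1\<bar> \<le> bnd 2 * x\<^sup>2 * (bnd 1 * x)"
    using S x bnd_ge_0 mult_right_mono[OF S(3), of "x\<^sup>2"] by (intro mult_mono) auto
  hence "\<bar>S * x\<^sup>2 / 2 * (moment 0 x - 1)\<bar> \<le> bnd 2 * bnd 1 * x ^ 3"
    using S by (simp add: abs_mult power2_eq_square power3_eq_cube mult_ac)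
  moreover have "\<bar>1 - moment 0 x - x\<^sup>2 / 2 * moment 2 x\<bar> \<le> x ^ 3 * bnd 3"
    using x x' by (intro moment_cubic) auto
  moreover have "moment 0 x - (1 - S * x\<^sup>2 / 2) = - (1 - moment 0 x - x\<^sup>2 / 2 * moment 2 x) - S * x\<^sup>2 / 2 * (moment 0 x - 1)"
    unfolding S(1) by (simp add: field_simps)
  ultimately have "\<bar>moment 0 x - (1 - S * x\<^sup>2 / 2)\<bar> \<le> x ^ 3 * bnd 3 + bnd 2 * bnd 1 * x ^ 3"
    by linarith
  thus "\<bar>moment 0 x - (1 - moment 2 x / moment 0 x * x\<^sup>2 / 2)\<bar> \<le> (bnd 3 + bnd 2 * bnd 1) * x ^ 3"
    by (simp add: S_def algebra_simps)
qed

text \<open>The bound 1 keeps 1 - t^2/(2n) positive. The second bound makes the cubic Taylor error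
  at most half of the quadratic decrease t^2/(2n); sqrt(v/2) is a lower bound for \<sigma>, and the
  added 1 avoids division by zero.\<close>

definition char_radius :: "real \<Rightarrow> real" where
  "char_radius v = min 1 (sqrt (v / 2) ^ 3 / (4 * (bnd 3 + 1)))"

text \<open>The first summand is the cubic error of the tilted expansion, the third the error of
  \<open>moment 0 x\<close>, and 1 together with b^4 the error of replacing the product of quadratic
  factors by an exponential.\<close>

definition char_const :: "real \<Rightarrow> real \<Rightarrow> real" where
  "char_const v b = bnd 3 / sqrt (v / 2) ^ 3 + 1 + (bnd 3 + bnd 2 * bnd 1) * (b / sqrt (v / 2)) ^ 3 + b ^ 4"

lemma char_radius_pos: "0 < v \<Longrightarrow> 0 < char_radius v"
  using bnd_ge_0[of 3] by (simp add: char_radius_def)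

text \<open>One factor is compared in three steps: a(t), then moment 0 x times 1 - t^2/(2n), then (1
  - \<beta>^2/(2n))(1 - t^2/(2n)), then exp(-(\<beta>^2 + t^2)/(2n)). Each step costs a multiple of
  n^(-3/2) (1 + |t|^3); the n-th power multiplies by n, and Gaussian decay removes the growth in
  t.\<close>

lemma tilted_char_power_diff:
  fixes n :: nat
  defines "\<epsilon> \<equiv> 1 / sqrt (real n)"
  assumes adm: "admissible v \<eta>" "v \<le> moment 2 0" and x: "0 \<le> x" "x \<le> \<eta>" "moment 1 x = 0"
    and n: "2 \<le> n" and \<sigma>: "\<sigma> = sqrt (moment 2 x / moment 0 x)" and \<beta>: "\<beta> = x * \<sigma> * sqrt (real n)" "\<beta> \<le> b"
    and a: "\<And>t. a t = (LINT \<omega>|M. exp ((complex_of_real x + \<i> * complex_of_real (t / (\<sigma> * sqrt (real n)))) * complex_of_real (Y \<omega>)))"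
  shows "\<bar>t\<bar> \<le> char_radius v * sqrt (real n) \<Longrightarrow>
      cmod (a t ^ n - complex_of_real (exp (- (\<beta>\<^sup>2 + t\<^sup>2) / 2))) \<le> 130 * char_const v b * \<epsilon>"
    and "cmod (a t ^ n - complex_of_real (exp (- (\<beta>\<^sup>2 + t\<^sup>2) / 2))) \<le> 2"
proof -
  note cb = critical_bounds[OF adm x]
  define s where "s = sqrt (v / 2)"
  have v: "0 < v" using adm by (simp add: admissible_def)
  have s: "0 < s" "s \<le> \<sigma>" using v cb(4) unfolding s_def \<sigma> by (auto intro: real_sqrt_le_mono)
  hence \<sigma>0: "0 < \<sigma>" by linarith
  have \<sigma>2: "\<sigma>\<^sup>2 = moment 2 x / moment 0 x"
    unfolding \<sigma> using cb(4) v by (intro real_sqrt_pow2) linarith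
  have x': "\<bar>x\<bar> \<le> \<delta> / 2" using x adm \<delta>_pos by (auto simp: admissible_def)
  have m0: "0 < moment 0 x" by (rule moment_pos[OF x'])
  have m2: "moment 2 x = \<sigma>\<^sup>2 * moment 0 x" using \<sigma>2 m0 by simp
  have n0: "0 < real n" using n by simp
  have \<epsilon>: "0 < \<epsilon>" "\<epsilon> \<le> 1" "\<epsilon>\<^sup>2 = 1 / real n" "real n * \<epsilon> ^ 3 = \<epsilon>"
    using n by (auto simp: \<epsilon>_def power2_eq_square power3_eq_cube real_div_sqrt)
  have \<beta>0: "0 \<le> \<beta>" using x \<sigma>0 by (simp add: \<beta>)
  have x_eq: "x = \<beta> * \<epsilon> / \<sigma>" using \<sigma>0 n by (simp add: \<beta> \<epsilon>_def)
  \<comment> \<open>The n-th root of the Gaussian transform, so that factors can be compared before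
    taking powers.\<close>
  define bb where "bb = (\<lambda>t. exp (- ((\<beta>\<^sup>2 + t\<^sup>2) * \<epsilon>\<^sup>2 / 2)))"
  have bb_n: "bb t ^ n = exp (- (\<beta>\<^sup>2 + t\<^sup>2) / 2)" for t
  proof -
    have "real n * (- ((\<beta>\<^sup>2 + t\<^sup>2) * (1 / real n) / 2)) = - (\<beta>\<^sup>2 + t\<^sup>2) / 2"
      using n by (simp add: field_simps)
    thus ?thesis unfolding bb_def exp_of_nat_mult[symmetric] \<epsilon>(3) by (simp only:)
  qed
  have a_le: "cmod (a t) \<le> 1"
    using norm_expectation_exp_le[of x "t / (\<sigma> * sqrt (real n))"] cb(3) unfolding a by linarith
  show "cmod (a t ^ n - complex_of_real (exp (- (\<beta>\<^sup>2 + t\<^sup>2) / 2))) \<le> 2"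
  proof -
    have "cmod (a t ^ n) \<le> 1" "cmod (complex_of_real (exp (- (\<beta>\<^sup>2 + t\<^sup>2) / 2))) \<le> 1"
      using a_le by (auto simp: norm_power power_le_one)
    thus ?thesis using norm_triangle_ineq4[of "a t ^ n" "complex_of_real (exp (- (\<beta>\<^sup>2 + t\<^sup>2) / 2))"] by linarith
  qed
  assume "\<bar>t\<bar> \<le> char_radius v * sqrt (real n)"
  hence tc: "\<bar>t\<bar> * \<epsilon> \<le> char_radius v" using n0 by (simp add: \<epsilon>_def field_simps)
  hence t1: "\<bar>t\<bar> * \<epsilon> \<le> 1" by (simp add: char_radius_def)
  hence t2: "t\<^sup>2 * \<epsilon>\<^sup>2 \<le> 1"
    using \<epsilon> power_mono[OF t1, of 2] by (simp add: power_mult_distrib)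
  define u where "u = t / (\<sigma> * sqrt (real n))"
  have u: "\<bar>u\<bar> = \<bar>t\<bar> * \<epsilon> / \<sigma>" "u\<^sup>2 = t\<^sup>2 * \<epsilon>\<^sup>2 / \<sigma>\<^sup>2"
    using \<sigma>0 n0 by (simp_all add: u_def \<epsilon>_def abs_mult power_mult_distrib power_divide)
  \<comment> \<open>The choice of \<sigma> makes the relative variance of the tilted, rescaled
    variable exactly 1.\<close>
  have quad: "moment 0 x - u\<^sup>2 / 2 * moment 2 x = moment 0 x * (1 - t\<^sup>2 * \<epsilon>\<^sup>2 / 2)"
    using \<sigma>0 unfolding m2 u by (simp add: algebra_simps)
  have e1: "cmod (a t - complex_of_real (moment 0 x * (1 - t\<^sup>2 * \<epsilon>\<^sup>2 / 2))) \<le> \<bar>u\<bar> ^ 3 * bnd 3"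
    using expectation_exp_quadratic[OF x' x(3), of u] unfolding a quad[symmetric] u_def .
  have cube_s: "1 / \<sigma> ^ 3 \<le> 1 / s ^ 3"
    using s by (intro divide_left_mono power_mono) auto
  have u3: "\<bar>u\<bar> ^ 3 * bnd 3 \<le> \<bar>t\<bar> ^ 3 * \<epsilon> ^ 3 * (bnd 3 / s ^ 3)"
  proof -
    have "\<bar>u\<bar> ^ 3 * bnd 3 = \<bar>t\<bar> ^ 3 * \<epsilon> ^ 3 * bnd 3 * (1 / \<sigma> ^ 3)"
      unfolding u by (simp add: power_divide power_mult_distrib)
    also have "\<dots> \<le> \<bar>t\<bar> ^ 3 * \<epsilon> ^ 3 * bnd 3 * (1 / s ^ 3)"
      using \<epsilon> bnd_ge_0 by (intro mult_left_mono cube_s) auto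
    finally show ?thesis by simp
  qed
  have e2: "\<bar>moment 0 x * (1 - t\<^sup>2 * \<epsilon>\<^sup>2 / 2) - (1 - \<beta>\<^sup>2 * \<epsilon>\<^sup>2 / 2) * (1 - t\<^sup>2 * \<epsilon>\<^sup>2 / 2)\<bar>
      \<le> \<epsilon> ^ 3 * ((bnd 3 + bnd 2 * bnd 1) * (b / s) ^ 3)"
  proof -
    have "\<beta>\<^sup>2 * \<epsilon>\<^sup>2 = \<sigma>\<^sup>2 * x\<^sup>2"
      using \<sigma>0 by (simp add: x_eq power_divide power_mult_distrib)
    hence "\<beta>\<^sup>2 * \<epsilon>\<^sup>2 = moment 2 x / moment 0 x * x\<^sup>2"
      unfolding \<sigma>2 .
    hence "\<bar>moment 0 x - (1 - \<beta>\<^sup>2 * \<epsilon>\<^sup>2 / 2)\<bar> \<le> (bnd 3 + bnd 2 * bnd 1) * x ^ 3"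
      using cb(6) by simp
    also have "\<dots> \<le> (bnd 3 + bnd 2 * bnd 1) * (\<epsilon> * (b / s)) ^ 3"
    proof (intro mult_left_mono power_mono)
      have "\<beta> / \<sigma> \<le> b / s" using \<beta>0 \<beta> s by (intro frac_le) auto
      hence "\<epsilon> * (\<beta> / \<sigma>) \<le> \<epsilon> * (b / s)" using \<epsilon> by (intro mult_left_mono) auto
      thus "x \<le> \<epsilon> * (b / s)" unfolding x_eq by (simp add: mult.commute)
    qed (use x bnd_ge_0 in auto)
    finally have 1: "\<bar>moment 0 x - (1 - \<beta>\<^sup>2 * \<epsilon>\<^sup>2 / 2)\<bar> \<le> (bnd 3 + bnd 2 * bnd 1) * (\<epsilon> * (b / s)) ^ 3" .
    have "\<bar>moment 0 x * (1 - t\<^sup>2 * \<epsilon>\<^sup>2 / 2) - (1 - \<beta>\<^sup>2 * \<epsilon>\<^sup>2 / 2) * (1 - t\<^sup>2 * \<epsilon>\<^sup>2 / 2)\<bar>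
        = \<bar>moment 0 x - (1 - \<beta>\<^sup>2 * \<epsilon>\<^sup>2 / 2)\<bar> * \<bar>1 - t\<^sup>2 * \<epsilon>\<^sup>2 / 2\<bar>"
      by (simp add: abs_mult[symmetric] algebra_simps)
    also have "\<dots> \<le> (bnd 3 + bnd 2 * bnd 1) * (\<epsilon> * (b / s)) ^ 3 * 1"
      using t2 order_trans[OF abs_ge_zero 1] by (intro mult_mono 1) (simp_all add: abs_le_iff)
    finally show ?thesis by (simp only: power_mult_distrib[of \<epsilon> "b / s"] mult_1_right mult_ac)
  qed
  have e3: "\<bar>(1 - \<beta>\<^sup>2 * \<epsilon>\<^sup>2 / 2) * (1 - t\<^sup>2 * \<epsilon>\<^sup>2 / 2) - bb t\<bar> \<le> \<epsilon> ^ 3 * (b ^ 4 + \<bar>t\<bar> ^ 3)"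
  proof -
    let ?p = "\<beta>\<^sup>2 * \<epsilon>\<^sup>2 / 2" and ?q = "t\<^sup>2 * \<epsilon>\<^sup>2 / 2"
    have "\<bar>(1 - ?p) * (1 - ?q) - exp (- (?p + ?q))\<bar> \<le> (?p + ?q)\<^sup>2"
      by (rule gaussian_factor_approx) auto
    also have "exp (- (?p + ?q)) = bb t" by (simp add: bb_def algebra_simps add_divide_distrib)
    also have "(?p + ?q)\<^sup>2 \<le> 2 * ?p\<^sup>2 + 2 * ?q\<^sup>2"
      using zero_le_power2[of "?p - ?q"] by (simp add: power2_eq_square algebra_simps)
    also have "2 * ?p\<^sup>2 = \<beta> ^ 4 * \<epsilon> ^ 4 / 2" by (simp add: power2_eq_square numeral_eq_Suc)
    also have "2 * ?q\<^sup>2 = \<bar>t\<bar> ^ 3 * \<epsilon> ^ 3 * (\<bar>t\<bar> * \<epsilon>) / 2"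
    proof -
      have "\<bar>t\<bar> ^ 3 * \<epsilon> ^ 3 * (\<bar>t\<bar> * \<epsilon>) = \<bar>t\<bar> ^ 4 * \<epsilon> ^ 4" by (simp add: numeral_eq_Suc)
      also have "\<bar>t\<bar> ^ 4 = t ^ 4" by simp
      finally show ?thesis by (simp add: power2_eq_square numeral_eq_Suc)
    qed
    also have "\<beta> ^ 4 * \<epsilon> ^ 4 / 2 + \<bar>t\<bar> ^ 3 * \<epsilon> ^ 3 * (\<bar>t\<bar> * \<epsilon>) / 2 \<le> b ^ 4 * \<epsilon> ^ 3 + \<bar>t\<bar> ^ 3 * \<epsilon> ^ 3"
    proof (rule add_mono)
      have "\<beta> ^ 4 * \<epsilon> ^ 4 \<le> b ^ 4 * \<epsilon> ^ 3"
        using \<beta>0 \<beta> \<epsilon> by (intro mult_mono power_mono power_decreasing) auto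
      moreover have "0 \<le> \<beta> ^ 4 * \<epsilon> ^ 4" by simp
      ultimately show "\<beta> ^ 4 * \<epsilon> ^ 4 / 2 \<le> b ^ 4 * \<epsilon> ^ 3" by linarith
      have "\<bar>t\<bar> ^ 3 * \<epsilon> ^ 3 * (\<bar>t\<bar> * \<epsilon>) \<le> \<bar>t\<bar> ^ 3 * \<epsilon> ^ 3 * 1"
        using \<epsilon> by (intro mult_left_mono t1) auto
      moreover have "0 \<le> \<bar>t\<bar> ^ 3 * \<epsilon> ^ 3 * (\<bar>t\<bar> * \<epsilon>)" using \<epsilon> by auto
      ultimately show "\<bar>t\<bar> ^ 3 * \<epsilon> ^ 3 * (\<bar>t\<bar> * \<epsilon>) / 2 \<le> \<bar>t\<bar> ^ 3 * \<epsilon> ^ 3" by linarith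
    qed
    finally show ?thesis by (simp add: algebra_simps)
  qed
  have b0: "0 \<le> b" using \<beta>0 \<beta> by linarith
  have diff: "cmod (a t - complex_of_real (bb t)) \<le> \<epsilon> ^ 3 * (char_const v b * (1 + \<bar>t\<bar> ^ 3))"
  proof -
    define P where "P = (bnd 3 + bnd 2 * bnd 1) * (b / s) ^ 3"
    have P: "0 \<le> P" unfolding P_def using bnd_ge_0 b0 s by auto
    have "a t - complex_of_real (bb t) = (a t - complex_of_real (moment 0 x * (1 - t\<^sup>2 * \<epsilon>\<^sup>2 / 2)))
       + complex_of_real ((moment 0 x * (1 - t\<^sup>2 * \<epsilon>\<^sup>2 / 2) - (1 - \<beta>\<^sup>2 * \<epsilon>\<^sup>2 / 2) * (1 - t\<^sup>2 * \<epsilon>\<^sup>2 / 2))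
          + ((1 - \<beta>\<^sup>2 * \<epsilon>\<^sup>2 / 2) * (1 - t\<^sup>2 * \<epsilon>\<^sup>2 / 2) - bb t))" by simp
    hence "cmod (a t - complex_of_real (bb t)) \<le> cmod (a t - complex_of_real (moment 0 x * (1 - t\<^sup>2 * \<epsilon>\<^sup>2 / 2)))
       + \<bar>(moment 0 x * (1 - t\<^sup>2 * \<epsilon>\<^sup>2 / 2) - (1 - \<beta>\<^sup>2 * \<epsilon>\<^sup>2 / 2) * (1 - t\<^sup>2 * \<epsilon>\<^sup>2 / 2))
          + ((1 - \<beta>\<^sup>2 * \<epsilon>\<^sup>2 / 2) * (1 - t\<^sup>2 * \<epsilon>\<^sup>2 / 2) - bb t)\<bar>"
      by (metis norm_of_real norm_triangle_ineq)
    also have "\<dots> \<le> \<bar>t\<bar> ^ 3 * \<epsilon> ^ 3 * (bnd 3 / s ^ 3) + (\<epsilon> ^ 3 * P + \<epsilon> ^ 3 * (b ^ 4 + \<bar>t\<bar> ^ 3))"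
      using e1 u3 e2 e3 unfolding P_def
      by (intro add_mono order_trans[OF abs_triangle_ineq add_mono]) auto
    also have "\<dots> = \<epsilon> ^ 3 * ((bnd 3 / s ^ 3 + 1) * \<bar>t\<bar> ^ 3 + (P + b ^ 4))"
      by (simp add: algebra_simps)
    also have "\<dots> \<le> \<epsilon> ^ 3 * (char_const v b * (1 + \<bar>t\<bar> ^ 3))"
    proof (rule mult_left_mono)
      have c: "char_const v b = (bnd 3 / s ^ 3 + 1) + (P + b ^ 4)"
        by (simp add: char_const_def s_def P_def)
      have "0 \<le> bnd 3 / s ^ 3 + 1" "0 \<le> P + b ^ 4" "0 \<le> \<bar>t\<bar> ^ 3"
        using bnd_ge_0[of 3] s P by (auto intro!: add_nonneg_nonneg)
      thus "(bnd 3 / s ^ 3 + 1) * \<bar>t\<bar> ^ 3 + (P + b ^ 4) \<le> char_const v b * (1 + \<bar>t\<bar> ^ 3)"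
        unfolding c distrib_left distrib_right using mult_nonneg_nonneg[of "P + b ^ 4" "\<bar>t\<bar> ^ 3"]
        by (simp add: distrib_right)
    qed (use \<epsilon> in simp)
    finally show ?thesis .
  qed
  \<comment> \<open>A common bound for both factors. Inside the radius the cubic error consumes at
    most half of the decrease t^2 \<epsilon>^2/2, which leaves t^2 \<epsilon>^2/4.\<close>
  define E where "E = exp (- (t\<^sup>2 * \<epsilon>\<^sup>2 / 4))"
  have aE: "cmod (a t) \<le> E"
  proof -
    have "\<bar>u\<bar> \<le> s\<^sup>2 / (4 * (bnd 3 + 1))"
    proof -
      have "\<bar>t\<bar> * \<epsilon> \<le> s ^ 3 / (4 * (bnd 3 + 1))" using tc by (simp add: char_radius_def s_def)
      hence "\<bar>t\<bar> * \<epsilon> / \<sigma> \<le> s ^ 3 / (4 * (bnd 3 + 1)) / s"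
        using s bnd_ge_0[of 3] by (intro frac_le) auto
      thus ?thesis unfolding u using s by (simp add: power3_eq_cube power2_eq_square)
    qed
    moreover have "s\<^sup>2 / (4 * (bnd 3 + 1)) \<le> \<sigma>\<^sup>2 / (4 * (bnd 3 + 1))"
      using s bnd_ge_0[of 3] by (intro divide_right_mono power_mono) auto
    ultimately have "\<bar>u\<bar> * (4 * (bnd 3 + 1)) \<le> \<sigma>\<^sup>2"
      using bnd_ge_0[of 3] by (simp add: pos_le_divide_eq)
    moreover have "\<bar>u\<bar> * bnd 3 \<le> \<bar>u\<bar> * (bnd 3 + 1)" by (intro mult_left_mono) auto
    ultimately have "\<bar>u\<bar> * bnd 3 \<le> \<sigma>\<^sup>2 / 4" by linarith
    hence "u\<^sup>2 * (\<bar>u\<bar> * bnd 3) \<le> u\<^sup>2 * (\<sigma>\<^sup>2 / 4)" by (intro mult_left_mono) auto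
    moreover have "\<bar>u\<bar> ^ 3 = u\<^sup>2 * \<bar>u\<bar>" by (simp add: power3_eq_cube power2_eq_square)
    ultimately have ub: "\<bar>u\<bar> ^ 3 * bnd 3 \<le> t\<^sup>2 * \<epsilon>\<^sup>2 / 4" using \<sigma>0 by (simp add: u mult.assoc)
    have "0 \<le> 1 - t\<^sup>2 * \<epsilon>\<^sup>2 / 2" using t2 by simp
    hence le: "\<bar>moment 0 x * (1 - t\<^sup>2 * \<epsilon>\<^sup>2 / 2)\<bar> \<le> 1 * (1 - t\<^sup>2 * \<epsilon>\<^sup>2 / 2)"
      using cb(3) m0 unfolding abs_mult by (intro mult_mono) auto
    have "cmod (a t) \<le> cmod (complex_of_real (moment 0 x * (1 - t\<^sup>2 * \<epsilon>\<^sup>2 / 2)))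
        + cmod (a t - complex_of_real (moment 0 x * (1 - t\<^sup>2 * \<epsilon>\<^sup>2 / 2)))"
      by (rule norm_triangle_sub)
    also have "\<dots> \<le> (1 - t\<^sup>2 * \<epsilon>\<^sup>2 / 2) + t\<^sup>2 * \<epsilon>\<^sup>2 / 4"
      unfolding norm_of_real by (rule order_trans[OF add_mono[OF le order_trans[OF e1 ub]]]) simp
    also have "\<dots> = 1 + (- (t\<^sup>2 * \<epsilon>\<^sup>2 / 4))" by simp
    also have "\<dots> \<le> E" unfolding E_def by (rule exp_ge_add_one_self)
    finally show ?thesis .
  qed
  have bE: "cmod (complex_of_real (bb t)) \<le> E"
  proof -
    have "t\<^sup>2 * \<epsilon>\<^sup>2 / 4 \<le> (\<beta>\<^sup>2 + t\<^sup>2) * \<epsilon>\<^sup>2 / 2"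
      using zero_le_power2[of "\<beta> * \<epsilon>"] zero_le_power2[of "t * \<epsilon>"] by (simp add: power_mult_distrib algebra_simps)
    thus ?thesis by (simp add: bb_def E_def)
  qed
  have En: "E ^ (n - 1) \<le> exp (- t\<^sup>2 / 8)"
  proof -
    \<comment> \<open>From n \<ge> 2 the exponent n - 1 is at least n/2, which turns the rate 1/4
      into 1/8.\<close>
    have "real n \<le> 2 * real (n - 1)" using n by linarith
    hence "t\<^sup>2 * real n \<le> t\<^sup>2 * (2 * real (n - 1))" by (intro mult_left_mono) auto
    hence "t\<^sup>2 / 8 \<le> real (n - 1) * (t\<^sup>2 * \<epsilon>\<^sup>2 / 4)" unfolding \<epsilon> using n0 by (simp add: field_simps)
    thus ?thesis unfolding E_def exp_of_nat_mult[symmetric] by simp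
  qed
  have cc: "0 \<le> char_const v b"
    unfolding char_const_def using bnd_ge_0 b0 v by (auto intro!: add_nonneg_nonneg)
  have "cmod (a t ^ n - complex_of_real (bb t) ^ n) \<le> real n * cmod (a t - complex_of_real (bb t)) * E ^ (n - 1)"
    using n by (intro norm_power_diff_scaled aE bE) (auto simp: E_def)
  also have "\<dots> \<le> real n * (\<epsilon> ^ 3 * (char_const v b * (1 + \<bar>t\<bar> ^ 3))) * exp (- t\<^sup>2 / 8)"
    using \<epsilon> cc by (intro mult_mono diff En) (auto simp: E_def)
  also have "\<dots> = (real n * \<epsilon> ^ 3) * char_const v b * ((1 + \<bar>t\<bar> ^ 3) * exp (- t\<^sup>2 / 8))"
    by (simp add: mult_ac)
  also have "\<dots> \<le> (real n * \<epsilon> ^ 3) * char_const v b * 130"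
    using \<epsilon> cc by (intro mult_left_mono cube_exp_le) auto
  finally show "cmod (a t ^ n - complex_of_real (exp (- (\<beta>\<^sup>2 + t\<^sup>2) / 2))) \<le> 130 * char_const v b * \<epsilon>"
    unfolding \<epsilon>(4) of_real_power[symmetric] bb_n by (simp add: mult_ac)
qed

end

section \<open>The error bound for a single queue\<close>

context exp_moment
begin

lemma log_psi_eq:
  assumes "Y = (\<lambda>\<omega>. V \<omega> - U \<omega> / r)"
  shows "log_psi M V U r = (\<lambda>\<zeta>. ln (moment 0 (- \<zeta>)))"
proof
  fix \<zeta>
  have "psi M V U r (complex_of_real (- \<zeta>)) = (LINT \<omega>|M. complex_of_real (exp (- \<zeta> * Y \<omega>)))"
    unfolding psi_def assms by (simp add: exp_of_real[symmetric])
  also have "\<dots> = complex_of_real (moment 0 (- \<zeta>))"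
    unfolding moment_def by (simp only: integral_complex_of_real power_0 mult_1_left)
  finally show "log_psi M V U r \<zeta> = ln (moment 0 (- \<zeta>))"
    by (simp add: log_psi_def)
qed

lemma log_psi_derivative:
  assumes Y: "Y = (\<lambda>\<omega>. V \<omega> - U \<omega> / r)" and \<zeta>: "\<bar>\<zeta>\<bar> < \<delta> / 2"
  shows "(log_psi M V U r has_real_derivative - (moment 1 (- \<zeta>) / moment 0 (- \<zeta>))) (at \<zeta>)"
proof -
  have "0 < moment 0 (- \<zeta>)" using \<zeta> by (intro moment_pos) simp
  moreover have "((\<lambda>\<zeta>. moment 0 (- \<zeta>)) has_real_derivative moment 1 (- \<zeta>) * - 1) (at \<zeta>)"
    using moment_has_derivative[of "- \<zeta>" 0] \<zeta> by (intro DERIV_chain2[where f = "moment 0"]) (auto intro!: derivative_eq_intros)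
  ultimately show ?thesis
    unfolding log_psi_eq[OF Y] by (auto intro!: derivative_eq_intros)
qed

text \<open>At a critical point the square of the first logarithmic derivative vanishes, so the
  second derivative is the second moment of the normalised tilted law, which is also its
  variance.\<close>

lemma deriv_deriv_log_psi:
  assumes Y: "Y = (\<lambda>\<omega>. V \<omega> - U \<omega> / r)" and \<zeta>: "\<bar>\<zeta>\<bar> < \<delta> / 2" and crit: "moment 1 (- \<zeta>) = 0"
  shows "deriv (deriv (log_psi M V U r)) \<zeta> = moment 2 (- \<zeta>) / moment 0 (- \<zeta>)"
proof (rule DERIV_imp_deriv)
  have m0: "0 < moment 0 (- \<zeta>)" using \<zeta> by (intro moment_pos) simp
  have d: "((\<lambda>\<zeta>. moment k (- \<zeta>)) has_real_derivative moment (Suc k) (- \<zeta>) * - 1) (at \<zeta>)" for k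
    using moment_has_derivative[of "- \<zeta>" k] \<zeta> by (intro DERIV_chain2[where f = "moment k"]) (auto intro!: derivative_eq_intros)
  have "((\<lambda>\<zeta>. - (moment 1 (- \<zeta>) / moment 0 (- \<zeta>))) has_real_derivative
      - ((moment (Suc 1) (- \<zeta>) * - 1 * moment 0 (- \<zeta>) - moment 1 (- \<zeta>) * (moment (Suc 0) (- \<zeta>) * - 1)) / (moment 0 (- \<zeta>) * moment 0 (- \<zeta>)))) (at \<zeta>)"
    using m0 by (intro DERIV_minus DERIV_divide d) auto
  also have "- ((moment (Suc 1) (- \<zeta>) * - 1 * moment 0 (- \<zeta>) - moment 1 (- \<zeta>) * (moment (Suc 0) (- \<zeta>) * - 1)) / (moment 0 (- \<zeta>) * moment 0 (- \<zeta>)))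
      = moment 2 (- \<zeta>) / moment 0 (- \<zeta>)"
    using m0 unfolding crit by (simp add: numeral_2_eq_2)
  finally show "(deriv (log_psi M V U r) has_real_derivative moment 2 (- \<zeta>) / moment 0 (- \<zeta>)) (at \<zeta>)"
  proof (rule has_field_derivative_transform_within_open[of _ _ _ "{- \<delta> / 2<..<\<delta> / 2}"])
    \<comment> \<open>The explicit first derivative is valid on an open interval around \<zeta>,
      which suffices for differentiating once more.\<close>
    fix z assume "z \<in> {- \<delta> / 2<..<\<delta> / 2}"
    hence "\<bar>z\<bar> < \<delta> / 2" by auto
    from DERIV_imp_deriv[OF log_psi_derivative[OF Y this]]
    show "- (moment 1 (- z) / moment 0 (- z)) = deriv (log_psi M V U r) z" by simp
  qed (use \<zeta> in auto)
qed

text \<open>Since d < \<delta>/2, the whole interval lies where the moment formulas hold; positivity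
  of \<open>moment 0\<close> reduces the condition to a zero of \<open>moment 1\<close>.\<close>

lemma is_saddle_point_iff:
  assumes Y: "Y = (\<lambda>\<omega>. V \<omega> - U \<omega> / r)" and d: "d < \<delta> / 2"
  shows "is_saddle_point M V U d r \<zeta> \<longleftrightarrow> \<zeta> \<in> {- d..0} \<and> moment 1 (- \<zeta>) = 0"
proof (cases "\<zeta> \<in> {- d..0}")
  case True
  hence \<zeta>: "\<bar>\<zeta>\<bar> < \<delta> / 2" using d by auto
  hence "0 < moment 0 (- \<zeta>)" by (intro moment_pos) simp
  thus ?thesis
    using log_psi_derivative[OF Y \<zeta>] True
    by (auto simp: is_saddle_point_def dest: DERIV_unique)
qed (auto simp: is_saddle_point_def)

lemma saddle_point_exists:
  assumes Y: "Y = (\<lambda>\<omega>. V \<omega> - U \<omega> / r)" and adm: "admissible v \<eta>" "v \<le> moment 2 0"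
    and d: "0 < d" "d \<le> \<eta>" and m1: "moment 1 0 \<le> 0" "- moment 1 0 \<le> v / 2 * d"
  shows "\<exists>!\<zeta>. is_saddle_point M V U d r \<zeta>"
    and "\<exists>x. saddle_point M V U d r = - x \<and> 0 \<le> x \<and> x \<le> \<eta> \<and> moment 1 x = 0 \<and>
      deriv (deriv (log_psi M V U r)) (- x) = moment 2 x / moment 0 x"
proof -
  have d': "d < \<delta> / 2" using d adm(1) \<delta>_pos by (auto simp: admissible_def)
  note iff = is_saddle_point_iff[OF Y d']
  obtain x where x: "x \<in> {0..d}" "moment 1 x = 0" and uniq: "\<And>y. y \<in> {0..d} \<and> moment 1 y = 0 \<Longrightarrow> y = x"
    using ex1_critical[OF adm d m1] by blast
  have sp: "is_saddle_point M V U d r (- x)" using x by (simp add: iff)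
  have un: "\<zeta> = - x" if "is_saddle_point M V U d r \<zeta>" for \<zeta>
    using that uniq[of "- \<zeta>"] by (auto simp: iff)
  show "\<exists>!\<zeta>. is_saddle_point M V U d r \<zeta>" using sp un by blast
  have "saddle_point M V U d r = - x"
    unfolding saddle_point_def using sp un by (rule the_equality)
  moreover have "deriv (deriv (log_psi M V U r)) (- x) = moment 2 x / moment 0 x"
    using deriv_deriv_log_psi[OF Y, of "- x"] x d' by simp
  ultimately show "\<exists>x. saddle_point M V U d r = - x \<and> 0 \<le> x \<and> x \<le> \<eta> \<and> moment 1 x = 0 \<and>
      deriv (deriv (log_psi M V U r)) (- x) = moment 2 x / moment 0 x"
    using x d by (intro exI[of _ x]) auto
qed

text \<open>Write q = exp(-b1^2/2). The numbers 65 and 2 are half of 130 and 4, from dividing pi by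
  2 pi. The condition \<open>small\<close> pushes the exponential moment of the queue increment down
  to (1 + q)/2, so the two contraction gaps are at least (1 - q)/2 and 1 - q; this is the factor
  2/(1 - q)^2.\<close>

lemma waiting_time_laplace_diff:
  fixes s :: complex and n :: nat
  assumes Y: "Y = (\<lambda>\<omega>. V \<omega> - U \<omega> / r)" and ind: "indep_var borel V borel U"
    and intV: "\<And>z. \<bar>Re z\<bar> \<le> \<delta> \<Longrightarrow> integrable M (\<lambda>\<omega>. exp (z * complex_of_real (V \<omega>)))"
    and intU: "\<And>z. \<bar>Re z\<bar> \<le> \<delta> \<Longrightarrow> integrable M (\<lambda>\<omega>. exp (z * complex_of_real (U \<omega>)))"
    and r: "1 / 2 \<le> r"
    and adm: "admissible v \<eta>" "v \<le> moment 2 0" and x: "0 \<le> x" "x \<le> \<eta>" "moment 1 x = 0"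
    and n: "2 \<le> n" and \<sigma>: "\<sigma> = sqrt (moment 2 x / moment 0 x)" and \<beta>: "\<beta> = x * \<sigma> * sqrt (real n)"
    and b: "0 < b1" "b1 \<le> \<beta>" "\<beta> \<le> b2"
    and st: "steady_state_waiting_time M V U r n Q W"
    and small: "130 * char_const v b2 * (1 / sqrt (real n)) \<le> (1 - exp (- b1\<^sup>2 / 2)) / 2"
    and s: "- (1/2) * \<beta> \<le> Re s"
  shows "integrable Q (\<lambda>\<omega>. exp (- s * complex_of_real (sqrt (real n) / \<sigma> * W \<omega>)))"
    and "integrable (gaussian_steps \<beta>) (\<lambda>x. exp (- s * complex_of_real (walk_max x)))"
    and "cmod ((LINT \<omega>|Q. exp (- s * complex_of_real (sqrt (real n) / \<sigma> * W \<omega>)))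
        - (LINT x|gaussian_steps \<beta>. exp (- s * complex_of_real (walk_max x))))
      \<le> 2 * (65 * char_const v b2 / b1 + 2 / char_radius v) / (1 - exp (- b1\<^sup>2 / 2))\<^sup>2
          * (cmod s + 2 * (cmod s)\<^sup>2 / b1) / sqrt (real n)"
proof -
  define \<epsilon> where "\<epsilon> = 1 / sqrt (real n)"
  define q where "q = exp (- b1\<^sup>2 / 2)"
  define C where "C = char_const v b2"
  define R where "R = char_radius v"
  have v: "0 < v" using adm by (simp add: admissible_def)
  have R: "0 < R" unfolding R_def by (rule char_radius_pos[OF v])
  have n0: "0 < real n" "1 \<le> n" using n by auto
  have \<beta>0: "0 < \<beta>" using b by linarith
  have q: "0 < q" "q < 1" using b(1) by (auto simp: q_def)
  have "0 < moment 2 x / moment 0 x" using critical_bounds(4)[OF adm x] v by linarith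
  hence \<sigma>0: "0 < \<sigma>" unfolding \<sigma> by (rule real_sqrt_gt_zero)
  have \<epsilon>: "0 < \<epsilon>" using n0 by (simp add: \<epsilon>_def)
  have C: "0 \<le> C" unfolding C_def char_const_def
    using bnd_ge_0 b v by (auto intro!: add_nonneg_nonneg)
  have meas: "V \<in> borel_measurable M" "U \<in> borel_measurable M"
    using indep_var_rv1[OF ind] indep_var_rv2[OF ind] by auto
  define c where "c = sqrt (real n) / \<sigma>"
  have c: "0 < c" using n0 \<sigma>0 by (simp add: c_def)
  define \<mu> where "\<mu> = increment_law (sample_mean_law M V n) (sample_mean_law M U n) r c"
  define \<nu> where "\<nu> = density lborel (normal_density (- \<beta>) 1)"
  define L where "L = distr Q borel (\<lambda>\<omega>. c * W \<omega>)"
  define K where "K = distr (gaussian_steps \<beta>) borel walk_max"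
  define a where "a = (\<lambda>t. (LINT \<omega>|M. exp ((complex_of_real x + \<i> * complex_of_real (t / (\<sigma> * sqrt (real n)))) * complex_of_real (Y \<omega>))))"
  have rdA: "real_distribution (sample_mean_law M V n)" and rdB: "real_distribution (sample_mean_law M U n)"
    by (intro real_distribution_sample_mean_law prob_space_axioms meas)+
  have stL: "lindley_stationary \<mu> L"
    unfolding \<mu>_def L_def by (rule steady_state_lindley_stationary[OF st c rdA rdB])
  have rd\<mu>: "real_distribution \<mu>" unfolding \<mu>_def by (rule real_distribution_increment_law[OF rdA rdB])
  have rd\<nu>: "real_distribution \<nu>" unfolding \<nu>_def by (rule real_distribution_normal)
  note nm = normal_tilted_moments[of \<beta>, folded \<nu>_def]
  have less\<nu>: "(LINT x|\<nu>. exp (\<beta> * x)) < 1" unfolding nm(2) using \<beta>0 by simp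
  have stK: "lindley_stationary \<nu> K"
    unfolding K_def gaussian_steps_def \<nu>_def[symmetric]
    by (rule lindley_stationary_walk_max[OF rd\<nu> \<beta>0 nm(1) less\<nu>])
  \<comment> \<open>The scaling turns the exponent \<beta> into the tilt x of a single summand:
    \<beta> c/n = x. The line Re z = \<beta> is thus the line through the saddle point.\<close>
  have tilt: "(complex_of_real \<beta> + \<i> * complex_of_real t) * complex_of_real c / of_nat n
      = complex_of_real x + \<i> * complex_of_real (t / (\<sigma> * sqrt (real n)))" for t
  proof -
    have "\<beta> * c / real n = x" using n0 \<sigma>0 by (simp add: \<beta> c_def)
    moreover have "t * c / real n = t / (\<sigma> * sqrt (real n))"
      using n0 \<sigma>0 by (simp add: c_def field_simps)
    ultimately show ?thesis
      by (simp add: complex_eq_iff)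
  qed
  have x\<delta>: "x \<le> \<delta> / 4" using x adm by (simp add: admissible_def)
  have V: "integrable M (\<lambda>\<omega>. exp ((complex_of_real x + \<i> * complex_of_real u) * complex_of_real (V \<omega>)))" for u
    using x x\<delta> \<delta>_pos by (intro intV) simp
  have U: "integrable M (\<lambda>\<omega>. exp (- ((complex_of_real x + \<i> * complex_of_real u) / complex_of_real r) * complex_of_real (U \<omega>)))" for u
  proof (intro intU)
    \<comment> \<open>Dividing by r \<ge> 1/2 at most doubles the tilt, and 2x \<le> \<delta>/2
      stays within the range of \<open>intU\<close>.\<close>
    have "x / r \<le> x / (1 / 2)" using x r by (intro divide_left_mono) auto
    thus "\<bar>Re (- ((complex_of_real x + \<i> * complex_of_real u) / complex_of_real r))\<bar> \<le> \<delta>"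
      using x x\<delta> \<delta>_pos r by (simp add: Re_divide_of_real)
  qed
  have psi_a: "psi M V U r (complex_of_real x + \<i> * complex_of_real (t / (\<sigma> * sqrt (real n)))) = a t" for t
    unfolding psi_def a_def Y ..
  have int_c: "integrable \<mu> (\<lambda>y. exp ((complex_of_real \<beta> + \<i> * complex_of_real t) * complex_of_real y))"
    and cm: "cmgf \<mu> (complex_of_real \<beta> + \<i> * complex_of_real t) = a t ^ n" for t
    using increment_law_sample_mean_cmgf[OF prob_space_axioms ind n0(2) tilt[of t, symmetric] V U]
    unfolding \<mu>_def psi_a by auto
  have int\<mu>: "integrable \<mu> (\<lambda>y. exp (\<beta> * y))"
    using integrable_norm[OF int_c[of 0]] by simp
  have char: "\<bar>t\<bar> \<le> R * sqrt (real n) \<Longrightarrow>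
      cmod (cmgf \<mu> (complex_of_real \<beta> + \<i> * complex_of_real t) - cmgf \<nu> (complex_of_real \<beta> + \<i> * complex_of_real t)) \<le> 130 * C * \<epsilon>"
    "cmod (cmgf \<mu> (complex_of_real \<beta> + \<i> * complex_of_real t) - cmgf \<nu> (complex_of_real \<beta> + \<i> * complex_of_real t)) \<le> 2" for t
    using tilted_char_power_diff[OF adm x n \<sigma> \<beta> b(3), of a t]
    unfolding cm nm(3) R_def C_def \<epsilon>_def a_def by auto
  have small': "130 * C * \<epsilon> \<le> (1 - q) / 2" using small by (simp add: C_def \<epsilon>_def q_def)
  have le_q: "exp (- \<beta>\<^sup>2 / 2) \<le> q"
    using b power_mono[of b1 \<beta> 2] by (simp add: q_def)
  \<comment> \<open>At t = 0 the transform estimate compares the real exponential moments. Its error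
    is at most (1 - q)/2, while the Gaussian moment is at most q.\<close>
  have lam: "(LINT y|\<mu>. exp (\<beta> * y)) \<le> (1 + q) / 2"
  proof -
    have "cmgf \<mu> (complex_of_real \<beta> + \<i> * complex_of_real 0) = (LINT y|\<mu>. complex_of_real (exp (\<beta> * y)))"
      unfolding cmgf_def by (simp add: exp_of_real[symmetric])
    also have "\<dots> = complex_of_real (LINT y|\<mu>. exp (\<beta> * y))" by (rule integral_complex_of_real)
    finally have 1: "cmgf \<mu> (complex_of_real \<beta> + \<i> * complex_of_real 0) = complex_of_real (LINT y|\<mu>. exp (\<beta> * y))" .
    have "cmod (cmgf \<mu> (complex_of_real \<beta> + \<i> * complex_of_real 0) - cmgf \<nu> (complex_of_real \<beta> + \<i> * complex_of_real 0)) \<le> 130 * C * \<epsilon>"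
      using R n0 by (intro char(1)) simp
    hence "\<bar>(LINT y|\<mu>. exp (\<beta> * y)) - exp (- \<beta>\<^sup>2 / 2)\<bar> \<le> 130 * C * \<epsilon>"
      unfolding 1 nm(3) of_real_diff[symmetric] norm_of_real by simp
    thus ?thesis using small' le_q by argo
  qed
  have less\<mu>: "(LINT y|\<mu>. exp (\<beta> * y)) < 1" by (rule le_less_trans[OF lam]) (use q in simp)
  define D where "D = (65 * C / b1 + 2 / R) * \<epsilon>"
  have D0: "0 \<le> D" unfolding D_def using C b R \<epsilon> by auto
  have D: "exp (\<beta> * y) * \<bar>stop_loss \<mu> y - stop_loss \<nu> y\<bar> \<le> D" for y
  proof -
    have "exp (\<beta> * y) * \<bar>stop_loss \<mu> y - stop_loss \<nu> y\<bar>
      \<le> (LBINT t. cmod (cmgf \<mu> (complex_of_real \<beta> + \<i> * complex_of_real t) - cmgf \<nu> (complex_of_real \<beta> + \<i> * complex_of_real t)) / (\<beta>\<^sup>2 + t\<^sup>2)) / (2 * pi)"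
      by (rule stop_loss_diff_le[OF rd\<mu> rd\<nu> \<beta>0 int\<mu> nm(1)])
    also have "\<dots> \<le> pi * ((130 * C * \<epsilon>) / \<beta> + 4 / (R * sqrt (real n))) / (2 * pi)"
    proof (intro divide_right_mono integral_split_bound)
      show "integrable lborel (\<lambda>t. cmod (cmgf \<mu> (complex_of_real \<beta> + \<i> * complex_of_real t) - cmgf \<nu> (complex_of_real \<beta> + \<i> * complex_of_real t)) / (\<beta>\<^sup>2 + t\<^sup>2))"
        by (rule integrable_cmgf_diff[OF rd\<mu> rd\<nu> \<beta>0])
    qed (use \<beta>0 R n0 C \<epsilon> char in auto)
    also have "\<dots> = 65 * C * \<epsilon> / \<beta> + 2 / R * \<epsilon>"
      by (simp add: \<epsilon>_def field_simps)
    also have "65 * C * \<epsilon> / \<beta> \<le> 65 * C * \<epsilon> / b1"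
      using C \<epsilon> b \<beta>0 by (intro divide_left_mono) auto
    finally show ?thesis by (simp add: D_def algebra_simps)
  qed
  define N where "N = 2 * D / (1 - q)\<^sup>2"
  have N: "exp (\<beta> * y) * \<bar>stop_loss L y - stop_loss K y\<bar> \<le> N" if "0 \<le> y" for y
  proof -
    have "exp (\<beta> * y) * \<bar>stop_loss L y - stop_loss K y\<bar>
        \<le> D / ((1 - (LINT x|\<mu>. exp (\<beta> * x))) * (1 - (LINT x|\<nu>. exp (\<beta> * x))))"
      by (rule stationary_stop_loss_diff_le[OF stL stK \<beta>0 int\<mu> less\<mu> nm(1) less\<nu> D that])
    also have "\<dots> \<le> D / ((1 - q) / 2 * (1 - q))"
    proof (rule divide_left_mono)
      have l: "(1 - q) / 2 \<le> 1 - (LINT x|\<mu>. exp (\<beta> * x))" using diff_left_mono[OF lam, of 1] by (simp add: field_simps)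
      have k: "1 - q \<le> 1 - (LINT x|\<nu>. exp (\<beta> * x))" unfolding nm(2) using le_q by simp
      show "(1 - q) / 2 * (1 - q) \<le> (1 - (LINT x|\<mu>. exp (\<beta> * x))) * (1 - (LINT x|\<nu>. exp (\<beta> * x)))"
        using q less\<mu> by (intro mult_mono l k) auto
      show "0 < (1 - (LINT x|\<mu>. exp (\<beta> * x))) * (1 - (LINT x|\<nu>. exp (\<beta> * x))) * ((1 - q) / 2 * (1 - q))"
        using q less\<mu> less\<nu> by (intro mult_pos_pos) auto
    qed (rule D0)
    also have "\<dots> = N" using q by (simp add: N_def power2_eq_square)
    finally show ?thesis .
  qed
  note mL = lindley_stationary_exp_moment(1)[OF stL \<beta>0 int\<mu> less\<mu>]
  note mK = lindley_stationary_exp_moment(1)[OF stK \<beta>0 nm(1) less\<nu>]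
  have rdL: "real_distribution L" "AE w in L. 0 \<le> w" and rdK: "real_distribution K" "AE w in K. 0 \<le> w"
    using stL stK by (auto simp: lindley_stationary_def)
  \<comment> \<open>The half plane of the theorem corresponds to \<theta>' = \<beta>/2, which leaves
    the margin \<beta>/2.\<close>
  have s': "- (\<beta> / 2) \<le> Re s" "\<beta> / 2 < \<beta>" using s \<beta>0 by auto
  have W [measurable]: "W \<in> borel_measurable Q" using st by (simp add: steady_state_waiting_time_def)
  have wm [measurable]: "walk_max \<in> borel_measurable (gaussian_steps \<beta>)"
    unfolding gaussian_steps_def by (rule walk_max_measurable) simp
  have iL: "integrable L (\<lambda>w. exp (- s * complex_of_real w))"
    by (rule real_distribution.laplace_stop_loss(1)[OF rdL \<beta>0 mL s'])
  have iK: "integrable K (\<lambda>w. exp (- s * complex_of_real w))"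
    by (rule real_distribution.laplace_stop_loss(1)[OF rdK \<beta>0 mK s'])
  show "integrable Q (\<lambda>\<omega>. exp (- s * complex_of_real (sqrt (real n) / \<sigma> * W \<omega>)))"
    using iL unfolding L_def c_def[symmetric] by (subst (asm) integrable_distr_eq) auto
  show "integrable (gaussian_steps \<beta>) (\<lambda>x. exp (- s * complex_of_real (walk_max x)))"
    using iK unfolding K_def by (subst (asm) integrable_distr_eq) auto
  have cL: "(LINT \<omega>|Q. exp (- s * complex_of_real (sqrt (real n) / \<sigma> * W \<omega>))) = cmgf L (- s)"
    unfolding cmgf_def L_def c_def[symmetric] by (subst integral_distr) auto
  have cK: "(LINT x|gaussian_steps \<beta>. exp (- s * complex_of_real (walk_max x))) = cmgf K (- s)"
    unfolding cmgf_def K_def by (subst integral_distr) auto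
  have "cmod (cmgf L (- s) - cmgf K (- s)) \<le> N * (cmod s + (cmod s)\<^sup>2 / (\<beta> - \<beta> / 2))"
    by (rule laplace_diff_le[OF rdL(1) rdK(1) rdL(2) rdK(2) \<beta>0 mL mK s' N])
  also have "\<dots> \<le> N * (cmod s + 2 * (cmod s)\<^sup>2 / b1)"
  proof (intro mult_left_mono add_left_mono)
    have "(cmod s)\<^sup>2 / (\<beta> - \<beta> / 2) = 2 * (cmod s)\<^sup>2 / \<beta>" by simp
    also have "\<dots> \<le> 2 * (cmod s)\<^sup>2 / b1" using b \<beta>0 by (intro divide_left_mono) auto
    finally show "(cmod s)\<^sup>2 / (\<beta> - \<beta> / 2) \<le> 2 * (cmod s)\<^sup>2 / b1" .
    show "0 \<le> N" using D0 by (simp add: N_def)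
  qed
  also have "\<dots> = 2 * (65 * C / b1 + 2 / R) / (1 - q)\<^sup>2 * (cmod s + 2 * (cmod s)\<^sup>2 / b1) / sqrt (real n)"
    by (simp add: N_def D_def \<epsilon>_def)
  finally show "cmod ((LINT \<omega>|Q. exp (- s * complex_of_real (sqrt (real n) / \<sigma> * W \<omega>)))
        - (LINT x|gaussian_steps \<beta>. exp (- s * complex_of_real (walk_max x))))
      \<le> 2 * (65 * char_const v b2 / b1 + 2 / char_radius v) / (1 - exp (- b1\<^sup>2 / 2))\<^sup>2
          * (cmod s + 2 * (cmod s)\<^sup>2 / b1) / sqrt (real n)"
    unfolding cL cK C_def R_def q_def .
qed

end

text \<open>What remains is to fix all constants before n: \<delta>, \<open>B\<close> and
  \<open>v\<close> serve every \<rho> n \<ge> 1/2, \<eta> is derived from them, and the conditions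
  still depending on n and d hold eventually.\<close>

theorem theorem3:
  fixes M :: "'a measure" and V U :: "'a \<Rightarrow> real"
    and Q :: "nat \<Rightarrow> 'b measure" and W :: "nat \<Rightarrow> 'b \<Rightarrow> real"
    and \<rho> :: "nat \<Rightarrow> real" and \<delta>\<^sub>0 \<beta>\<^sub>1 \<beta>\<^sub>2 :: real
  assumes "prob_space M"
    and "prob_space.indep_var M borel V borel U"
    and "AE \<omega> in M. 0 \<le> V \<omega>" and "AE \<omega> in M. 0 \<le> U \<omega>"
    and "integrable M V" and "prob_space.expectation M V = 1"
    and "integrable M U" and "prob_space.expectation M U = 1"
    and "integrable M (\<lambda>\<omega>. (V \<omega>)\<^sup>2)" and "integrable M (\<lambda>\<omega>. (U \<omega>)\<^sup>2)"
    and "0 < prob_space.variance M V + prob_space.variance M U"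
    and "0 < \<delta>\<^sub>0" and "mgf_analytic_on_strip M V \<delta>\<^sub>0" and "mgf_analytic_on_strip M U \<delta>\<^sub>0"
    and "separation M V U"
    and "\<And>n. 1 \<le> n \<Longrightarrow> 0 < \<rho> n \<and> \<rho> n < 1"
    and "0 < \<beta>\<^sub>1" and "\<beta>\<^sub>1 \<le> \<beta>\<^sub>2"
    and "\<And>n. 1 \<le> n \<Longrightarrow> (1 - \<rho> n) * sqrt (real n) \<in> {\<beta>\<^sub>1..\<beta>\<^sub>2}"
    and "\<And>n. 1 \<le> n \<Longrightarrow> steady_state_waiting_time M V U (\<rho> n) n (Q n) (W n)"
  shows "\<exists>\<eta>>0. \<forall>d\<in>{0<..\<eta>}.
    (\<forall>\<^sub>F n in sequentially. \<exists>!\<zeta>. is_saddle_point M V U d (\<rho> n) \<zeta>) \<and>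
    (let \<zeta>sp = (\<lambda>n. saddle_point M V U d (\<rho> n));
         \<sigma> = (\<lambda>n. sqrt (deriv (deriv (log_psi M V U (\<rho> n))) (\<zeta>sp n)));
         \<beta> = (\<lambda>n. - \<zeta>sp n * \<sigma> n * sqrt (real n))
     in asymp_one \<sigma> \<and> asymp_one \<beta> \<and>
        (\<forall>S::complex set. bounded S \<longrightarrow>
          (\<exists>K n\<^sub>0. \<forall>n\<ge>n\<^sub>0. \<forall>s\<in>S. Re s \<ge> - (1/2) * \<beta> n \<longrightarrow>
            integrable (Q n)
              (\<lambda>\<omega>. exp (- s * complex_of_real (sqrt (real n) / \<sigma> n * W n \<omega>))) \<and>
            integrable (gaussian_steps (\<beta> n))
              (\<lambda>x. exp (- s * complex_of_real (walk_max x))) \<and>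
            cmod ((LINT \<omega>|Q n. exp (- s * complex_of_real (sqrt (real n) / \<sigma> n * W n \<omega>)))
                - (LINT x|gaussian_steps (\<beta> n). exp (- s * complex_of_real (walk_max x))))
              \<le> K / sqrt (real n))))"
proof -
  interpret prob_space M by fact
  note ind = assms(2)
  have [measurable]: "V \<in> borel_measurable M" "U \<in> borel_measurable M"
    using indep_var_rv1[OF ind] indep_var_rv2[OF ind] by auto
  have strip: "integrable M (\<lambda>\<omega>. exp (z * complex_of_real (X \<omega>)))"
    if X: "mgf_analytic_on_strip M X \<delta>\<^sub>0" "\<bar>Re z\<bar> \<le> \<delta>\<^sub>0" for X z
  proof -
    obtain a b where ab: "a < - \<delta>\<^sub>0" "\<delta>\<^sub>0 < b"
      and int: "\<forall>z::complex. a < Re z \<and> Re z < b \<longrightarrow> integrable M (\<lambda>\<omega>. exp (z * complex_of_real (X \<omega>)))"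
      using X(1) unfolding mgf_analytic_on_strip_def by blast
    have "a < Re z \<and> Re z < b" using ab X(2) by linarith
    with int show ?thesis by blast
  qed
  have strip_real: "integrable M (\<lambda>\<omega>. exp (\<delta>\<^sub>0 * X \<omega>))" if "mgf_analytic_on_strip M X \<delta>\<^sub>0" for X
    using integrable_norm[OF strip[OF that, of "complex_of_real \<delta>\<^sub>0"]] \<open>0 < \<delta>\<^sub>0\<close> by simp
  note eV = strip_real[OF assms(13)] and eU = strip_real[OF assms(14)]
  \<comment> \<open>For r \<ge> 1/2 and nonnegative V, U one has |V - U/r| \<le> V + 2U \<le> 4
    max(V,U), hence the divisor 4 and the bound \<open>B\<close> for all such r at once.\<close>
  define \<delta> where "\<delta> = \<delta>\<^sub>0 / 4"
  define B where "B = expectation (\<lambda>\<omega>. exp (\<delta>\<^sub>0 * V \<omega>)) + expectation (\<lambda>\<omega>. exp (\<delta>\<^sub>0 * U \<omega>))"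
  have \<delta>: "0 < \<delta>" using \<open>0 < \<delta>\<^sub>0\<close> by (simp add: \<delta>_def)
  have EM: "exp_moment M (\<lambda>\<omega>. V \<omega> - U \<omega> / r) \<delta> B" if r: "1 / 2 \<le> r" for r
  proof -
    have pt: "exp (\<delta> * \<bar>V \<omega> - U \<omega> / r\<bar>) \<le> exp (\<delta>\<^sub>0 * V \<omega>) + exp (\<delta>\<^sub>0 * U \<omega>)"
      if nn: "0 \<le> V \<omega>" "0 \<le> U \<omega>" for \<omega>
    proof -
      have "U \<omega> / r \<le> U \<omega> / (1 / 2)" "0 \<le> U \<omega> / r"
        using nn r by (intro divide_left_mono divide_nonneg_pos; simp)+
      hence "\<bar>V \<omega> - U \<omega> / r\<bar> \<le> V \<omega> + 2 * U \<omega>" using nn by (simp add: abs_le_iff)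
      also have "\<dots> \<le> 4 * max (V \<omega>) (U \<omega>)" using nn by (simp add: max_def)
      finally have "\<delta> * \<bar>V \<omega> - U \<omega> / r\<bar> \<le> \<delta> * (4 * max (V \<omega>) (U \<omega>))"
        using \<delta> by (intro mult_left_mono) auto
      also have "\<dots> = \<delta>\<^sub>0 * max (V \<omega>) (U \<omega>)" by (simp add: \<delta>_def)
      finally have "exp (\<delta> * \<bar>V \<omega> - U \<omega> / r\<bar>) \<le> exp (\<delta>\<^sub>0 * max (V \<omega>) (U \<omega>))" by simp
      also have "\<dots> \<le> exp (\<delta>\<^sub>0 * V \<omega>) + exp (\<delta>\<^sub>0 * U \<omega>)" by (simp add: max_def)
      finally show ?thesis .
    qed
    have ae: "AE \<omega> in M. exp (\<delta> * \<bar>V \<omega> - U \<omega> / r\<bar>) \<le> exp (\<delta>\<^sub>0 * V \<omega>) + exp (\<delta>\<^sub>0 * U \<omega>)"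
      using assms(3,4) by eventually_elim (rule pt)
    have i: "integrable M (\<lambda>\<omega>. exp (\<delta> * \<bar>V \<omega> - U \<omega> / r\<bar>))"
      by (rule Bochner_Integration.integrable_bound[OF Bochner_Integration.integrable_add[OF eV eU]])
        (use ae in \<open>auto elim!: eventually_mono\<close>)
    have "expectation (\<lambda>\<omega>. exp (\<delta> * \<bar>V \<omega> - U \<omega> / r\<bar>)) \<le> expectation (\<lambda>\<omega>. exp (\<delta>\<^sub>0 * V \<omega>) + exp (\<delta>\<^sub>0 * U \<omega>))"
      by (rule integral_mono_AE[OF i Bochner_Integration.integrable_add[OF eV eU] ae])
    also have "\<dots> = B" unfolding B_def by (rule Bochner_Integration.integral_add[OF eV eU])
    finally show ?thesis
      using \<delta> i by unfold_locales auto
  qed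
  \<comment> \<open>The second moment of V - U/r is Var V + Var U/r^2 + (1 - 1/r)^2, so
    \<open>v\<close> bounds it from below uniformly in r < 1.\<close>
  define v where "v = variance V + variance U"
  have v: "0 < v" using assms(11) by (simp add: v_def)
  have VU: "integrable M (\<lambda>\<omega>. V \<omega> * U \<omega>)" "expectation (\<lambda>\<omega>. V \<omega> * U \<omega>) = 1"
    using indep_var_integrable[OF ind assms(5,7)] indep_var_lebesgue_integral[OF ind assms(5,7)] assms(6,8) by auto
  have second: "v \<le> exp_moment.moment M (\<lambda>\<omega>. V \<omega> - U \<omega> / r) 2 0"
    and first: "exp_moment.moment M (\<lambda>\<omega>. V \<omega> - U \<omega> / r) 1 0 = 1 - 1 / r" if r: "1 / 2 \<le> r" "r < 1" for r
  proof -
    note m = exp_moment.moment_def[OF EM[OF r(1)]]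
    have var: "variance V = expectation (\<lambda>\<omega>. (V \<omega>)\<^sup>2) - 1" "variance U = expectation (\<lambda>\<omega>. (U \<omega>)\<^sup>2) - 1"
      using variance_eq[OF assms(5,9)] variance_eq[OF assms(7,10)] assms(6,8) by simp_all
    have "expectation (\<lambda>\<omega>. (V \<omega> - U \<omega> / r)\<^sup>2)
        = expectation (\<lambda>\<omega>. (V \<omega>)\<^sup>2 - 2 / r * (V \<omega> * U \<omega>) + 1 / r\<^sup>2 * (U \<omega>)\<^sup>2)"
      using r by (intro Bochner_Integration.integral_cong) (auto simp: power2_eq_square field_simps)
    also have "\<dots> = expectation (\<lambda>\<omega>. (V \<omega>)\<^sup>2) - 2 / r * 1 + 1 / r\<^sup>2 * expectation (\<lambda>\<omega>. (U \<omega>)\<^sup>2)"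
      using assms(9,10) VU by simp
    also have "\<dots> = variance V + 1 / r\<^sup>2 * variance U + (1 - 1 / r)\<^sup>2"
      unfolding var by (simp add: power2_eq_square algebra_simps)
    finally have eq: "expectation (\<lambda>\<omega>. (V \<omega> - U \<omega> / r)\<^sup>2) = variance V + 1 / r\<^sup>2 * variance U + (1 - 1 / r)\<^sup>2" .
    have m2: "exp_moment.moment M (\<lambda>\<omega>. V \<omega> - U \<omega> / r) 2 0 = variance V + 1 / r\<^sup>2 * variance U + (1 - 1 / r)\<^sup>2"
      unfolding m eq[symmetric] by simp
    have "1 * variance U \<le> 1 / r\<^sup>2 * variance U"
      using r by (intro mult_right_mono variance_positive) (auto simp: power_le_one)
    thus "v \<le> exp_moment.moment M (\<lambda>\<omega>. V \<omega> - U \<omega> / r) 2 0"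
      using zero_le_power2[of "1 - 1 / r"] unfolding m2 v_def by linarith
    show "exp_moment.moment M (\<lambda>\<omega>. V \<omega> - U \<omega> / r) 1 0 = 1 - 1 / r"
      unfolding m using assms(5-8) by simp
  qed
  \<comment> \<open>The constants of the locale depend on \<delta> and \<open>B\<close> alone; r = 1
    merely provides an instance from which their properties can be read off.\<close>
  note EM1 = EM[of 1, simplified]
  define K where "K = exp_moment.bnd \<delta> B"
  have K: "0 \<le> K k" for k unfolding K_def by (rule exp_moment.bnd_ge_0[OF EM1])
  \<comment> \<open>One entry for each upper bound in \<open>admissible\<close>; the added 1 guards
    against vanishing denominators.\<close>
  define \<eta> where "\<eta> = min (\<delta> / 4) (min (v / (2 * (K 3 + 1))) (1 / (2 * (K 1 + 1))))"
  have \<eta>: "0 < \<eta>" unfolding \<eta>_def using \<delta> v K[of 3] K[of 1] by (auto intro!: divide_pos_pos add_nonneg_pos)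
  have adm: "exp_moment.admissible \<delta> B v \<eta>"
    unfolding exp_moment.admissible_def[OF EM1] K_def[symmetric]
  proof (intro conjI v \<eta>)
    show "\<eta> \<le> \<delta> / 4" unfolding \<eta>_def by (rule min.cobounded1)
    have "\<eta> * (K 3 + 1) \<le> v / (2 * (K 3 + 1)) * (K 3 + 1)"
      using K[of 3] by (intro mult_right_mono) (auto simp: \<eta>_def)
    also have "\<dots> = v / 2" using K[of 3] by (simp add: field_simps)
    finally show "\<eta> * K 3 \<le> v / 2" using \<eta> by (simp add: distrib_left)
    have "\<eta> * (K 1 + 1) \<le> 1 / (2 * (K 1 + 1)) * (K 1 + 1)"
      using K[of 1] by (intro mult_right_mono) (auto simp: \<eta>_def)
    also have "\<dots> = 1 / 2" using K[of 1] by (simp add: field_simps)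
    finally show "\<eta> * K 1 \<le> 1 / 2" using \<eta> by (simp add: distrib_left)
  qed
  show ?thesis
  proof (intro exI[of _ \<eta>] conjI ballI \<eta>)
    fix d assume "d \<in> {0<..\<eta>}"
    hence d: "0 < d" "d \<le> \<eta>" by auto
    define \<zeta>sp where "\<zeta>sp = (\<lambda>n. saddle_point M V U d (\<rho> n))"
    define \<sigma> where "\<sigma> = (\<lambda>n. sqrt (deriv (deriv (log_psi M V U (\<rho> n))) (\<zeta>sp n)))"
    define \<beta> where "\<beta> = (\<lambda>n. - \<zeta>sp n * \<sigma> n * sqrt (real n))"
    \<comment> \<open>\<beta> n is the product of x sqrt n and \<sigma> n. The former lies between
      \<open>\<beta>\<^sub>1 / (K 2 + 1)\<close> and \<open>4 * \<beta>\<^sub>2 / v\<close>, the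
      latter between sqrt(v/2) and \<open>sqrt (2 * K 2)\<close>.\<close>
    define b1 where "b1 = \<beta>\<^sub>1 / (K 2 + 1) * sqrt (v / 2)"
    define b2 where "b2 = 4 * \<beta>\<^sub>2 / v * sqrt (2 * K 2)"
    have b1: "0 < b1" unfolding b1_def using \<open>0 < \<beta>\<^sub>1\<close> K[of 2] v by (auto intro!: mult_pos_pos divide_pos_pos)
    \<comment> \<open>The bound on \<rho> n gives access to the common moment bound. The last
      condition makes the drift, at most \<open>2 * \<beta>\<^sub>2 / sqrt (real n)\<close>, small
      enough for the critical point to lie in the interval of length d.\<close>
    define good where "good = (\<lambda>n::nat. 2 \<le> n \<and> 1 / 2 \<le> \<rho> n \<and> 2 * \<beta>\<^sub>2 / sqrt (real n) \<le> v / 2 * d)"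
    have lim: "(\<lambda>n. c / sqrt (real n)) \<longlonglongrightarrow> 0" for c :: real
      by (rule tendsto_divide_0[OF tendsto_const filterlim_at_top_imp_at_infinity])
         (rule filterlim_compose[OF sqrt_at_top filterlim_real_sequentially])
    have small: "\<forall>\<^sub>F n in sequentially. c / sqrt (real n) \<le> e" if "0 < e" for c e :: real
      using order_tendstoD(2)[OF lim[of c] that] by eventually_elim simp
    have "\<forall>\<^sub>F n in sequentially. \<beta>\<^sub>2 / sqrt (real n) \<le> 1 / 2"
      "\<forall>\<^sub>F n in sequentially. 2 * \<beta>\<^sub>2 / sqrt (real n) \<le> v / 2 * d"
      using v d by (intro small; simp)+
    with eventually_ge_at_top[of "2::nat"] have ev_good: "\<forall>\<^sub>F n in sequentially. good n"
    proof eventually_elim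
      case (elim n)
      have "1 - \<rho> n \<le> \<beta>\<^sub>2 / sqrt (real n)"
        using assms(19)[of n] elim(1) by (simp add: field_simps)
      hence "1 / 2 \<le> \<rho> n" using elim(2) by linarith
      thus ?case unfolding good_def using elim(1,3) by blast
    qed
    have key: "(\<exists>!\<zeta>. is_saddle_point M V U d (\<rho> n) \<zeta>) \<and> sqrt (v / 2) \<le> \<sigma> n \<and> \<sigma> n \<le> sqrt (2 * K 2) \<and> b1 \<le> \<beta> n \<and> \<beta> n \<le> b2 \<and>
        (\<exists>x. 0 \<le> x \<and> x \<le> \<eta> \<and> exp_moment.moment M (\<lambda>\<omega>. V \<omega> - U \<omega> / \<rho> n) 1 x = 0 \<and>
           \<sigma> n = sqrt (exp_moment.moment M (\<lambda>\<omega>. V \<omega> - U \<omega> / \<rho> n) 2 x / exp_moment.moment M (\<lambda>\<omega>. V \<omega> - U \<omega> / \<rho> n) 0 x) \<and>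
           \<beta> n = x * \<sigma> n * sqrt (real n))" if "good n" for n
    proof -
      have n: "2 \<le> n" "1 / 2 \<le> \<rho> n" "2 * \<beta>\<^sub>2 / sqrt (real n) \<le> v / 2 * d" using that by (auto simp: good_def)
      have \<rho>: "\<rho> n < 1" "0 < \<rho> n" using assms(16)[of n] n by auto
      have rn: "0 < sqrt (real n)" using n by simp
      interpret Y: exp_moment M "\<lambda>\<omega>. V \<omega> - U \<omega> / \<rho> n" \<delta> B by (rule EM[OF n(2)])
      note second' = second[OF n(2) \<rho>(1)] and first' = first[OF n(2) \<rho>(1)]
      have m1: "- Y.moment 1 0 = (1 - \<rho> n) / \<rho> n" unfolding first' using \<rho> by (simp add: field_simps)
      have low: "\<beta>\<^sub>1 / sqrt (real n) \<le> 1 - \<rho> n" and up: "1 - \<rho> n \<le> \<beta>\<^sub>2 / sqrt (real n)"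
        using assms(19)[of n] n(1) rn by (simp_all add: field_simps)
      have "(1 - \<rho> n) / \<rho> n \<le> (\<beta>\<^sub>2 / sqrt (real n)) / (1 / 2)"
        using up n \<rho> by (intro frac_le) auto
      hence up': "- Y.moment 1 0 \<le> 2 * \<beta>\<^sub>2 / sqrt (real n)" unfolding m1 by (simp add: mult.commute)
      have "(1 - \<rho> n) * \<rho> n \<le> (1 - \<rho> n) * 1" using \<rho> by (intro mult_left_mono) auto
      hence "1 - \<rho> n \<le> (1 - \<rho> n) / \<rho> n" using \<rho> by (simp add: pos_le_divide_eq)
      hence low': "\<beta>\<^sub>1 / sqrt (real n) \<le> - Y.moment 1 0" unfolding m1 using low by linarith
      have neg: "Y.moment 1 0 \<le> 0" using low' \<open>0 < \<beta>\<^sub>1\<close> rn by (smt (verit) divide_pos_pos)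
      have "- Y.moment 1 0 \<le> v / 2 * d" using up' n(3) by linarith
      note sp = Y.saddle_point_exists[OF refl adm second' d neg this]
      obtain x where x: "\<zeta>sp n = - x" "0 \<le> x" "x \<le> \<eta>" "Y.moment 1 x = 0"
        "deriv (deriv (log_psi M V U (\<rho> n))) (- x) = Y.moment 2 x / Y.moment 0 x"
        using sp(2) unfolding \<zeta>sp_def by blast
      note cb = Y.critical_bounds[OF adm second' x(2-4), folded K_def]
      have \<sigma>: "\<sigma> n = sqrt (Y.moment 2 x / Y.moment 0 x)" unfolding \<sigma>_def x(1) x(5) ..
      have \<sigma>_le: "sqrt (v / 2) \<le> \<sigma> n" "\<sigma> n \<le> sqrt (2 * K 2)"
        unfolding \<sigma> using cb(4,5) by (auto intro: real_sqrt_le_mono)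
      have \<sigma>_nonneg: "0 \<le> \<sigma> n" using order_trans[OF _ \<sigma>_le(1)] v by simp
      have \<beta>: "\<beta> n = x * \<sigma> n * sqrt (real n)" unfolding \<beta>_def x(1) by simp
      have xs: "\<beta>\<^sub>1 / (K 2 + 1) \<le> x * sqrt (real n)" "x * sqrt (real n) \<le> 4 * \<beta>\<^sub>2 / v"
      proof -
        have "\<beta>\<^sub>1 / sqrt (real n) \<le> (K 2 + 1) * x"
          using low' cb(2) x(2) by (simp add: distrib_right)
        thus "\<beta>\<^sub>1 / (K 2 + 1) \<le> x * sqrt (real n)" using rn K[of 2] by (simp add: field_simps)
        have "v / 2 * x \<le> 2 * \<beta>\<^sub>2 / sqrt (real n)" using up' cb(1) by linarith
        thus "x * sqrt (real n) \<le> 4 * \<beta>\<^sub>2 / v" using rn v by (simp add: field_simps)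
      qed
      have \<beta>': "\<beta> n = (x * sqrt (real n)) * \<sigma> n" unfolding \<beta> by simp
      have "b1 \<le> \<beta> n" unfolding \<beta>' b1_def
        using xs \<sigma>_le v x(2) by (intro mult_mono) auto
      moreover have "\<beta> n \<le> b2" unfolding \<beta>' b2_def
        using xs \<sigma>_le \<sigma>_nonneg v \<open>0 < \<beta>\<^sub>1\<close> \<open>\<beta>\<^sub>1 \<le> \<beta>\<^sub>2\<close> by (intro mult_mono) auto
      ultimately show ?thesis using sp(1) \<sigma>_le x \<sigma> \<beta> by blast
    qed
    show "\<forall>\<^sub>F n in sequentially. \<exists>!\<zeta>. is_saddle_point M V U d (\<rho> n) \<zeta>"
      using ev_good by eventually_elim (use key in blast)
    have asym_\<sigma>: "asymp_one \<sigma>" unfolding asymp_one_def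
    \<comment> \<open>The maximum makes the required order of the two constants immediate.\<close>
    proof (rule exI[of _ "sqrt (v / 2)"], rule exI[of _ "max (sqrt (v / 2)) (sqrt (2 * K 2))"], intro conjI)
      show "\<forall>\<^sub>F n in sequentially. sqrt (v / 2) \<le> \<sigma> n \<and> \<sigma> n \<le> max (sqrt (v / 2)) (sqrt (2 * K 2))"
        using ev_good by eventually_elim (use key in \<open>auto simp: le_max_iff_disj\<close>)
    qed (use v in auto)
    have asym_\<beta>: "asymp_one \<beta>" unfolding asymp_one_def
    proof (rule exI[of _ b1], rule exI[of _ "max b1 b2"], intro conjI b1)
      show "\<forall>\<^sub>F n in sequentially. b1 \<le> \<beta> n \<and> \<beta> n \<le> max b1 b2"
        using ev_good by eventually_elim (use key in \<open>auto simp: le_max_iff_disj\<close>)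
    qed auto
    define C where "C = exp_moment.char_const \<delta> B v b2"
    define F where "F = 2 * (65 * C / b1 + 2 / exp_moment.char_radius \<delta> B v) / (1 - exp (- b1\<^sup>2 / 2))\<^sup>2"
    have main: "\<exists>K n\<^sub>0. \<forall>n\<ge>n\<^sub>0. \<forall>s\<in>S. Re s \<ge> - (1/2) * \<beta> n \<longrightarrow>
            integrable (Q n)
              (\<lambda>\<omega>. exp (- s * complex_of_real (sqrt (real n) / \<sigma> n * W n \<omega>))) \<and>
            integrable (gaussian_steps (\<beta> n))
              (\<lambda>x. exp (- s * complex_of_real (walk_max x))) \<and>
            cmod ((LINT \<omega>|Q n. exp (- s * complex_of_real (sqrt (real n) / \<sigma> n * W n \<omega>)))
                - (LINT x|gaussian_steps (\<beta> n). exp (- s * complex_of_real (walk_max x))))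
              \<le> K / sqrt (real n)" if S: "bounded S" for S :: "complex set"
    proof -
      obtain G where G: "\<And>s. s \<in> S \<Longrightarrow> cmod s \<le> G" using S unfolding bounded_iff by blast
      have "\<forall>\<^sub>F n in sequentially. good n \<and> 130 * C / sqrt (real n) \<le> (1 - exp (- b1\<^sup>2 / 2)) / 2"
        using b1 by (intro eventually_conj ev_good small) simp
      then obtain n\<^sub>0 where n0: "\<And>n. n\<^sub>0 \<le> n \<Longrightarrow> good n \<and> 130 * C / sqrt (real n) \<le> (1 - exp (- b1\<^sup>2 / 2)) / 2"
        unfolding eventually_sequentially by blast
      have "integrable (Q n) (\<lambda>\<omega>. exp (- s * complex_of_real (sqrt (real n) / \<sigma> n * W n \<omega>))) \<and>
            integrable (gaussian_steps (\<beta> n)) (\<lambda>x. exp (- s * complex_of_real (walk_max x))) \<and>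
            cmod ((LINT \<omega>|Q n. exp (- s * complex_of_real (sqrt (real n) / \<sigma> n * W n \<omega>)))
                - (LINT x|gaussian_steps (\<beta> n). exp (- s * complex_of_real (walk_max x))))
              \<le> \<bar>F\<bar> * (G + 2 * G\<^sup>2 / b1) / sqrt (real n)"
        if "n\<^sub>0 \<le> n" "s \<in> S" "Re s \<ge> - (1/2) * \<beta> n" for n s
      proof -
        have gd: "good n" and sm: "130 * C * (1 / sqrt (real n)) \<le> (1 - exp (- b1\<^sup>2 / 2)) / 2"
          using n0[OF that(1)] by auto
        have n: "2 \<le> n" "1 / 2 \<le> \<rho> n" using gd by (auto simp: good_def)
        have \<rho>: "\<rho> n < 1" using assms(16)[of n] n by auto
        interpret Y: exp_moment M "\<lambda>\<omega>. V \<omega> - U \<omega> / \<rho> n" \<delta> B by (rule EM[OF n(2)])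
        obtain x where x: "0 \<le> x" "x \<le> \<eta>" "Y.moment 1 x = 0"
          "\<sigma> n = sqrt (Y.moment 2 x / Y.moment 0 x)" "\<beta> n = x * \<sigma> n * sqrt (real n)"
          and bb: "b1 \<le> \<beta> n" "\<beta> n \<le> b2"
          using key[OF gd] by blast
        have iV: "integrable M (\<lambda>\<omega>. exp (z * complex_of_real (V \<omega>)))"
          and iU: "integrable M (\<lambda>\<omega>. exp (z * complex_of_real (U \<omega>)))" if "\<bar>Re z\<bar> \<le> \<delta>" for z
          using that \<open>0 < \<delta>\<^sub>0\<close> by (intro strip assms(13,14); simp add: \<delta>_def)+
        have ss: "steady_state_waiting_time M V U (\<rho> n) n (Q n) (W n)" using n by (intro assms(20)) simp
        note R = Y.waiting_time_laplace_diff[OF refl ind iV iU n(2) adm second[OF n(2) \<rho>] x(1-3) n(1) x(4,5) b1 bb ss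
            sm[unfolded C_def] that(3)]
        have "0 \<le> G" using G[OF that(2)] norm_ge_zero order_trans by blast
        have "F * (cmod s + 2 * (cmod s)\<^sup>2 / b1) \<le> \<bar>F\<bar> * (G + 2 * G\<^sup>2 / b1)"
          using G[OF that(2)] b1 \<open>0 \<le> G\<close>
          by (intro mult_mono add_mono divide_right_mono mult_left_mono power_mono) auto
        hence "F * (cmod s + 2 * (cmod s)\<^sup>2 / b1) / sqrt (real n) \<le> \<bar>F\<bar> * (G + 2 * G\<^sup>2 / b1) / sqrt (real n)"
          by (rule divide_right_mono) simp
        thus ?thesis using R unfolding F_def C_def by (meson order_trans)
      qed
      thus ?thesis by blast
    qed
    show "let \<zeta>sp = (\<lambda>n. saddle_point M V U d (\<rho> n));
         \<sigma> = (\<lambda>n. sqrt (deriv (deriv (log_psi M V U (\<rho> n))) (\<zeta>sp n)));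
         \<beta> = (\<lambda>n. - \<zeta>sp n * \<sigma> n * sqrt (real n))
     in asymp_one \<sigma> \<and> asymp_one \<beta> \<and>
        (\<forall>S::complex set. bounded S \<longrightarrow>
          (\<exists>K n\<^sub>0. \<forall>n\<ge>n\<^sub>0. \<forall>s\<in>S. Re s \<ge> - (1/2) * \<beta> n \<longrightarrow>
            integrable (Q n)
              (\<lambda>\<omega>. exp (- s * complex_of_real (sqrt (real n) / \<sigma> n * W n \<omega>))) \<and>
            integrable (gaussian_steps (\<beta> n))
              (\<lambda>x. exp (- s * complex_of_real (walk_max x))) \<and>
            cmod ((LINT \<omega>|Q n. exp (- s * complex_of_real (sqrt (real n) / \<sigma> n * W n \<omega>)))
                - (LINT x|gaussian_steps (\<beta> n). exp (- s * complex_of_real (walk_max x))))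
              \<le> K / sqrt (real n)))"
      unfolding Let_def
      by (intro conjI allI impI asym_\<sigma>[unfolded \<sigma>_def \<zeta>sp_def] asym_\<beta>[unfolded \<beta>_def \<sigma>_def \<zeta>sp_def]
            main[unfolded \<beta>_def \<sigma>_def \<zeta>sp_def])
  qed
qed

end
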